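(* Let $\mu_0$ be a probability measure on a $\sigma$-algebra on a set $D\neq\emptyset$, let $H_0=L_2(D,\mu_0)$ have an orthonormal basis $(e_\nu)_{\nu\in\mathbb{N}_0}$ of (pointwise defined) functions with $e_0=1$, and let $(\alpha_{\nu,j})_{\nu,j\in\mathbb{N}}$ be real numbers with $\alpha_{\nu,j}\ge\max(\alpha_{\nu,1},\alpha_{1,j})$ for all $\nu,j\in\mathbb{N}$ and $\alpha_{1,1}>1$. Let $F,H,G$ and, for $c>0$ and a fixed point $a\in D$, $F^c,G^c$ be the tensor product spaces defined in the context. Assume that $G$ is a reproducing kernel Hilbert space (in the sense of the context). Then there exists a constant $0<c_0<1$ such that we have continuous embeddings $$F^{c_0}\hookrightarrow F\hookrightarrow F^{c_0^{-1}}\hookrightarrow\bigotimes_{j\in\mathbb{N}}H_0,\qquad G^{c_0}\hookrightarrow G\hookrightarrow G^{c_0^{-1}}\hookrightarrow\bigotimes_{j\in\mathbb{N}}H_0,\qquad F\hookrightarrow H\hookrightarrow G,$$ and $F^{c_0^{-1}}$ as well as $G^{c_0^{-1}}$ are reproducing kernel Hilbert spaces (of functions on $D^{\mathbb{N}}$).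
   Context: All spaces are over $\mathbb{K}\in\{\mathbb{R},\mathbb{C}\}$; $\langle\cdot,\cdot\rangle_0$ is the scalar product of $H_0$. $H_j:=\{f\in H_0:\sum_{\nu\in\mathbb{N}}\alpha_{\nu,j}|\langle f,e_\nu\rangle_0|^2<\infty\}$ with $\langle f,g\rangle_j:=\langle f,e_0\rangle_0\langle e_0,g\rangle_0+\sum_{\nu\in\mathbb{N}}\alpha_{\nu,j}\langle f,e_\nu\rangle_0\langle e_\nu,g\rangle_0$, $j\in\mathbb{N}$. $\gamma_j:=\sup_{\nu\in\mathbb{N}}\alpha_{\nu,1}/\alpha_{\nu,j}\in(0,1]$. $G_j:=H_1$ with $\langle f,g\rangle_{G_j}:=\langle f,e_0\rangle_0\langle e_0,g\rangle_0+\frac1{\gamma_j}\sum_{\nu\in\mathbb{N}}\alpha_{\nu,1}\langle f,e_\nu\rangle_0\langle e_\nu,g\rangle_0$. $F_j:=\operatorname{span}\{e_0,e_1\}$ with $\langle f,g\rangle_{F_j}:=\langle f,e_0\rangle_0\langle e_0,g\rangle_0+\alpha_{1,j}\langle f,e_1\rangle_0\langle e_1,g\rangle_0$. "$G$ is a reproducing kernel Hilbert space" means: $\sum_{\nu,j\in\mathbb{N}}\frac{\gamma_j}{\alpha_{\nu,1}}|e_\nu(y_j)|^2<\infty$ for all $(y_j)_{j\in\mathbb{N}}\in D^{\mathbb{N}}$. In that case $\sum_\nu\alpha_{\nu,1}^{-1}|e_\nu(y)|^2<\infty$ for all $y\in D$, and every $f\in H_1$ is identified with the function $f(y)=\sum_{\nu\in\mathbb{N}_0}\langle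 f,e_\nu\rangle_0e_\nu(y)$ on $D$; thus $H_1$ (and every $H_j,G_j,F_j$) is a reproducing kernel Hilbert space of functions on $D$. For fixed $a\in D$ and $c>0$: $G_j^c:=H_1$ with $\langle f,g\rangle_{G_j^c}:=f(a)\overline{g(a)}+\frac1{c\gamma_j}\sum_{\nu\in\mathbb{N}}\alpha_{\nu,1}\langle f,e_\nu\rangle_0\langle e_\nu,g\rangle_0$; $F_j^c:=\operatorname{span}\{e_0,e_1\}$ with $\langle f,g\rangle_{F_j^c}:=f(a)\overline{g(a)}+\frac{\alpha_{1,j}}{c}\langle f,e_1\rangle_0\langle e_1,g\rangle_0$. $F,H,G,F^c,G^c,\bigotimes_jH_0$ are the countable tensor products of the respective factors $F_j,H_j,G_j,F^c_j,G^c_j,H_0$. Countable tensor products are von Neumann's incomplete tensor products based on the unit vector $e_0=1$ in each factor: the completion of the span of elementary tensors $\otimes_jf_j$ with $f_j\neq1$ for only finitely many $j$, with respect to $\langle\otimes_jf_j,\otimes_jg_j\rangle=\prod_j\langle f_j,g_j\rangle$. Elementary tensors of functions are identified with the functions $\mathbf{y}\mapsto\prod_jf_j(y_j)$ on $D^{\mathbb{N}}$; $\bigotimes_jH_0$ is canonically isometric to $L_2(D^{\mathbb{N}},\mu)$ with $\mu$ the countable product of $\mu_0$. The embeddings are the canonical ones, given by $\otimes_jf_j\mapsto\otimes_jf_j$. *)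

theory Defs
  imports "HOL-Probability.Probability"
begin

text \<open>
  The scalar field is a set \<open>K\<close> of complex numbers, which is either \<open>\<real>\<close> or \<open>UNIV\<close>; over \<open>\<real>\<close> all
  functions and all coefficients are real.  An inner product space is given by its carrier, a set of
  scalar functions with the pointwise linear structure, and its inner product (linear in the first,
  conjugate linear in the second argument).

  The factors are spaces of functions on \<open>D\<close> modulo null functions: the elements of \<open>L\<^sub>2(D, \<mu>)\<close> are
  represented by square integrable functions and are not quotiented by equality almost everywhere.
  All inner products below depend only on the equivalence classes, and in the tensor
  product of such spaces, representatives of the same class yield equal elementary tensors.
\<close>

record 'x ips =
  carr :: "('x \<Rightarrow> complex) set"
  ip :: "('x \<Rightarrow> complex) \<Rightarrow> ('x \<Rightarrow> complex) \<Rightarrow> complex"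

definition nrm :: "'x ips \<Rightarrow> ('x \<Rightarrow> complex) \<Rightarrow> real" where
  "nrm V f = sqrt (Re (ip V f f))"

definition lin_map ::
  "complex set \<Rightarrow> ('x \<Rightarrow> complex) set \<Rightarrow> (('x \<Rightarrow> complex) \<Rightarrow> ('y \<Rightarrow> complex)) \<Rightarrow> bool" where
  "lin_map K A T \<longleftrightarrow>
     (\<forall>f\<in>A. \<forall>g\<in>A. T (\<lambda>x. f x + g x) = (\<lambda>y. T f y + T g y)) \<and>
     (\<forall>k\<in>K. \<forall>f\<in>A. T (\<lambda>x. k * f x) = (\<lambda>y. k * T f y))"


section \<open>Completion of a span with prescribed inner products\<close>

text \<open>
  Let \<open>\<kappa>\<close> be a positive semidefinite kernel on \<open>E\<close>.  \<open>hilbert_hull K E \<kappa>\<close> is the completion of the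
  linear span of vectors \<open>v\<^sub>p\<close>, \<open>p \<in> E\<close>, with inner products \<open>\<langle>v\<^sub>p, v\<^sub>q\<rangle> = \<kappa> p q\<close>.  As in von
  Neumann's construction of infinite direct products, a vector \<open>\<Phi>\<close> is realised as the functional
  \<open>q \<mapsto> \<langle>\<Phi>, v\<^sub>q\<rangle>\<close> on \<open>E\<close> (put to zero outside \<open>E\<close>), and the completion consists of the pointwise limits
  of those sequences in the span that are Cauchy in norm.  Elements of the span are
  given by finitely supported coefficient functions.
\<close>

definition combs :: "complex set \<Rightarrow> 'p set \<Rightarrow> ('p \<Rightarrow> complex) set" where
  "combs K E = {c. finite {p. c p \<noteq> 0} \<and> {p. c p \<noteq> 0} \<subseteq> E \<and> (\<forall>p. c p \<in> K)}"

definition kvec :: "'p set \<Rightarrow> ('p \<Rightarrow> 'p \<Rightarrow> complex) \<Rightarrow> 'p \<Rightarrow> ('p \<Rightarrow> complex)" where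
  "kvec E \<kappa> p = (\<lambda>q. if q \<in> E then \<kappa> p q else 0)"

definition comb_vec :: "'p set \<Rightarrow> ('p \<Rightarrow> 'p \<Rightarrow> complex) \<Rightarrow> ('p \<Rightarrow> complex) \<Rightarrow> ('p \<Rightarrow> complex)" where
  "comb_vec E \<kappa> c = (\<lambda>q. \<Sum>p | c p \<noteq> 0. c p * kvec E \<kappa> p q)"

definition comb_ip :: "('p \<Rightarrow> 'p \<Rightarrow> complex) \<Rightarrow> ('p \<Rightarrow> complex) \<Rightarrow> ('p \<Rightarrow> complex) \<Rightarrow> complex" where
  "comb_ip \<kappa> c d = (\<Sum>p | c p \<noteq> 0. \<Sum>q | d q \<noteq> 0. c p * cnj (d q) * \<kappa> p q)"

definition comb_dist :: "('p \<Rightarrow> 'p \<Rightarrow> complex) \<Rightarrow> ('p \<Rightarrow> complex) \<Rightarrow> ('p \<Rightarrow> complex) \<Rightarrow> real" where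
  "comb_dist \<kappa> c d = sqrt (Re (comb_ip \<kappa> (\<lambda>p. c p - d p) (\<lambda>p. c p - d p)))"

definition approximates ::
  "complex set \<Rightarrow> 'p set \<Rightarrow> ('p \<Rightarrow> 'p \<Rightarrow> complex) \<Rightarrow> (nat \<Rightarrow> 'p \<Rightarrow> complex) \<Rightarrow> ('p \<Rightarrow> complex) \<Rightarrow> bool" where
  "approximates K E \<kappa> s \<Phi> \<longleftrightarrow>
     (\<forall>n. s n \<in> combs K E) \<and>
     (\<forall>\<epsilon>>0. \<exists>N. \<forall>m\<ge>N. \<forall>n\<ge>N. comb_dist \<kappa> (s m) (s n) < \<epsilon>) \<and>
     (\<forall>q. (\<lambda>n. comb_vec E \<kappa> (s n) q) \<longlonglongrightarrow> \<Phi> q)"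

definition hilbert_hull :: "complex set \<Rightarrow> 'p set \<Rightarrow> ('p \<Rightarrow> 'p \<Rightarrow> complex) \<Rightarrow> 'p ips" where
  "hilbert_hull K E \<kappa> =
     \<lparr> carr = {\<Phi>. \<exists>s. approximates K E \<kappa> s \<Phi>},
       ip = (\<lambda>\<Phi> \<Psi>. THE z. \<forall>s t. approximates K E \<kappa> s \<Phi> \<longrightarrow> approximates K E \<kappa> t \<Psi> \<longrightarrow>
                    (\<lambda>n. comb_ip \<kappa> (s n) (t n)) \<longlonglongrightarrow> z) \<rparr>"


section \<open>Countable incomplete tensor products\<close>

text \<open>
  \<open>V j\<close>, \<open>j \<ge> 1\<close>, are the factors and \<open>u\<close> is a common unit vector of all factors.  Since
  \<open>\<langle>u, u\<rangle> = 1\<close> in each factor, the infinite product \<open>\<Prod>\<^sub>j \<langle>f\<^sub>j, g\<^sub>j\<rangle>\<close> reduces to the finite one below.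
\<close>

definition elem_seqs :: "(nat \<Rightarrow> 'x ips) \<Rightarrow> ('x \<Rightarrow> complex) \<Rightarrow> (nat \<Rightarrow> 'x \<Rightarrow> complex) set" where
  "elem_seqs V u = {f \<in> (\<Pi>\<^sub>E j\<in>{1..}. carr (V j)). finite {j \<in> {1..}. f j \<noteq> u}}"

definition prod_ip ::
  "(nat \<Rightarrow> 'x ips) \<Rightarrow> ('x \<Rightarrow> complex) \<Rightarrow> (nat \<Rightarrow> 'x \<Rightarrow> complex) \<Rightarrow> (nat \<Rightarrow> 'x \<Rightarrow> complex) \<Rightarrow> complex" where
  "prod_ip V u f g = (\<Prod>j | 1 \<le> j \<and> (f j \<noteq> u \<or> g j \<noteq> u). ip (V j) (f j) (g j))"

definition tensor ::
  "complex set \<Rightarrow> ('x \<Rightarrow> complex) \<Rightarrow> (nat \<Rightarrow> 'x ips) \<Rightarrow> (nat \<Rightarrow> 'x \<Rightarrow> complex) ips" where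
  "tensor K u V = hilbert_hull K (elem_seqs V u) (prod_ip V u)"

definition elem_tensor ::
  "('x \<Rightarrow> complex) \<Rightarrow> (nat \<Rightarrow> 'x ips) \<Rightarrow> (nat \<Rightarrow> 'x \<Rightarrow> complex) \<Rightarrow> ((nat \<Rightarrow> 'x \<Rightarrow> complex) \<Rightarrow> complex)" where
  "elem_tensor u V f = kvec (elem_seqs V u) (prod_ip V u) f"

text \<open>The canonical map \<open>\<Otimes>\<^sub>j f\<^sub>j \<mapsto> \<Otimes>\<^sub>j f\<^sub>j\<close> is a continuous embedding of \<open>\<Otimes>\<^sub>j V\<^sub>j\<close> into \<open>\<Otimes>\<^sub>j W\<^sub>j\<close>.\<close>

definition tensor_embeds ::
  "complex set \<Rightarrow> ('x \<Rightarrow> complex) \<Rightarrow> (nat \<Rightarrow> 'x ips) \<Rightarrow> (nat \<Rightarrow> 'x ips) \<Rightarrow> bool" where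
  "tensor_embeds K u V W \<longleftrightarrow>
     elem_seqs V u \<subseteq> elem_seqs W u \<and>
     (\<exists>T. T \<in> carr (tensor K u V) \<rightarrow> carr (tensor K u W) \<and>
          lin_map K (carr (tensor K u V)) T \<and>
          inj_on T (carr (tensor K u V)) \<and>
          (\<exists>C. \<forall>\<Phi>\<in>carr (tensor K u V). nrm (tensor K u W) (T \<Phi>) \<le> C * nrm (tensor K u V) \<Phi>) \<and>
          (\<forall>f\<in>elem_seqs V u. T (elem_tensor u V f) = elem_tensor u W f))"

text \<open>
  \<open>val f y\<close> is the value at \<open>y \<in> D\<close> of the function that is identified with the vector \<open>f\<close> of a
  factor.  The tensor product is a reproducing kernel Hilbert space of functions on \<open>D\<^sup>\<nat>\<close> if
  identifying \<open>\<Otimes>\<^sub>j f\<^sub>j\<close> with the function \<open>y \<mapsto> \<Prod>\<^sub>j f\<^sub>j(y\<^sub>j)\<close> identifies all its elements with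
  functions on \<open>D\<^sup>\<nat>\<close>, in a linear and injective way and with continuous point evaluations.
  If \<open>f\<^sub>j = u\<close> then \<open>f\<^sub>j(y\<^sub>j) = 1\<close>, so the product over all \<open>j\<close> is finite.
\<close>

definition tensor_rkhs ::
  "complex set \<Rightarrow> ('x \<Rightarrow> complex) \<Rightarrow> (('x \<Rightarrow> complex) \<Rightarrow> 'd \<Rightarrow> complex) \<Rightarrow> 'd set \<Rightarrow>
     (nat \<Rightarrow> 'x ips) \<Rightarrow> bool" where
  "tensor_rkhs K u val D V \<longleftrightarrow>
     (\<exists>R. lin_map K (carr (tensor K u V)) R \<and>
          (\<forall>\<Phi>\<in>carr (tensor K u V). \<forall>\<Psi>\<in>carr (tensor K u V).
             (\<forall>y\<in>{1..} \<rightarrow>\<^sub>E D. R \<Phi> y = R \<Psi> y) \<longrightarrow> \<Phi> = \<Psi>) \<and>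
          (\<forall>y\<in>{1..} \<rightarrow>\<^sub>E D. \<exists>C. \<forall>\<Phi>\<in>carr (tensor K u V).
             cmod (R \<Phi> y) \<le> C * nrm (tensor K u V) \<Phi>) \<and>
          (\<forall>f\<in>elem_seqs V u. \<forall>y\<in>{1..} \<rightarrow>\<^sub>E D.
             R (elem_tensor u V f) y = (\<Prod>j | 1 \<le> j \<and> f j \<noteq> u. val (f j) (y j))))"


section \<open>The factors\<close>

definition L2_fun :: "complex set \<Rightarrow> 'd measure \<Rightarrow> ('d \<Rightarrow> complex) set" where
  "L2_fun K M = {f \<in> borel_measurable M. f \<in> space M \<rightarrow> K \<and> integrable M (\<lambda>x. (cmod (f x))\<^sup>2)}"

definition ip0 :: "'d measure \<Rightarrow> ('d \<Rightarrow> complex) \<Rightarrow> ('d \<Rightarrow> complex) \<Rightarrow> complex" where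
  "ip0 M f g = (LINT x|M. f x * cnj (g x))"

definition L2_space :: "complex set \<Rightarrow> 'd measure \<Rightarrow> 'd ips" where
  "L2_space K M = \<lparr> carr = L2_fun K M, ip = ip0 M \<rparr>"

definition onb :: "complex set \<Rightarrow> 'd measure \<Rightarrow> (nat \<Rightarrow> 'd \<Rightarrow> complex) \<Rightarrow> bool" where
  "onb K M e \<longleftrightarrow>
     (\<forall>\<nu>. e \<nu> \<in> L2_fun K M) \<and>
     (\<forall>\<nu> \<nu>'. ip0 M (e \<nu>) (e \<nu>') = (if \<nu> = \<nu>' then 1 else 0)) \<and>
     (\<forall>f\<in>L2_fun K M. \<forall>\<epsilon>>0. \<exists>n c. (\<forall>\<nu>. c \<nu> \<in> K) \<and>
        nrm (L2_space K M) (\<lambda>x. f x - (\<Sum>\<nu><n. c \<nu> * e \<nu> x)) < \<epsilon>)"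

definition H_set ::
  "complex set \<Rightarrow> 'd measure \<Rightarrow> (nat \<Rightarrow> 'd \<Rightarrow> complex) \<Rightarrow> (nat \<Rightarrow> nat \<Rightarrow> real) \<Rightarrow> nat \<Rightarrow>
     ('d \<Rightarrow> complex) set" where
  "H_set K M e \<alpha> j =
     {f \<in> L2_fun K M. (\<lambda>\<nu>. \<alpha> \<nu> j * (cmod (ip0 M f (e \<nu>)))\<^sup>2) summable_on {1..}}"

definition wsum ::
  "'d measure \<Rightarrow> (nat \<Rightarrow> 'd \<Rightarrow> complex) \<Rightarrow> (nat \<Rightarrow> nat \<Rightarrow> real) \<Rightarrow> nat \<Rightarrow>
     ('d \<Rightarrow> complex) \<Rightarrow> ('d \<Rightarrow> complex) \<Rightarrow> complex" where
  "wsum M e \<alpha> j f g =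
     (\<Sum>\<^sub>\<infinity>\<nu>\<in>{1..}. of_real (\<alpha> \<nu> j) * ip0 M f (e \<nu>) * ip0 M (e \<nu>) g)"

definition H_space ::
  "complex set \<Rightarrow> 'd measure \<Rightarrow> (nat \<Rightarrow> 'd \<Rightarrow> complex) \<Rightarrow> (nat \<Rightarrow> nat \<Rightarrow> real) \<Rightarrow> nat \<Rightarrow> 'd ips" where
  "H_space K M e \<alpha> j =
     \<lparr> carr = H_set K M e \<alpha> j,
       ip = (\<lambda>f g. ip0 M f (e 0) * ip0 M (e 0) g + wsum M e \<alpha> j f g) \<rparr>"

definition gam :: "(nat \<Rightarrow> nat \<Rightarrow> real) \<Rightarrow> nat \<Rightarrow> real" where
  "gam \<alpha> j = (SUP \<nu>\<in>{1..}. \<alpha> \<nu> 1 / \<alpha> \<nu> j)"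

definition G_space ::
  "complex set \<Rightarrow> 'd measure \<Rightarrow> (nat \<Rightarrow> 'd \<Rightarrow> complex) \<Rightarrow> (nat \<Rightarrow> nat \<Rightarrow> real) \<Rightarrow> nat \<Rightarrow> 'd ips" where
  "G_space K M e \<alpha> j =
     \<lparr> carr = H_set K M e \<alpha> 1,
       ip = (\<lambda>f g. ip0 M f (e 0) * ip0 M (e 0) g
                   + of_real (1 / gam \<alpha> j) * wsum M e \<alpha> 1 f g) \<rparr>"

definition span01 :: "complex set \<Rightarrow> (nat \<Rightarrow> 'd \<Rightarrow> complex) \<Rightarrow> ('d \<Rightarrow> complex) set" where
  "span01 K e = {(\<lambda>x. s * e 0 x + t * e 1 x) | s t. s \<in> K \<and> t \<in> K}"

definition F_space ::
  "complex set \<Rightarrow> 'd measure \<Rightarrow> (nat \<Rightarrow> 'd \<Rightarrow> complex) \<Rightarrow> (nat \<Rightarrow> nat \<Rightarrow> real) \<Rightarrow> nat \<Rightarrow> 'd ips" where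
  "F_space K M e \<alpha> j =
     \<lparr> carr = span01 K e,
       ip = (\<lambda>f g. ip0 M f (e 0) * ip0 M (e 0) g
                   + of_real (\<alpha> 1 j) * ip0 M f (e 1) * ip0 M (e 1) g) \<rparr>"

definition G_is_rkhs ::
  "'d measure \<Rightarrow> (nat \<Rightarrow> 'd \<Rightarrow> complex) \<Rightarrow> (nat \<Rightarrow> nat \<Rightarrow> real) \<Rightarrow> bool" where
  "G_is_rkhs M e \<alpha> \<longleftrightarrow>
     (\<forall>y\<in>{1..} \<rightarrow>\<^sub>E space M.
        (\<lambda>(\<nu>, j). gam \<alpha> j / \<alpha> \<nu> 1 * (cmod (e \<nu> (y j)))\<^sup>2) summable_on {1..} \<times> {1..})"

text \<open>
  The value at \<open>y\<close> of the function identified with (the class of) \<open>f\<close>.  It is in general different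
  from the value \<open>f y\<close> of the representative \<open>f\<close>.
\<close>

definition pt_val ::
  "'d measure \<Rightarrow> (nat \<Rightarrow> 'd \<Rightarrow> complex) \<Rightarrow> ('d \<Rightarrow> complex) \<Rightarrow> 'd \<Rightarrow> complex" where
  "pt_val M e f y = (\<Sum>\<^sub>\<infinity>\<nu>. ip0 M f (e \<nu>) * e \<nu> y)"

definition Gc_space ::
  "complex set \<Rightarrow> 'd measure \<Rightarrow> (nat \<Rightarrow> 'd \<Rightarrow> complex) \<Rightarrow> (nat \<Rightarrow> nat \<Rightarrow> real) \<Rightarrow> 'd \<Rightarrow> real \<Rightarrow>
     nat \<Rightarrow> 'd ips" where
  "Gc_space K M e \<alpha> a c j =
     \<lparr> carr = H_set K M e \<alpha> 1,
       ip = (\<lambda>f g. pt_val M e f a * cnj (pt_val M e g a)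
                   + of_real (1 / (c * gam \<alpha> j)) * wsum M e \<alpha> 1 f g) \<rparr>"

definition Fc_space ::
  "complex set \<Rightarrow> 'd measure \<Rightarrow> (nat \<Rightarrow> 'd \<Rightarrow> complex) \<Rightarrow> (nat \<Rightarrow> nat \<Rightarrow> real) \<Rightarrow> 'd \<Rightarrow> real \<Rightarrow>
     nat \<Rightarrow> 'd ips" where
  "Fc_space K M e \<alpha> a c j =
     \<lparr> carr = span01 K e,
       ip = (\<lambda>f g. pt_val M e f a * cnj (pt_val M e g a)
                   + of_real (\<alpha> 1 j / c) * ip0 M f (e 1) * ip0 M (e 1) g) \<rparr>"

end

theory Submission imports Defs begin

text \<open>
  In coordinates with respect to \<open>e\<close>, all factors carry forms of the type
  \<open>l(x) cnj(l(y)) + w\<^sub>j W(x, y)\<close>, where \<open>l\<close> is the zeroth coordinate (for \<open>F\<close> and \<open>G\<close>) or the evaluation at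
  \<open>a\<close> (for \<open>F\<^sup>c\<close> and \<open>G\<^sup>c\<close>), and the reproducing kernel assumption yields \<open>\<Sum>\<^sub>j 1/w\<^sub>j < \<infinity>\<close>.  Since the
  difference of the two functionals is bounded by \<open>W\<close>, lowering \<open>w\<^sub>j\<close> by a fixed factor \<open>\<theta> < 1\<close> allows one to
  exchange them at the cost of a factor \<open>1 + O(1/w\<^sub>j)\<close> in the squared norm, and the product of these
  factors converges.  By Schur's product theorem the bounds in the factors multiply, so that any
  \<open>c\<^sub>0 < 1\<close> works.

  A map between tensor products is injective if functionals that are bounded on the target are total on
  the source.  The functionals used are products of arbitrary ones in finitely many slots with
  \<open>\<langle>\<cdot>, e\<^sub>0\<rangle>\<close> in the others, where the latter has to be bounded on the target with constants
  whose product converges.  Injectivity of \<open>\<Phi> \<mapsto> \<Phi>(y)\<close> is seen in the same way with point evaluations at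
  sequences \<open>y\<close> that are eventually \<open>a\<close>.
\<close>

section \<open>Hermitian forms on function spaces\<close>

text \<open>Continuity is the easy half; injectivity is the obstacle. A bounded map between spans
  extends to the completions, but the extension may acquire a kernel. In a single factor the twisted
  and the untwisted norms are equivalent, yet the constants of the reverse inequality stay away from
  1 as \<open>w_j\<close> grows, so their product diverges and no lower bound survives in the tensor
  product. Hence a Cauchy sequence that is null in the target norm is tested against functionals,
  slot by slot, until it is seen to be weakly null in the source. The vector \<open>e 0\<close> is
  orthogonal to everything with respect to \<open>W\<close>, so pairing with it in a twisted form is
  \<open>l\<close> itself; this is why comparing two tail functionals amounts to comparing
  \<open>l\<close> with \<open>l'\<close>. The summability of \<open>1/w_j\<close> has its origin in
  \<open>e 1\<close>: it is nonzero at some point, and the kernel hypothesis at that constant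
  sequence bounds the sum of all \<open>\<gamma>_j\<close>, while
  \<open>1/w_j \<le> \<gamma>_j\<close> for \<open>w_j = \<alpha>_{1,j}/\<alpha>_{1,1}\<close> (for
  \<open>F\<close>) and \<open>w_j = 1/\<gamma>_j\<close> (for \<open>G\<close>). With
  \<open>c_0 = 1/2\<close> every exchange of the functional halves the weight: \<open>2 w_j\<close>,
  \<open>w_j\<close>, \<open>w_j/2\<close>.\<close>

locale herm_form =
  fixes X :: "('i \<Rightarrow> complex) set" and k :: "('i \<Rightarrow> complex) \<Rightarrow> ('i \<Rightarrow> complex) \<Rightarrow> complex"
  assumes zero_mem: "(\<lambda>i. 0) \<in> X"
    and add_mem: "\<And>x y. x \<in> X \<Longrightarrow> y \<in> X \<Longrightarrow> (\<lambda>i. x i + y i) \<in> X"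
    and scale_mem: "\<And>x c. x \<in> X \<Longrightarrow> (\<lambda>i. c * x i) \<in> X"
    and add_left: "\<And>x y z. x \<in> X \<Longrightarrow> y \<in> X \<Longrightarrow> z \<in> X \<Longrightarrow> k (\<lambda>i. x i + y i) z = k x z + k y z"
    and scale_left: "\<And>x z c. x \<in> X \<Longrightarrow> z \<in> X \<Longrightarrow> k (\<lambda>i. c * x i) z = c * k x z"
    and herm: "\<And>x y. x \<in> X \<Longrightarrow> y \<in> X \<Longrightarrow> k y x = cnj (k x y)"
    and nonneg: "\<And>x. x \<in> X \<Longrightarrow> 0 \<le> Re (k x x)"
begin

text \<open>Only a seminorm: square integrable functions that agree almost everywhere are not
  identified, and different formal combinations of elementary tensors may have distance
  zero.\<close>

definition len :: "('i \<Rightarrow> complex) \<Rightarrow> real" where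
  "len x = sqrt (Re (k x x))"

lemma diff_mem: "x \<in> X \<Longrightarrow> y \<in> X \<Longrightarrow> (\<lambda>i. x i - y i) \<in> X"
  using add_mem[of x "\<lambda>i. -1 * y i"] scale_mem[of y "-1"] by simp

lemma diff_left:
  assumes "x \<in> X" "y \<in> X" "z \<in> X"
  shows "k (\<lambda>i. x i - y i) z = k x z - k y z"
  using add_left[of x "\<lambda>i. -1 * y i" z] scale_mem[of y "-1"] scale_left[of y z "-1"] assms by simp

lemma diff_right:
  assumes "x \<in> X" "y \<in> X" "z \<in> X"
  shows "k z (\<lambda>i. x i - y i) = k z x - k z y"
proof -
  have "k z (\<lambda>i. x i - y i) = cnj (k (\<lambda>i. x i - y i) z)"
    using herm[of "\<lambda>i. x i - y i" z] diff_mem assms by simp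
  also have "\<dots> = cnj (k x z) - cnj (k y z)"
    using diff_left[OF assms] by simp
  finally show ?thesis using herm[OF assms(1,3)] herm[OF assms(2,3)] by simp
qed

lemma add_right:
  assumes "x \<in> X" "y \<in> X" "z \<in> X"
  shows "k z (\<lambda>i. x i + y i) = k z x + k z y"
proof -
  have "k z (\<lambda>i. x i + y i) = cnj (k (\<lambda>i. x i + y i) z)"
    using herm[of "\<lambda>i. x i + y i" z] add_mem assms by simp
  also have "\<dots> = cnj (k x z) + cnj (k y z)"
    using add_left[OF assms] by simp
  finally show ?thesis using herm[OF assms(1,3)] herm[OF assms(2,3)] by simp
qed

lemma scale_right:
  assumes "x \<in> X" "z \<in> X"
  shows "k z (\<lambda>i. c * x i) = cnj c * k z x"
proof -
  have "k z (\<lambda>i. c * x i) = cnj (k (\<lambda>i. c * x i) z)"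
    using herm[of "\<lambda>i. c * x i" z] scale_mem assms by simp
  also have "\<dots> = cnj c * cnj (k x z)"
    using scale_left[OF assms] by simp
  finally show ?thesis using herm[OF assms] by simp
qed

lemma zero_left: "z \<in> X \<Longrightarrow> k (\<lambda>i. 0) z = 0"
  using scale_left[of "\<lambda>i. 0" z 0] zero_mem by simp

lemma sum_mem:
  assumes "\<And>a. a \<in> A \<Longrightarrow> f a \<in> X"
  shows "(\<lambda>i. \<Sum>a\<in>A. c a * f a i) \<in> X"
  using assms
proof (induction A rule: infinite_finite_induct)
  case (insert a A)
  then show ?case using add_mem[of "\<lambda>i. c a * f a i" "\<lambda>i. \<Sum>a\<in>A. c a * f a i"] scale_mem by simp
qed (auto simp: zero_mem)

lemma sum_left:
  assumes "\<And>a. a \<in> A \<Longrightarrow> f a \<in> X" "z \<in> X"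
  shows "k (\<lambda>i. \<Sum>a\<in>A. c a * f a i) z = (\<Sum>a\<in>A. c a * k (f a) z)"
  using assms
proof (induction A rule: infinite_finite_induct)
  case (insert a A)
  then show ?case
    using add_left[of "\<lambda>i. c a * f a i" "\<lambda>i. \<Sum>a\<in>A. c a * f a i" z] scale_mem scale_left
      sum_mem[of A f c] by simp
qed (auto simp: zero_left)

lemma sum_sum:
  assumes "\<And>a. a \<in> A \<Longrightarrow> f a \<in> X"
  shows "k (\<lambda>i. \<Sum>a\<in>A. c a * f a i) (\<lambda>i. \<Sum>a\<in>A. c a * f a i)
    = (\<Sum>a\<in>A. \<Sum>b\<in>A. c a * cnj (c b) * k (f a) (f b))"
proof -
  let ?s = "\<lambda>i. \<Sum>a\<in>A. c a * f a i"
  have s: "?s \<in> X" using assms by (rule sum_mem)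
  have "k (f a) ?s = (\<Sum>b\<in>A. cnj (c b) * k (f a) (f b))" if "a \<in> A" for a
  proof -
    have "k (f a) ?s = cnj (k ?s (f a))" using herm[OF s] assms that by simp
    also have "\<dots> = (\<Sum>b\<in>A. cnj (c b) * cnj (k (f b) (f a)))"
      using sum_left[of A f "f a" c] assms that by simp
    also have "\<dots> = (\<Sum>b\<in>A. cnj (c b) * k (f a) (f b))"
      using assms that by (intro sum.cong refl arg_cong2[where f = "(*)"]) (simp add: herm[symmetric])
    finally show ?thesis .
  qed
  then show ?thesis
    using sum_left[of A f ?s c] assms s
    by (simp add: sum_distrib_left mult.assoc)
qed

lemma self_nonneg: "x \<in> X \<Longrightarrow> k x x \<in> \<real>\<^sub>\<ge>\<^sub>0"
  using herm[of x x] nonneg[of x] by (simp add: complex_nonneg_Reals_iff complex_eq_iff)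

lemma len_nonneg [simp]: "x \<in> X \<Longrightarrow> 0 \<le> len x"
  unfolding len_def using nonneg by simp

lemma len_sq: "x \<in> X \<Longrightarrow> (len x)\<^sup>2 = Re (k x x)"
  unfolding len_def using nonneg by simp

lemma Cauchy_Schwarz:
  assumes x: "x \<in> X" and y: "y \<in> X"
  shows "(cmod (k x y))\<^sup>2 \<le> Re (k x x) * Re (k y y)"
proof -
  let ?z = "k x y" and ?a = "Re (k x x)" and ?b = "Re (k y y)"
  have q: "0 \<le> ?a - 2 * t * (cmod ?z)\<^sup>2 + t\<^sup>2 * (cmod ?z)\<^sup>2 * ?b" for t :: real
  proof -
    \<comment> \<open>The phase of \<open>?z\<close> in \<open>c\<close> makes the cross terms real,
      so a quadratic polynomial in the real variable \<open>t\<close> is enough; for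
      \<open>?b > 0\<close> it is used at \<open>t = 1 / ?b\<close>.\<close>
    define c where "c = - (of_real t * ?z)"
    have cy: "(\<lambda>i. c * y i) \<in> X" using y by (rule scale_mem)
    have yx: "k y x = cnj ?z" using herm[OF x y] .
    have "k (\<lambda>i. x i + c * y i) (\<lambda>i. x i + c * y i)
        = k x x + cnj c * ?z + c * cnj ?z + c * cnj c * k y y"
      using add_left[OF x cy add_mem[OF x cy]] add_right[OF x cy x] add_right[OF x cy cy]
        scale_left[OF y x] scale_left[OF y cy] scale_right[OF y x] scale_right[OF y y] yx
      by (simp add: algebra_simps)
    moreover have "Re (cnj c * ?z + c * cnj ?z) = - 2 * t * (cmod ?z)\<^sup>2"
    proof -
      have "cnj c * ?z + c * cnj ?z = of_real (- 2 * t) * (?z * cnj ?z)"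
        unfolding c_def by (simp add: algebra_simps)
      then show ?thesis by (simp only: complex_norm_square[symmetric]) simp
    qed
    moreover have "c * cnj c = of_real (t\<^sup>2 * (cmod ?z)\<^sup>2)"
      unfolding c_def complex_norm_square[symmetric] by (simp add: norm_mult power_mult_distrib)
    ultimately show ?thesis
      using nonneg[OF add_mem[OF x cy]] by simp
  qed
  show ?thesis
  proof (cases "?b = 0")
    case True
    have "(cmod ?z)\<^sup>2 = 0"
    proof (rule ccontr)
      assume "(cmod ?z)\<^sup>2 \<noteq> 0"
      \<comment> \<open>For \<open>?b = 0\<close> the polynomial is affine in \<open>t\<close>, and
        this \<open>t\<close> gives it the value -1.\<close>
      then show False using q[of "(?a + 1) / (2 * (cmod ?z)\<^sup>2)"] True by simp
    qed
    then show ?thesis using True by simp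
  next
    case False
    then have "0 < ?b" using nonneg[OF y] by simp
    then show ?thesis using q[of "1 / ?b"] by (simp add: field_simps power2_eq_square)
  qed
qed

lemma Cauchy_Schwarz_len:
  assumes "x \<in> X" "y \<in> X"
  shows "cmod (k x y) \<le> len x * len y"
  using real_le_rsqrt[OF Cauchy_Schwarz[OF assms]] by (simp add: len_def real_sqrt_mult)

lemma len_add:
  assumes x: "x \<in> X" and y: "y \<in> X"
  shows "len (\<lambda>i. x i + y i) \<le> len x + len y"
proof (rule power2_le_imp_le)
  have "(len (\<lambda>i. x i + y i))\<^sup>2 = Re (k x x) + Re (k y y) + 2 * Re (k x y)"
    using len_sq[OF add_mem[OF x y]] add_left[OF x y add_mem[OF x y]] add_right[OF x y x]
      add_right[OF x y y] herm[OF x y] by simp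
  also have "\<dots> \<le> (len x)\<^sup>2 + (len y)\<^sup>2 + 2 * (len x * len y)"
    using len_sq[OF x] len_sq[OF y] Cauchy_Schwarz_len[OF x y] complex_Re_le_cmod[of "k x y"] by simp
  also have "\<dots> = (len x + len y)\<^sup>2" by (simp add: power2_sum)
  finally show "(len (\<lambda>i. x i + y i))\<^sup>2 \<le> (len x + len y)\<^sup>2" .
qed (simp add: x y)

lemma len_scale: "x \<in> X \<Longrightarrow> len (\<lambda>i. c * x i) = cmod c * len x"
  unfolding len_def using scale_left[of x "\<lambda>i. c * x i" c] scale_right[of x x c] scale_mem[of x c]
  by (simp add: mult.assoc[symmetric] complex_norm_square[symmetric] real_sqrt_mult)

lemma len_minus_commute:
  assumes "x \<in> X" "y \<in> X"
  shows "len (\<lambda>i. x i - y i) = len (\<lambda>i. y i - x i)"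
  using len_scale[OF diff_mem[OF assms], of "-1"] by simp

lemma len_diff_abs:
  assumes "x \<in> X" "y \<in> X"
  shows "\<bar>len x - len y\<bar> \<le> len (\<lambda>i. x i - y i)"
proof -
  have "len x \<le> len (\<lambda>i. x i - y i) + len y"
    using len_add[of "\<lambda>i. x i - y i" y] diff_mem assms by simp
  moreover have "len y \<le> len (\<lambda>i. y i - x i) + len x"
    using len_add[of "\<lambda>i. y i - x i" x] diff_mem assms by simp
  ultimately show ?thesis using len_minus_commute[OF assms] by simp
qed

section \<open>Cauchy sequences for a semidefinite form\<close>

definition len_Cauchy :: "(nat \<Rightarrow> 'i \<Rightarrow> complex) \<Rightarrow> bool" where
  "len_Cauchy s \<longleftrightarrow> (\<forall>n. s n \<in> X) \<and> (\<forall>\<epsilon>>0. \<exists>N. \<forall>m\<ge>N. \<forall>n\<ge>N. len (\<lambda>i. s m i - s n i) < \<epsilon>)"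

lemma len_Cauchy_mem: "len_Cauchy s \<Longrightarrow> s n \<in> X"
  by (simp add: len_Cauchy_def)

lemma len_Cauchy_add:
  assumes s: "len_Cauchy s" and t: "len_Cauchy t"
  shows "len_Cauchy (\<lambda>n i. s n i + t n i)"
  unfolding len_Cauchy_def
proof (intro conjI allI impI)
  fix \<epsilon> :: real assume "\<epsilon> > 0"
  then have e: "\<epsilon> / 2 > 0" by simp
  obtain N1 where N1: "\<And>m n. m \<ge> N1 \<Longrightarrow> n \<ge> N1 \<Longrightarrow> len (\<lambda>i. s m i - s n i) < \<epsilon> / 2"
    using s e unfolding len_Cauchy_def by meson
  obtain N2 where N2: "\<And>m n. m \<ge> N2 \<Longrightarrow> n \<ge> N2 \<Longrightarrow> len (\<lambda>i. t m i - t n i) < \<epsilon> / 2"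
    using t e unfolding len_Cauchy_def by meson
  have "len (\<lambda>i. s m i + t m i - (s n i + t n i)) < \<epsilon>" if "m \<ge> max N1 N2" "n \<ge> max N1 N2" for m n
  proof -
    have "len (\<lambda>i. s m i + t m i - (s n i + t n i))
        \<le> len (\<lambda>i. s m i - s n i) + len (\<lambda>i. t m i - t n i)"
      using len_add[of "\<lambda>i. s m i - s n i" "\<lambda>i. t m i - t n i"]
        diff_mem[OF len_Cauchy_mem[OF s] len_Cauchy_mem[OF s]]
        diff_mem[OF len_Cauchy_mem[OF t] len_Cauchy_mem[OF t]]
      by (simp add: algebra_simps)
    then show ?thesis using N1[of m n] N2[of m n] that by simp
  qed
  then show "\<exists>N. \<forall>m\<ge>N. \<forall>n\<ge>N. len (\<lambda>i. s m i + t m i - (s n i + t n i)) < \<epsilon>" by blast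
qed (use add_mem len_Cauchy_mem s t in blast)

lemma len_Cauchy_scale:
  assumes s: "len_Cauchy s"
  shows "len_Cauchy (\<lambda>n i. c * s n i)"
  unfolding len_Cauchy_def
proof (intro conjI allI impI)
  fix \<epsilon> :: real assume "\<epsilon> > 0"
  then have "\<epsilon> / (cmod c + 1) > 0" by (simp add: add_nonneg_pos)
  then obtain N where N: "\<And>m n. m \<ge> N \<Longrightarrow> n \<ge> N \<Longrightarrow> len (\<lambda>i. s m i - s n i) < \<epsilon> / (cmod c + 1)"
    using s unfolding len_Cauchy_def by meson
  have "len (\<lambda>i. c * s m i - c * s n i) < \<epsilon>" if "m \<ge> N" "n \<ge> N" for m n
  proof -
    have m: "(\<lambda>i. s m i - s n i) \<in> X" by (intro diff_mem len_Cauchy_mem s)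
    have "len (\<lambda>i. c * s m i - c * s n i) = cmod c * len (\<lambda>i. s m i - s n i)"
      using len_scale[OF m, of c] by (simp add: algebra_simps)
    also have "\<dots> \<le> (cmod c + 1) * len (\<lambda>i. s m i - s n i)"
      using m by (simp add: algebra_simps)
    also have "\<dots> < \<epsilon>" 
      using N[OF that] add_nonneg_pos[of "cmod c" 1] by (simp add: pos_less_divide_eq mult.commute)
    finally show ?thesis .
  qed
  then show "\<exists>N. \<forall>m\<ge>N. \<forall>n\<ge>N. len (\<lambda>i. c * s m i - c * s n i) < \<epsilon>" by blast
qed (use scale_mem len_Cauchy_mem s in blast)

lemma len_Cauchy_diff:
  assumes "len_Cauchy s" "len_Cauchy t"
  shows "len_Cauchy (\<lambda>n i. s n i - t n i)"
  using len_Cauchy_add[OF assms(1) len_Cauchy_scale[OF assms(2), of "-1"]] by simp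

lemma Cauchy_len:
  assumes s: "len_Cauchy s"
  shows "Cauchy (\<lambda>n. len (s n))"
proof (rule CauchyI)
  fix \<epsilon> :: real assume "\<epsilon> > 0"
  then obtain N where N: "\<And>m n. m \<ge> N \<Longrightarrow> n \<ge> N \<Longrightarrow> len (\<lambda>i. s m i - s n i) < \<epsilon>"
    using s unfolding len_Cauchy_def by meson
  have "norm (len (s m) - len (s n)) < \<epsilon>" if "m \<ge> N" "n \<ge> N" for m n
    using le_less_trans[OF len_diff_abs[OF len_Cauchy_mem[OF s] len_Cauchy_mem[OF s]] N[OF that]] by simp
  then show "\<exists>M. \<forall>m\<ge>M. \<forall>n\<ge>M. norm (len (s m) - len (s n)) < \<epsilon>" by blast
qed

lemma len_Cauchy_bound:
  assumes "len_Cauchy s"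
  obtains B where "B > 0" "\<And>n. len (s n) \<le> B"
proof -
  have "Bseq (\<lambda>n. len (s n))" using Cauchy_len[OF assms] by (rule Cauchy_Bseq)
  then obtain B where "B > 0" "\<And>n. norm (len (s n)) \<le> B" by (auto elim: BseqE)
  then show ?thesis using that[of B] len_nonneg[OF len_Cauchy_mem[OF assms]] by simp
qed

text \<open>Split \<open>k (s n) (s n)\<close> into the pairings of \<open>s n\<close> with
  \<open>s n - s N\<close> and with \<open>s N\<close>. The first is small because the lengths stay
  bounded, the second by assumption. Testing against the members of the sequence itself replaces a
  limit in a completion.\<close>

lemma len_Cauchy_null:
  assumes s: "len_Cauchy s" and w: "\<And>N. (\<lambda>n. k (s n) (s N)) \<longlonglongrightarrow> 0"
  shows "(\<lambda>n. len (s n)) \<longlonglongrightarrow> 0"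
proof -
  note sX = len_Cauchy_mem[OF s]
  obtain B where B: "B > 0" "\<And>n. len (s n) \<le> B" using len_Cauchy_bound[OF s] by blast
  have "(\<lambda>n. (len (s n))\<^sup>2) \<longlonglongrightarrow> 0"
  proof (rule LIMSEQ_I)
    fix \<epsilon> :: real assume "\<epsilon> > 0"
    then have e: "\<epsilon> / (2 * B) > 0" "\<epsilon> / 2 > 0" using B by auto
    obtain N where N: "\<And>m n. m \<ge> N \<Longrightarrow> n \<ge> N \<Longrightarrow> len (\<lambda>i. s m i - s n i) < \<epsilon> / (2 * B)"
      using s e unfolding len_Cauchy_def by meson
    obtain N' where N': "\<And>n. n \<ge> N' \<Longrightarrow> norm (k (s n) (s N) - 0) < \<epsilon> / 2"
      using LIMSEQ_D[OF w e(2)] by blast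
    have "norm ((len (s n))\<^sup>2 - 0) < \<epsilon>" if "n \<ge> max N N'" for n
    proof -
      have "(len (s n))\<^sup>2 = Re (k (s n) (\<lambda>i. s n i - s N i)) + Re (k (s n) (s N))"
        using len_sq[OF sX] diff_right[OF sX sX sX] by simp
      also have "\<dots> \<le> cmod (k (s n) (\<lambda>i. s n i - s N i)) + cmod (k (s n) (s N))"
        by (intro add_mono complex_Re_le_cmod)
      also have "\<dots> \<le> B * len (\<lambda>i. s n i - s N i) + cmod (k (s n) (s N))"
        using Cauchy_Schwarz_len[OF sX diff_mem[OF sX sX], of n n N]
          mult_right_mono[OF B(2) len_nonneg[OF diff_mem[OF sX sX]], of n n N] by linarith
      also have "\<dots> < B * (\<epsilon> / (2 * B)) + \<epsilon> / 2"
        using N[of n N] N'[of n] that B(1) by (intro add_strict_mono mult_strict_left_mono) auto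
      also have "\<dots> = \<epsilon>" using B(1) by simp
      finally show ?thesis by simp
    qed
    then show "\<exists>no. \<forall>n\<ge>no. norm ((len (s n))\<^sup>2 - 0) < \<epsilon>" by blast
  qed
  then have "(\<lambda>n. sqrt ((len (s n))\<^sup>2)) \<longlonglongrightarrow> sqrt 0" by (rule tendsto_real_sqrt)
  then show ?thesis using len_nonneg[OF sX] by simp
qed

lemma len_null_imp_null:
  assumes "\<And>n. s n \<in> X" "y \<in> X" "(\<lambda>n. len (s n)) \<longlonglongrightarrow> 0"
  shows "(\<lambda>n. k (s n) y) \<longlonglongrightarrow> 0"
proof (rule Lim_null_comparison)
  show "\<forall>\<^sub>F n in sequentially. norm (k (s n) y) \<le> len (s n) * len y"
    using Cauchy_Schwarz_len assms(1,2) by simp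
  show "(\<lambda>n. len (s n) * len y) \<longlonglongrightarrow> 0"
    using tendsto_mult_left_zero[OF assms(3)] by blast
qed

end

lemma herm_form_subset:
  assumes "herm_form X k" "X' \<subseteq> X" "(\<lambda>i. 0) \<in> X'"
    and "\<And>x y. x \<in> X' \<Longrightarrow> y \<in> X' \<Longrightarrow> (\<lambda>i. x i + y i) \<in> X'" "\<And>x c. x \<in> X' \<Longrightarrow> (\<lambda>i. c * x i) \<in> X'"
  shows "herm_form X' k"
proof -
  interpret herm_form X k by fact
  show ?thesis
    by (rule herm_form.intro)
      (fact assms(3-5) | (rule add_left scale_left herm nonneg; use assms(2) in blast))+
qed

lemma len_Cauchy_map:
  assumes k: "herm_form X k" and k': "herm_form Y k'"
    and T: "\<And>x. x \<in> X \<Longrightarrow> T x \<in> Y"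
      "\<And>x y. x \<in> X \<Longrightarrow> y \<in> X \<Longrightarrow> T (\<lambda>i. x i - y i) = (\<lambda>i. T x i - T y i)"
    and B: "0 \<le> B" "\<And>x. x \<in> X \<Longrightarrow> Re (k' (T x) (T x)) \<le> B * Re (k x x)"
    and s: "herm_form.len_Cauchy X k s"
  shows "herm_form.len_Cauchy Y k' (\<lambda>n. T (s n))"
proof -
  interpret X: herm_form X k by fact
  interpret Y: herm_form Y k' by fact
  note sX = X.len_Cauchy_mem[OF s]
  show ?thesis
    unfolding Y.len_Cauchy_def
  proof (intro conjI allI impI)
    show "T (s n) \<in> Y" for n by (rule T(1)[OF sX])
    fix \<epsilon> :: real assume "\<epsilon> > 0"
    then have "\<epsilon> / (sqrt B + 1) > 0" using B(1) by (simp add: add_nonneg_pos)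
    then obtain N where N: "\<And>m n. m \<ge> N \<Longrightarrow> n \<ge> N \<Longrightarrow> X.len (\<lambda>i. s m i - s n i) < \<epsilon> / (sqrt B + 1)"
      using s unfolding X.len_Cauchy_def by meson
    have "Y.len (\<lambda>i. T (s m) i - T (s n) i) < \<epsilon>" if "m \<ge> N" "n \<ge> N" for m n
    proof -
      have d: "(\<lambda>i. s m i - s n i) \<in> X" by (rule X.diff_mem[OF sX sX])
      have "Y.len (\<lambda>i. T (s m) i - T (s n) i) \<le> sqrt B * X.len (\<lambda>i. s m i - s n i)"
        using B(2)[OF d] T(2)[OF sX sX] by (simp add: X.len_def Y.len_def real_sqrt_mult[symmetric])
      also have "\<dots> \<le> (sqrt B + 1) * X.len (\<lambda>i. s m i - s n i)"
        using d by (simp add: algebra_simps)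
      also have "\<dots> < \<epsilon>"
        using N[OF that] B(1) add_nonneg_pos[of "sqrt B" 1] by (simp add: pos_less_divide_eq mult.commute)
      finally show ?thesis .
    qed
    then show "\<exists>N. \<forall>m\<ge>N. \<forall>n\<ge>N. Y.len (\<lambda>i. T (s m) i - T (s n) i) < \<epsilon>" by blast
  qed
qed


section \<open>Positive semidefinite kernels\<close>

text \<open>Coefficients are complex for both scalar fields. Asking for a nonnegative real value,
  and not just a nonnegative real part, makes the kernel hermitian by polarisation
  (\<open>psd_herm\<close>).\<close>

definition psd :: "'p set \<Rightarrow> ('p \<Rightarrow> 'p \<Rightarrow> complex) \<Rightarrow> bool" where
  "psd E \<kappa> \<longleftrightarrow> (\<forall>F c. finite F \<longrightarrow> F \<subseteq> E \<longrightarrow>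
     (\<Sum>p\<in>F. \<Sum>q\<in>F. c p * cnj (c q) * \<kappa> p q) \<in> \<real>\<^sub>\<ge>\<^sub>0)"

lemma psdD: "psd E \<kappa> \<Longrightarrow> finite F \<Longrightarrow> F \<subseteq> E \<Longrightarrow> (\<Sum>p\<in>F. \<Sum>q\<in>F. c p * cnj (c q) * \<kappa> p q) \<in> \<real>\<^sub>\<ge>\<^sub>0"
  by (simp add: psd_def)

text \<open>The comparison kernel may depend on the finite set \<open>F\<close>. This is how product
  kernels over infinitely many slots are reduced to products over one finite set of slots.\<close>

lemma psd_finiteI:
  assumes "\<And>F. finite F \<Longrightarrow> F \<subseteq> E \<Longrightarrow> \<exists>\<kappa>'. psd F \<kappa>' \<and> (\<forall>p\<in>F. \<forall>q\<in>F. \<kappa> p q = \<kappa>' p q)"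
  shows "psd E \<kappa>"
  unfolding psd_def
proof (intro allI impI)
  fix F and c :: "'a \<Rightarrow> complex" assume F: "finite F" "F \<subseteq> E"
  then obtain \<kappa>' where k: "psd F \<kappa>'" "\<forall>p\<in>F. \<forall>q\<in>F. \<kappa> p q = \<kappa>' p q" using assms by blast
  have "(\<Sum>p\<in>F. \<Sum>q\<in>F. c p * cnj (c q) * \<kappa> p q) = (\<Sum>p\<in>F. \<Sum>q\<in>F. c p * cnj (c q) * \<kappa>' p q)"
    using k(2) by (intro sum.cong) auto
  then show "(\<Sum>p\<in>F. \<Sum>q\<in>F. c p * cnj (c q) * \<kappa> p q) \<in> \<real>\<^sub>\<ge>\<^sub>0" using psdD[OF k(1) F(1)] by simp
qed

lemma psd_cong:
  assumes "\<And>p q. p \<in> E \<Longrightarrow> q \<in> E \<Longrightarrow> \<kappa> p q = \<kappa>' p q" "psd E \<kappa>'"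
  shows "psd E \<kappa>"
proof (rule psd_finiteI)
  fix F assume "F \<subseteq> E"
  then show "\<exists>\<kappa>'. psd F \<kappa>' \<and> (\<forall>p\<in>F. \<forall>q\<in>F. \<kappa> p q = \<kappa>' p q)"
    using assms by (intro exI[of _ \<kappa>']) (auto simp: psd_def subset_iff)
qed

lemma psd_add: "psd E \<kappa> \<Longrightarrow> psd E \<kappa>' \<Longrightarrow> psd E (\<lambda>p q. \<kappa> p q + \<kappa>' p q)"
  unfolding psd_def by (simp add: ring_distribs sum.distrib nonneg_Reals_add_I)

lemma psd_scale:
  assumes "psd E \<kappa>" "(0::real) \<le> b"
  shows "psd E (\<lambda>p q. of_real b * \<kappa> p q)"
  unfolding psd_def
proof (intro allI impI)
  fix F and c :: "'a \<Rightarrow> complex" assume F: "finite F" "F \<subseteq> E"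
  have "(\<Sum>p\<in>F. \<Sum>q\<in>F. c p * cnj (c q) * (of_real b * \<kappa> p q))
      = of_real b * (\<Sum>p\<in>F. \<Sum>q\<in>F. c p * cnj (c q) * \<kappa> p q)"
    by (simp add: sum_distrib_left ac_simps)
  then show "(\<Sum>p\<in>F. \<Sum>q\<in>F. c p * cnj (c q) * (of_real b * \<kappa> p q)) \<in> \<real>\<^sub>\<ge>\<^sub>0"
    using psdD[OF assms(1) F] assms(2) by (auto intro!: nonneg_Reals_mult_I)
qed

lemma psd_subset: "psd E \<kappa> \<Longrightarrow> F \<subseteq> E \<Longrightarrow> psd F \<kappa>"
  unfolding psd_def by blast

lemma (in herm_form) psd_pullback:
  assumes "\<And>p. p \<in> E \<Longrightarrow> h p \<in> X"
  shows "psd E (\<lambda>p q. k (h p) (h q))"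
  unfolding psd_def
proof (intro allI impI)
  fix F and c :: "'a \<Rightarrow> complex" assume F: "finite F" "F \<subseteq> E"
  let ?s = "\<lambda>i. \<Sum>p\<in>F. c p * h p i"
  have "(\<Sum>p\<in>F. \<Sum>q\<in>F. c p * cnj (c q) * k (h p) (h q)) = k ?s ?s"
    by (rule sum_sum[symmetric]) (use assms F(2) in blast)
  moreover have "?s \<in> X" by (rule sum_mem) (use assms F(2) in blast)
  ultimately show "(\<Sum>p\<in>F. \<Sum>q\<in>F. c p * cnj (c q) * k (h p) (h q)) \<in> \<real>\<^sub>\<ge>\<^sub>0"
    using self_nonneg by simp
qed

lemma psd_diag: "psd E \<kappa> \<Longrightarrow> p \<in> E \<Longrightarrow> \<kappa> p p \<in> \<real>\<^sub>\<ge>\<^sub>0"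
  using psdD[of E \<kappa> "{p}" "\<lambda>_. 1"] by simp

lemma psd_herm:
  assumes "psd E \<kappa>" "p \<in> E" "q \<in> E"
  shows "\<kappa> q p = cnj (\<kappa> p q)"
proof (cases "p = q")
  case True
  then show ?thesis using psd_diag[OF assms(1,2)] by (simp add: complex_nonneg_Reals_iff complex_eq_iff)
next
  case False
  have d: "Im (\<kappa> p p) = 0" "Im (\<kappa> q q) = 0"
    using psd_diag[OF assms(1)] assms(2,3) by (simp_all add: complex_nonneg_Reals_iff)
  \<comment> \<open>Polarisation: the coefficients 1, 1 compare the imaginary parts, the
    coefficients 1, \<open>\<i>\<close> the real parts.\<close>
  have "Im (\<kappa> p q) + Im (\<kappa> q p) = 0"
    using psdD[OF assms(1), of "{p, q}" "\<lambda>_. 1"] False assms(2,3) d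
    by (simp add: complex_nonneg_Reals_iff)
  moreover have "Re (\<kappa> q p) = Re (\<kappa> p q)"
    using psdD[OF assms(1), of "{p, q}" "\<lambda>x. if x = p then 1 else \<i>"] False assms(2,3) d
    by (simp add: complex_nonneg_Reals_iff)
  ultimately show ?thesis by (simp add: complex_eq_iff)
qed

section \<open>Schur's product theorem\<close>

lemma psd_rank_one_mult:
  assumes "psd E \<kappa>"
  shows "psd E (\<lambda>p q. a p * cnj (a q) * \<kappa> p q)"
  unfolding psd_def
proof (intro allI impI)
  fix F and c :: "'a \<Rightarrow> complex" assume F: "finite F" "F \<subseteq> E"
  show "(\<Sum>p\<in>F. \<Sum>q\<in>F. c p * cnj (c q) * (a p * cnj (a q) * \<kappa> p q)) \<in> \<real>\<^sub>\<ge>\<^sub>0"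
    using psdD[OF assms F, of "\<lambda>p. c p * a p"] by (simp add: mult_ac)
qed

lemma psd_const_one: "psd E (\<lambda>p q. 1)"
  unfolding psd_def
proof (intro allI impI)
  fix F and c :: "'a \<Rightarrow> complex"
  have "(\<Sum>p\<in>F. \<Sum>q\<in>F. c p * cnj (c q) * 1) = sum c F * cnj (sum c F)"
    by (simp add: sum_product)
  also have "\<dots> = of_real ((cmod (sum c F))\<^sup>2)" by (rule complex_norm_square[symmetric])
  finally show "(\<Sum>p\<in>F. \<Sum>q\<in>F. c p * cnj (c q) * 1) \<in> \<real>\<^sub>\<ge>\<^sub>0" by simp
qed

text \<open>A null vector is orthogonal to all others, since otherwise an affine function of
  \<open>r\<close> would be bounded on one side. This settles the elimination step with vanishing
  pivot.\<close>

lemma psd_zero_row: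
  assumes "psd E \<kappa>" "x \<in> E" "p \<in> E" "\<kappa> x x = 0"
  shows "\<kappa> x p = 0"
proof (cases "x = p")
  case False
  let ?z = "\<kappa> x p"
  have q: "2 * r * (cmod ?z)\<^sup>2 \<le> Re (\<kappa> p p)" for r :: real
  proof -
    have "(\<Sum>a\<in>{x,p}. \<Sum>b\<in>{x,p}. (if a = x then - of_real r * cnj ?z else 1)
        * cnj (if b = x then - of_real r * cnj ?z else 1) * \<kappa> a b)
      = \<kappa> p p - of_real r * (?z * cnj ?z) - of_real r * (?z * cnj ?z)"
      using False assms(4) psd_herm[OF assms(1-3)] by (simp add: algebra_simps)
    then have "\<kappa> p p - of_real r * (?z * cnj ?z) - of_real r * (?z * cnj ?z) \<in> \<real>\<^sub>\<ge>\<^sub>0"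
      using psdD[OF assms(1), of "{x, p}" "\<lambda>a. if a = x then - of_real r * cnj ?z else 1"] assms(2,3)
      by simp
    then show ?thesis
      by (simp only: complex_norm_square[symmetric]) (simp add: complex_nonneg_Reals_iff)
  qed
  show ?thesis
  proof (rule ccontr)
    assume "?z \<noteq> 0"
    then show False using q[of "(Re (\<kappa> p p) + 1) / (2 * (cmod ?z)\<^sup>2)"] by simp
  qed
qed (use assms in simp)

text \<open>Eliminating one point by its Schur complement reduces Schur's product theorem to a smaller set.\<close>

lemma psd_mult_finite:
  assumes "finite F" "psd F \<kappa>" "psd F \<kappa>'"
  shows "(\<Sum>p\<in>F. \<Sum>q\<in>F. c p * cnj (c q) * (\<kappa> p q * \<kappa>' p q)) \<in> \<real>\<^sub>\<ge>\<^sub>0"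
  using assms
proof (induction F arbitrary: \<kappa> rule: finite_induct)
  case (insert x F)
  let ?a = "\<kappa> x x"
  define S where "S p q = (if ?a = 0 then \<kappa> p q else \<kappa> p q - \<kappa> p x * \<kappa> x q / ?a)" for p q
  have herm: "\<kappa> q p = cnj (\<kappa> p q)" if "p \<in> insert x F" "q \<in> insert x F" for p q
    using psd_herm[OF insert.prems(1)] that by blast
  have areal: "?a \<in> \<real>\<^sub>\<ge>\<^sub>0" using psd_diag[OF insert.prems(1)] by blast
  have row: "S x p = 0" "S p x = 0" if "p \<in> insert x F" for p
  proof -
    have "\<kappa> x p = 0" "\<kappa> p x = 0" if "?a = 0"
      using psd_zero_row[OF insert.prems(1) _ \<open>p \<in> insert x F\<close> that] herm[of x p]
        \<open>p \<in> insert x F\<close> by simp_all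
    then show "S x p = 0" "S p x = 0" by (auto simp: S_def)
  qed
  have psdS: "psd F S"
    unfolding psd_def
  proof (intro allI impI)
    fix G and d :: "'a \<Rightarrow> complex" assume G: "finite G" "G \<subseteq> F"
    have xG: "x \<notin> G" using G insert.hyps by blast
    show "(\<Sum>p\<in>G. \<Sum>q\<in>G. d p * cnj (d q) * S p q) \<in> \<real>\<^sub>\<ge>\<^sub>0"
    proof (cases "?a = 0")
      case True
      then show ?thesis using psdD[OF insert.prems(1) G(1)] G(2) by (auto simp: S_def)
    next
      case False
      define s where "s = (\<Sum>p\<in>G. d p * \<kappa> p x)"
      have s': "cnj s = (\<Sum>q\<in>G. cnj (d q) * \<kappa> x q)"
        unfolding s_def cnj_sum complex_cnj_mult using G(2)
        by (intro sum.cong refl arg_cong2[where f = "(*)"] herm[symmetric]) auto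
      \<comment> \<open>The coefficient at \<open>x\<close> is the one that minimises the form of
        \<open>\<kappa>\<close> when the others are fixed; the minimum is the form of the Schur
        complement, which is thereby nonnegative.\<close>
      define d' where "d' p = (if p = x then - s / ?a else d p)" for p
      have "cnj ?a = ?a" using herm[of x x] by simp
      have d'G: "d' p = d p" if "p \<in> G" for p using xG that by (auto simp: d'_def)
      have "(\<Sum>p\<in>insert x G. \<Sum>q\<in>insert x G. d' p * cnj (d' q) * \<kappa> p q)
          = d' x * cnj (d' x) * ?a + d' x * (\<Sum>q\<in>G. cnj (d q) * \<kappa> x q)
            + (cnj (d' x) * (\<Sum>p\<in>G. d p * \<kappa> p x) + (\<Sum>p\<in>G. \<Sum>q\<in>G. d p * cnj (d q) * \<kappa> p q))"
      proof -
        have "(\<Sum>q\<in>insert x G. d' p * cnj (d' q) * \<kappa> p q)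
            = d' p * cnj (d' x) * \<kappa> p x + (\<Sum>q\<in>G. d' p * cnj (d q) * \<kappa> p q)" for p
          using xG G(1) d'G by simp
        then have "(\<Sum>p\<in>insert x G. \<Sum>q\<in>insert x G. d' p * cnj (d' q) * \<kappa> p q)
          = d' x * cnj (d' x) * ?a + (\<Sum>q\<in>G. d' x * cnj (d q) * \<kappa> x q)
            + ((\<Sum>p\<in>G. d p * cnj (d' x) * \<kappa> p x) + (\<Sum>p\<in>G. \<Sum>q\<in>G. d p * cnj (d q) * \<kappa> p q))"
          using xG G(1) d'G by (simp add: sum.distrib)
        moreover have "(\<Sum>q\<in>G. d' x * cnj (d q) * \<kappa> x q) = d' x * (\<Sum>q\<in>G. cnj (d q) * \<kappa> x q)"
          by (simp add: sum_distrib_left mult.assoc)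
        moreover have "(\<Sum>p\<in>G. d p * cnj (d' x) * \<kappa> p x) = cnj (d' x) * (\<Sum>p\<in>G. d p * \<kappa> p x)"
          unfolding sum_distrib_left by (intro sum.cong refl) (simp add: ac_simps)
        ultimately show ?thesis by simp
      qed
      also have "\<dots> = (\<Sum>p\<in>G. \<Sum>q\<in>G. d p * cnj (d q) * \<kappa> p q) - s * cnj s / ?a"
        unfolding s_def[symmetric] s'[symmetric] using False \<open>cnj ?a = ?a\<close>
        by (simp add: d'_def field_simps)
      also have "s * cnj s / ?a = (\<Sum>p\<in>G. \<Sum>q\<in>G. d p * cnj (d q) * (\<kappa> p x * \<kappa> x q / ?a))"
        unfolding s' unfolding s_def sum_product sum_divide_distrib
        by (intro sum.cong refl) (simp add: ac_simps)
      also have "(\<Sum>p\<in>G. \<Sum>q\<in>G. d p * cnj (d q) * \<kappa> p q) - \<dots>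
          = (\<Sum>p\<in>G. \<Sum>q\<in>G. d p * cnj (d q) * S p q)"
        using False by (simp add: S_def sum_subtractf[symmetric] algebra_simps)
      finally show ?thesis
        using psdD[OF insert.prems(1), of "insert x G" d'] G by (simp add: subset_insertI2)
    qed
  qed
  have "(\<Sum>p\<in>insert x F. \<Sum>q\<in>insert x F. c p * cnj (c q) * (S p q * \<kappa>' p q))
      = (\<Sum>p\<in>F. \<Sum>q\<in>F. c p * cnj (c q) * (S p q * \<kappa>' p q))"
    using insert.hyps row by simp
  also have "\<dots> \<in> \<real>\<^sub>\<ge>\<^sub>0"
    using insert.IH[OF psdS] psd_subset[OF insert.prems(2)] by blast
  finally have 1: "(\<Sum>p\<in>insert x F. \<Sum>q\<in>insert x F. c p * cnj (c q) * (S p q * \<kappa>' p q)) \<in> \<real>\<^sub>\<ge>\<^sub>0" .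
  show ?case
  proof (cases "?a = 0")
    case True
    then show ?thesis using 1 by (simp add: S_def)
  next
    case False
    \<comment> \<open>\<open>\<kappa>\<close> is its Schur complement plus a rank one kernel divided
      by the pivot. The product of the rank one kernel with \<open>\<kappa>'\<close> only rescales
      the coefficients.\<close>
    let ?R = "\<Sum>p\<in>insert x F. \<Sum>q\<in>insert x F. c p * cnj (c q) * (\<kappa> p x * cnj (\<kappa> q x) * \<kappa>' p q)"
    have R: "?R \<in> \<real>\<^sub>\<ge>\<^sub>0"
      by (rule psdD[OF psd_rank_one_mult[OF insert.prems(2)]]) (use insert.hyps(1) in auto)
    have "c p * cnj (c q) * (\<kappa> p q * \<kappa>' p q) = c p * cnj (c q) * (S p q * \<kappa>' p q)
        + (1 / ?a) * (c p * cnj (c q) * (\<kappa> p x * cnj (\<kappa> q x) * \<kappa>' p q))"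
      if "p \<in> insert x F" "q \<in> insert x F" for p q
    proof -
      have "S p q = \<kappa> p q - (1 / ?a) * (\<kappa> p x * cnj (\<kappa> q x))"
        unfolding S_def using False herm[OF that(2), of x] by simp
      then show ?thesis by (simp only:) (simp add: algebra_simps del: One_nat_def)
    qed
    then have "(\<Sum>p\<in>insert x F. \<Sum>q\<in>insert x F. c p * cnj (c q) * (\<kappa> p q * \<kappa>' p q))
        = (\<Sum>p\<in>insert x F. \<Sum>q\<in>insert x F. c p * cnj (c q) * (S p q * \<kappa>' p q)
        + (1 / ?a) * (c p * cnj (c q) * (\<kappa> p x * cnj (\<kappa> q x) * \<kappa>' p q)))"
      by (intro sum.cong refl) blast
    also have "\<dots> = (\<Sum>p\<in>insert x F. \<Sum>q\<in>insert x F. c p * cnj (c q) * (S p q * \<kappa>' p q)) + (1 / ?a) * ?R"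
      by (simp only: sum.distrib sum_distrib_left)
    also have "\<dots> \<in> \<real>\<^sub>\<ge>\<^sub>0"
      using areal by (intro nonneg_Reals_add_I nonneg_Reals_mult_I 1 R) (auto simp: divide_inverse)
    finally show ?thesis .
  qed
qed simp

lemma psd_mult:
  assumes "psd E \<kappa>" "psd E \<kappa>'"
  shows "psd E (\<lambda>p q. \<kappa> p q * \<kappa>' p q)"
  using psd_mult_finite psd_subset assms unfolding psd_def[of E "\<lambda>p q. \<kappa> p q * \<kappa>' p q"] by blast

lemma psd_prod:
  assumes "\<And>j. j \<in> J \<Longrightarrow> psd E (A j)"
  shows "psd E (\<lambda>p q. \<Prod>j\<in>J. A j p q)"
  using assms by (induction J rule: infinite_finite_induct) (simp_all add: psd_const_one psd_mult)

text \<open>Telescoping: the difference for \<open>insert i J\<close> is \<open>A i\<close> times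
  the difference for \<open>J\<close>, plus \<open>A i - B i\<close> times the product of the
  \<open>B j\<close>. Both are Schur products of positive semidefinite kernels.\<close>

lemma psd_prod_diff:
  assumes "\<And>j. j \<in> J \<Longrightarrow> psd E (A j)" "\<And>j. j \<in> J \<Longrightarrow> psd E (B j)"
    and "\<And>j. j \<in> J \<Longrightarrow> psd E (\<lambda>p q. A j p q - B j p q)"
  shows "psd E (\<lambda>p q. (\<Prod>j\<in>J. A j p q) - (\<Prod>j\<in>J. B j p q))"
  using assms
proof (induction J rule: infinite_finite_induct)
  case (insert i J)
  have "psd E (\<lambda>p q. A i p q * ((\<Prod>j\<in>J. A j p q) - (\<Prod>j\<in>J. B j p q))
      + (A i p q - B i p q) * (\<Prod>j\<in>J. B j p q))"
    using insert by (intro psd_add psd_mult psd_prod) auto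
  then show ?case using insert.hyps by (simp add: algebra_simps)
qed (simp_all add: psd_def)

section \<open>Completions of spans\<close>

text \<open>Extends a function on the generators linearly to formal combinations. For
  \<open>h = (\<lambda>p. \<kappa> p q)\<close> this is the coordinate at \<open>q\<close> of the
  vector; for a product of point evaluations it is the value of the associated function.\<close>

definition lcomb :: "('p \<Rightarrow> complex) \<Rightarrow> ('p \<Rightarrow> complex) \<Rightarrow> complex" where
  "lcomb c h = (\<Sum>p | c p \<noteq> 0. c p * h p)"

lemma combs_finite: "c \<in> combs K E \<Longrightarrow> finite {p. c p \<noteq> 0}"
  by (simp add: combs_def)

lemma combs_support: "c \<in> combs K E \<Longrightarrow> c p \<noteq> 0 \<Longrightarrow> p \<in> E"
  by (auto simp: combs_def)

lemma combs_UNIV: "c \<in> combs K E \<Longrightarrow> c \<in> combs UNIV E"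
  by (simp add: combs_def)

lemma combs_mono: "E \<subseteq> E' \<Longrightarrow> c \<in> combs K E \<Longrightarrow> c \<in> combs K E'"
  by (auto simp: combs_def)

lemma combs_add:
  assumes "K = \<real> \<or> K = UNIV" "c \<in> combs K E" "d \<in> combs K E"
  shows "(\<lambda>p. c p + d p) \<in> combs K E"
proof -
  have sub: "{p. c p + d p \<noteq> 0} \<subseteq> {p. c p \<noteq> 0} \<union> {p. d p \<noteq> 0}" by auto
  have "finite {p. c p + d p \<noteq> 0}"
    by (rule finite_subset[OF sub]) (use assms combs_finite in blast)
  moreover have "c p + d p \<in> K" for p using assms by (auto simp: combs_def)
  ultimately show ?thesis using sub assms(2,3) unfolding combs_def by blast
qed

lemma combs_scale:
  assumes "K = \<real> \<or> K = UNIV" "k \<in> K" "c \<in> combs K E"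
  shows "(\<lambda>p. k * c p) \<in> combs K E"
proof -
  have sub: "{p. k * c p \<noteq> 0} \<subseteq> {p. c p \<noteq> 0}" by auto
  have "finite {p. k * c p \<noteq> 0}"
    by (rule finite_subset[OF sub]) (use assms combs_finite in blast)
  moreover have "k * c p \<in> K" for p using assms by (auto simp: combs_def)
  ultimately show ?thesis using sub assms(3) unfolding combs_def by blast
qed

lemma lcomb_superset:
  assumes "finite S" "{p. c p \<noteq> 0} \<subseteq> S"
  shows "lcomb c h = (\<Sum>p\<in>S. c p * h p)"
  unfolding lcomb_def using assms by (intro sum.mono_neutral_left) auto

lemma lcomb_add:
  assumes "c \<in> combs K E" "d \<in> combs K E"
  shows "lcomb (\<lambda>p. c p + d p) h = lcomb c h + lcomb d h"
proof -
  let ?S = "{p. c p \<noteq> 0} \<union> {p. d p \<noteq> 0}"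
  have "finite ?S" using assms combs_finite by blast
  then show ?thesis
    by (subst (1 2 3) lcomb_superset[of ?S]) (auto simp: sum.distrib ring_distribs)
qed

lemma lcomb_scale: "lcomb (\<lambda>p. k * c p) h = k * lcomb c h"
  by (cases "k = 0") (simp_all add: lcomb_def sum_distrib_left mult.assoc)

lemma lcomb_diff:
  assumes "c \<in> combs K E" "d \<in> combs K E"
  shows "lcomb (\<lambda>p. c p - d p) h = lcomb c h - lcomb d h"
proof -
  let ?S = "{p. c p \<noteq> 0} \<union> {p. d p \<noteq> 0}"
  have "finite ?S" using assms combs_finite by blast
  then show ?thesis
    by (subst (1 2 3) lcomb_superset[of ?S]) (auto simp: sum_subtractf ring_distribs)
qed

lemma lcomb_cong:
  assumes "c \<in> combs K E" "\<And>p. p \<in> E \<Longrightarrow> h p = h' p"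
  shows "lcomb c h = lcomb c h'"
  unfolding lcomb_def using assms(2)[OF combs_support[OF assms(1)]] by (intro sum.cong refl) simp

lemma lcomb_indicator: "lcomb (\<lambda>p. if p = f then 1 else 0) h = h f"
  by (subst lcomb_superset[of "{f}"]) auto

lemma comb_vec_lcomb: "comb_vec E \<kappa> c q = (if q \<in> E then lcomb c (\<lambda>p. \<kappa> p q) else 0)"
  by (simp add: comb_vec_def kvec_def lcomb_def)

lemma comb_ip_superset:
  assumes "finite S" "{p. c p \<noteq> 0} \<subseteq> S" "{p. d p \<noteq> 0} \<subseteq> S"
  shows "comb_ip \<kappa> c d = (\<Sum>p\<in>S. \<Sum>q\<in>S. c p * cnj (d q) * \<kappa> p q)"
proof -
  have "(\<Sum>q | d q \<noteq> 0. c p * cnj (d q) * \<kappa> p q) = (\<Sum>q\<in>S. c p * cnj (d q) * \<kappa> p q)" for p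
    using assms by (intro sum.mono_neutral_left) auto
  then have "comb_ip \<kappa> c d = (\<Sum>p | c p \<noteq> 0. \<Sum>q\<in>S. c p * cnj (d q) * \<kappa> p q)"
    by (simp add: comb_ip_def)
  also have "\<dots> = (\<Sum>p\<in>S. \<Sum>q\<in>S. c p * cnj (d q) * \<kappa> p q)"
    using assms by (intro sum.mono_neutral_left) auto
  finally show ?thesis .
qed

lemma comb_ip_lcomb: "comb_ip \<kappa> c d = (\<Sum>q | d q \<noteq> 0. cnj (d q) * lcomb c (\<lambda>p. \<kappa> p q))"
  unfolding comb_ip_def lcomb_def
  by (subst sum.swap) (auto simp: sum_distrib_left intro!: sum.cong)

lemma herm_form_combs:
  assumes "psd E \<kappa>"
  shows "herm_form (combs UNIV E) (comb_ip \<kappa>)"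
proof
  show "(\<lambda>i. 0) \<in> combs UNIV E" by (simp add: combs_def)
next
  fix x y assume "x \<in> combs UNIV E" "y \<in> combs UNIV E"
  then show "(\<lambda>i. x i + y i) \<in> combs UNIV E" by (intro combs_add) auto
next
  fix x c assume "x \<in> combs UNIV E"
  then show "(\<lambda>i. c * x i) \<in> combs UNIV E" by (intro combs_scale) auto
next
  fix x y z assume "x \<in> combs UNIV E" "y \<in> combs UNIV E" "z \<in> combs UNIV E"
  then show "comb_ip \<kappa> (\<lambda>i. x i + y i) z = comb_ip \<kappa> x z + comb_ip \<kappa> y z"
    by (simp add: comb_ip_lcomb lcomb_add ring_distribs sum.distrib)
next
  fix x z :: "'a \<Rightarrow> complex" and c
  show "comb_ip \<kappa> (\<lambda>i. c * x i) z = c * comb_ip \<kappa> x z"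
    by (simp add: comb_ip_lcomb lcomb_scale sum_distrib_left mult.left_commute)
next
  fix x y assume xy: "x \<in> combs UNIV E" "y \<in> combs UNIV E"
  let ?S = "{p. x p \<noteq> 0} \<union> {p. y p \<noteq> 0}"
  have f: "finite ?S" using combs_finite[OF xy(1)] combs_finite[OF xy(2)] by simp
  have SE: "?S \<subseteq> E" using combs_support[OF xy(1)] combs_support[OF xy(2)] by auto
  have "cnj (comb_ip \<kappa> x y) = (\<Sum>p\<in>?S. \<Sum>q\<in>?S. y q * cnj (x p) * cnj (\<kappa> p q))"
    by (subst comb_ip_superset[OF f]) (auto simp: cnj_sum ac_simps)
  also have "\<dots> = (\<Sum>p\<in>?S. \<Sum>q\<in>?S. y q * cnj (x p) * \<kappa> q p)"
  proof (intro sum.cong refl)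
    fix p q assume "p \<in> ?S" "q \<in> ?S"
    then have "\<kappa> q p = cnj (\<kappa> p q)" by (intro psd_herm[OF assms] subsetD[OF SE])
    then show "y q * cnj (x p) * cnj (\<kappa> p q) = y q * cnj (x p) * \<kappa> q p" by simp
  qed
  also have "\<dots> = comb_ip \<kappa> y x"
    by (subst comb_ip_superset[OF f]) (auto intro: sum.swap)
  finally show "comb_ip \<kappa> y x = cnj (comb_ip \<kappa> x y)" by simp
next
  fix x assume x: "x \<in> combs UNIV E"
  have "comb_ip \<kappa> x x \<in> \<real>\<^sub>\<ge>\<^sub>0"
    unfolding comb_ip_def using combs_support[OF x]
    by (intro psdD[OF assms combs_finite[OF x]]) blast
  then show "0 \<le> Re (comb_ip \<kappa> x x)" by (simp add: complex_nonneg_Reals_iff)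
qed

lemma psd_diff_comb_le:
  assumes "psd E (\<lambda>p q. of_real B * \<kappa> p q - \<kappa>' p q)" "c \<in> combs UNIV E"
  shows "Re (comb_ip \<kappa>' c c) \<le> B * Re (comb_ip \<kappa> c c)"
proof -
  let ?S = "{p. c p \<noteq> 0}"
  have "(\<Sum>p\<in>?S. \<Sum>q\<in>?S. c p * cnj (c q) * (of_real B * \<kappa> p q - \<kappa>' p q)) \<in> \<real>\<^sub>\<ge>\<^sub>0"
    using combs_support[OF assms(2)] by (intro psdD[OF assms(1) combs_finite[OF assms(2)]]) blast
  moreover have "(\<Sum>p\<in>?S. \<Sum>q\<in>?S. c p * cnj (c q) * (of_real B * \<kappa> p q - \<kappa>' p q))
      = of_real B * comb_ip \<kappa> c c - comb_ip \<kappa>' c c"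
    unfolding comb_ip_def
    by (simp add: right_diff_distrib sum_subtractf sum_distrib_left mult.left_commute)
  ultimately show ?thesis by (simp add: complex_nonneg_Reals_iff)
qed

lemma comb_ip_rank_one: "comb_ip (\<lambda>p q. h p * cnj (h q)) c c = of_real ((cmod (lcomb c h))\<^sup>2)"
  unfolding complex_norm_square comb_ip_def lcomb_def cnj_sum sum_product
  by (intro sum.cong refl) simp

text \<open>A bound by the seminorm also makes \<open>h\<close> well defined on vectors: it
  annihilates the combinations of length zero.\<close>

definition bounded_fun :: "'p set \<Rightarrow> ('p \<Rightarrow> 'p \<Rightarrow> complex) \<Rightarrow> ('p \<Rightarrow> complex) \<Rightarrow> bool" where
  "bounded_fun E \<kappa> h \<longleftrightarrow>
     (\<exists>B\<ge>0. \<forall>c\<in>combs UNIV E. cmod (lcomb c h) \<le> B * sqrt (Re (comb_ip \<kappa> c c)))"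

text \<open>The squared modulus of the functional is the form of the rank one kernel
  \<open>h p * cnj (h q)\<close>, so boundedness becomes a comparison of kernels and can be verified
  slot by slot.\<close>

lemma bounded_funI_psd:
  assumes "0 \<le> B" "psd E (\<lambda>p q. of_real B * \<kappa> p q - h p * cnj (h q))"
  shows "bounded_fun E \<kappa> h"
proof -
  have "cmod (lcomb c h) \<le> sqrt B * sqrt (Re (comb_ip \<kappa> c c))" if "c \<in> combs UNIV E" for c
    using psd_diff_comb_le[OF assms(2) that] real_le_rsqrt
    by (fastforce simp: comb_ip_rank_one real_sqrt_mult[symmetric])
  then show ?thesis using assms(1) unfolding bounded_fun_def by (intro exI[of _ "sqrt B"]) auto
qed

locale hull =
  fixes K :: "complex set" and E :: "'p set" and \<kappa> :: "'p \<Rightarrow> 'p \<Rightarrow> complex"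
  assumes K: "K = \<real> \<or> K = UNIV" and psd: "psd E \<kappa>"
begin

sublocale herm_form "combs UNIV E" "comb_ip \<kappa>"
  by (rule herm_form_combs[OF psd])

abbreviation "hilb \<equiv> hilbert_hull K E \<kappa>"

lemma carr_hull: "\<Phi> \<in> carr hilb \<longleftrightarrow> (\<exists>s. approximates K E \<kappa> s \<Phi>)"
  by (simp add: hilbert_hull_def)

lemma approximates_iff:
  "approximates K E \<kappa> s \<Phi> \<longleftrightarrow> (\<forall>n. s n \<in> combs K E) \<and> len_Cauchy s \<and>
     (\<forall>q\<in>E. (\<lambda>n. lcomb (s n) (\<lambda>p. \<kappa> p q)) \<longlonglongrightarrow> \<Phi> q) \<and> (\<forall>q. q \<notin> E \<longrightarrow> \<Phi> q = 0)"
proof -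
  have 1: "(\<forall>q. (\<lambda>n. comb_vec E \<kappa> (s n) q) \<longlonglongrightarrow> \<Phi> q) \<longleftrightarrow>
      (\<forall>q\<in>E. (\<lambda>n. lcomb (s n) (\<lambda>p. \<kappa> p q)) \<longlonglongrightarrow> \<Phi> q) \<and> (\<forall>q. q \<notin> E \<longrightarrow> \<Phi> q = 0)"
  proof -
    have "((\<lambda>n. comb_vec E \<kappa> (s n) q) \<longlonglongrightarrow> \<Phi> q) \<longleftrightarrow>
        (if q \<in> E then (\<lambda>n. lcomb (s n) (\<lambda>p. \<kappa> p q)) \<longlonglongrightarrow> \<Phi> q else \<Phi> q = 0)" for q
      unfolding comb_vec_lcomb by (cases "q \<in> E") (auto simp: LIMSEQ_const_iff)
    then show ?thesis by auto
  qed
  show ?thesis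
    unfolding approximates_def 1 len_Cauchy_def comb_dist_def len_def using combs_UNIV by blast
qed

lemma approximates_combs: "approximates K E \<kappa> s \<Phi> \<Longrightarrow> s n \<in> combs K E"
  and approximates_Cauchy: "approximates K E \<kappa> s \<Phi> \<Longrightarrow> len_Cauchy s"
  and approximates_lim: "approximates K E \<kappa> s \<Phi> \<Longrightarrow> q \<in> E \<Longrightarrow> (\<lambda>n. lcomb (s n) (\<lambda>p. \<kappa> p q)) \<longlonglongrightarrow> \<Phi> q"
  and approximates_zero: "approximates K E \<kappa> s \<Phi> \<Longrightarrow> q \<notin> E \<Longrightarrow> \<Phi> q = 0"
  unfolding approximates_iff by blast+

lemma approximates_add:
  assumes "approximates K E \<kappa> s \<Phi>" "approximates K E \<kappa> t \<Psi>"
  shows "approximates K E \<kappa> (\<lambda>n p. s n p + t n p) (\<lambda>q. \<Phi> q + \<Psi> q)"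
  unfolding approximates_iff
proof (intro conjI ballI allI impI)
  show "len_Cauchy (\<lambda>n p. s n p + t n p)"
    using assms approximates_Cauchy len_Cauchy_add by blast
  fix q assume "q \<in> E"
  then show "(\<lambda>n. lcomb (\<lambda>p. s n p + t n p) (\<lambda>p. \<kappa> p q)) \<longlonglongrightarrow> \<Phi> q + \<Psi> q"
    unfolding lcomb_add[OF approximates_combs[OF assms(1)] approximates_combs[OF assms(2)]]
    by (intro tendsto_add approximates_lim assms)
next
  show "(\<lambda>p. s n p + t n p) \<in> combs K E" for n
    using combs_add[OF K assms[THEN approximates_combs]] .
  show "\<Phi> q + \<Psi> q = 0" if "q \<notin> E" for q
    using assms[THEN approximates_zero, OF that] by simp
qed

lemma approximates_scale:
  assumes "approximates K E \<kappa> s \<Phi>" "k \<in> K"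
  shows "approximates K E \<kappa> (\<lambda>n p. k * s n p) (\<lambda>q. k * \<Phi> q)"
  unfolding approximates_iff
proof (intro conjI ballI allI impI)
  show "len_Cauchy (\<lambda>n p. k * s n p)"
    using assms approximates_Cauchy len_Cauchy_scale by blast
  fix q assume "q \<in> E"
  then show "(\<lambda>n. lcomb (\<lambda>p. k * s n p) (\<lambda>p. \<kappa> p q)) \<longlonglongrightarrow> k * \<Phi> q"
    unfolding lcomb_scale by (intro tendsto_mult_left approximates_lim assms(1))
next
  show "(\<lambda>p. k * s n p) \<in> combs K E" for n
    using combs_scale[OF K assms(2) approximates_combs[OF assms(1)]] .
  show "k * \<Phi> q = 0" if "q \<notin> E" for q
    using approximates_zero[OF assms(1) that] by simp
qed

lemma approximates_kvec:
  assumes "f \<in> E"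
  shows "approximates K E \<kappa> (\<lambda>n p. if p = f then 1 else 0) (kvec E \<kappa> f)"
proof -
  have "(\<lambda>p. if p = f then 1 else 0 :: complex) \<in> combs K E" using K assms by (auto simp: combs_def)
  moreover from this have "len_Cauchy (\<lambda>n p. if p = f then 1 else 0)"
    using combs_UNIV zero_left[OF zero_mem] by (auto simp: len_Cauchy_def len_def)
  ultimately show ?thesis by (auto simp: approximates_iff lcomb_indicator kvec_def)
qed

lemma null_seq:
  assumes "len_Cauchy d" "\<And>q. q \<in> E \<Longrightarrow> (\<lambda>n. lcomb (d n) (\<lambda>p. \<kappa> p q)) \<longlonglongrightarrow> 0"
  shows "(\<lambda>n. len (d n)) \<longlonglongrightarrow> 0"
proof (rule len_Cauchy_null[OF assms(1)])
  fix N
  have dN: "d N \<in> combs UNIV E" using assms(1) by (rule len_Cauchy_mem)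
  have "(\<lambda>n. \<Sum>q | d N q \<noteq> 0. cnj (d N q) * lcomb (d n) (\<lambda>p. \<kappa> p q)) \<longlonglongrightarrow> (\<Sum>q | d N q \<noteq> 0. cnj (d N q) * 0)"
    by (intro tendsto_sum tendsto_mult_left assms(2)) (use combs_support[OF dN] in blast)
  then show "(\<lambda>n. comb_ip \<kappa> (d n) (d N)) \<longlonglongrightarrow> 0" by (simp add: comb_ip_lcomb)
qed

text \<open>The realisation of vectors as functionals loses nothing: by \<open>null_seq\<close> a
  sequence whose coordinates tend to zero is null in norm. Norms and extensions are therefore
  independent of the approximating sequence.\<close>

lemma approximates_diff_null:
  assumes s: "approximates K E \<kappa> s \<Phi>" and t: "approximates K E \<kappa> t \<Phi>"
  shows "(\<lambda>n. len (\<lambda>p. s n p - t n p)) \<longlonglongrightarrow> 0"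
proof (rule null_seq)
  show "len_Cauchy (\<lambda>n p. s n p - t n p)"
    using s t approximates_Cauchy len_Cauchy_diff by blast
  fix q assume "q \<in> E"
  then show "(\<lambda>n. lcomb (\<lambda>p. s n p - t n p) (\<lambda>p. \<kappa> p q)) \<longlonglongrightarrow> 0"
    using tendsto_diff[OF approximates_lim[OF s] approximates_lim[OF t], of q q]
    unfolding lcomb_diff[OF approximates_combs[OF s] approximates_combs[OF t]] by simp
qed

lemma nrm_tendsto:
  assumes s: "approximates K E \<kappa> s \<Phi>"
  shows "(\<lambda>n. len (s n)) \<longlonglongrightarrow> nrm hilb \<Phi>"
proof -
  have mem: "s n \<in> combs UNIV E" if "approximates K E \<kappa> s \<Phi>" for s n
    using len_Cauchy_mem[OF approximates_Cauchy[OF that]] .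
  obtain L where L: "(\<lambda>n. len (s n)) \<longlonglongrightarrow> L"
    using Cauchy_convergent[OF Cauchy_len[OF approximates_Cauchy[OF s]]] convergent_def by blast
  have L': "(\<lambda>n. len (t n)) \<longlonglongrightarrow> L" if t: "approximates K E \<kappa> t \<Phi>" for t
  proof -
    have "(\<lambda>n. len (t n) - len (s n)) \<longlonglongrightarrow> 0"
    proof (rule Lim_null_comparison[OF _ approximates_diff_null[OF t s]])
      show "\<forall>\<^sub>F n in sequentially. norm (len (t n) - len (s n)) \<le> len (\<lambda>p. t n p - s n p)"
        using len_diff_abs[OF mem[OF t] mem[OF s]] by simp
    qed
    from tendsto_add[OF this L] show ?thesis by simp
  qed
  \<comment> \<open>The inner product of the completion is a definite description over all pairs of
    approximating sequences, so the limit has to be found for two different sequences as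
    well.\<close>
  have lim: "(\<lambda>n. comb_ip \<kappa> (t n) (t' n)) \<longlonglongrightarrow> of_real (L\<^sup>2)"
    if t: "approximates K E \<kappa> t \<Phi>" and t': "approximates K E \<kappa> t' \<Phi>" for t t'
  proof -
    have "(\<lambda>n. comb_ip \<kappa> (t n) (\<lambda>p. t' n p - t n p)) \<longlonglongrightarrow> 0"
    proof (rule Lim_null_comparison)
      show "\<forall>\<^sub>F n in sequentially. norm (comb_ip \<kappa> (t n) (\<lambda>p. t' n p - t n p))
          \<le> len (t n) * len (\<lambda>p. t' n p - t n p)"
        using Cauchy_Schwarz_len[OF mem[OF t] diff_mem[OF mem[OF t'] mem[OF t]]] by simp
      show "(\<lambda>n. len (t n) * len (\<lambda>p. t' n p - t n p)) \<longlonglongrightarrow> 0"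
        using tendsto_mult[OF L'[OF t] approximates_diff_null[OF t' t]] by simp
    qed
    moreover have "(\<lambda>n. complex_of_real ((len (t n))\<^sup>2)) \<longlonglongrightarrow> of_real (L\<^sup>2)"
      using L'[OF t] by (intro tendsto_intros)
    ultimately have "(\<lambda>n. comb_ip \<kappa> (t n) (\<lambda>p. t' n p - t n p) + of_real ((len (t n))\<^sup>2))
        \<longlonglongrightarrow> 0 + of_real (L\<^sup>2)"
      by (rule tendsto_add)
    moreover have "comb_ip \<kappa> (t n) (\<lambda>p. t' n p - t n p) + of_real ((len (t n))\<^sup>2)
        = comb_ip \<kappa> (t n) (t' n)" for n
    proof -
      have "complex_of_real ((len (t n))\<^sup>2) = comb_ip \<kappa> (t n) (t n)"
        using self_nonneg[OF mem[OF t]] len_sq[OF mem[OF t]]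
        by (simp add: complex_nonneg_Reals_iff complex_eq_iff)
      then show ?thesis using diff_right[OF mem[OF t'] mem[OF t] mem[OF t]] by simp
    qed
    ultimately show ?thesis by simp
  qed
  have "ip hilb \<Phi> \<Phi> = of_real (L\<^sup>2)"
    unfolding hilbert_hull_def ips.simps
  proof (rule the_equality)
    fix z assume "\<forall>s t. approximates K E \<kappa> s \<Phi> \<longrightarrow> approximates K E \<kappa> t \<Phi> \<longrightarrow>
        (\<lambda>n. comb_ip \<kappa> (s n) (t n)) \<longlonglongrightarrow> z"
    then show "z = of_real (L\<^sup>2)" using lim[OF s s] s LIMSEQ_unique by blast
  qed (use lim in blast)
  moreover have "0 \<le> L" using L len_nonneg[OF mem[OF s]] by (meson LIMSEQ_le_const)
  ultimately have "nrm hilb \<Phi> = L" by (simp add: nrm_def)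
  then show ?thesis using L by simp
qed

lemma nrm_nonneg:
  assumes "\<Phi> \<in> carr hilb"
  shows "0 \<le> nrm hilb \<Phi>"
proof -
  obtain s where s: "approximates K E \<kappa> s \<Phi>" using assms unfolding carr_hull ..
  show ?thesis
    using LIMSEQ_le_const[OF nrm_tendsto[OF s]] len_nonneg[OF len_Cauchy_mem[OF approximates_Cauchy[OF s]]]
    by blast
qed

section \<open>Extension of bounded functionals to the completion\<close>

lemma bounded_funD:
  assumes "bounded_fun E \<kappa> h"
  shows "\<exists>B\<ge>0. \<forall>c\<in>combs UNIV E. cmod (lcomb c h) \<le> B * len c"
  using assms unfolding bounded_fun_def len_def .

lemma bounded_fun_null:
  assumes "bounded_fun E \<kappa> h" "\<And>n. d n \<in> combs UNIV E" "(\<lambda>n. len (d n)) \<longlonglongrightarrow> 0"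
  shows "(\<lambda>n. lcomb (d n) h) \<longlonglongrightarrow> 0"
proof -
  obtain B where "\<forall>c\<in>combs UNIV E. cmod (lcomb c h) \<le> B * len c"
    using bounded_funD[OF assms(1)] by blast
  then have "\<forall>\<^sub>F n in sequentially. norm (lcomb (d n) h) \<le> B * len (d n)" using assms(2) by simp
  moreover have "(\<lambda>n. B * len (d n)) \<longlonglongrightarrow> 0" using tendsto_mult_right_zero[OF assms(3)] by blast
  ultimately show ?thesis by (rule Lim_null_comparison)
qed

text \<open>For bounded \<open>h\<close> the chosen sequence is immaterial, by
  \<open>ext_tendsto\<close>.\<close>

definition ext :: "('p \<Rightarrow> complex) \<Rightarrow> ('p \<Rightarrow> complex) \<Rightarrow> complex" where
  "ext h \<Phi> = lim (\<lambda>n. lcomb ((SOME s. approximates K E \<kappa> s \<Phi>) n) h)"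

lemma ext_tendsto:
  assumes h: "bounded_fun E \<kappa> h" and s: "approximates K E \<kappa> s \<Phi>"
  shows "(\<lambda>n. lcomb (s n) h) \<longlonglongrightarrow> ext h \<Phi>"
proof -
  define t where "t = (SOME s. approximates K E \<kappa> s \<Phi>)"
  have t: "approximates K E \<kappa> t \<Phi>" unfolding t_def
    by (rule someI[where P = "\<lambda>s. approximates K E \<kappa> s \<Phi>"]) (rule s)
  obtain B where B: "0 \<le> B" "\<forall>c\<in>combs UNIV E. cmod (lcomb c h) \<le> B * len c"
    using bounded_funD[OF h] by blast
  note tm = len_Cauchy_mem[OF approximates_Cauchy[OF t]]
  note sm = len_Cauchy_mem[OF approximates_Cauchy[OF s]]
  have "Cauchy (\<lambda>n. lcomb (t n) h)"
  proof (rule CauchyI)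
    fix \<epsilon> :: real assume "\<epsilon> > 0"
    then have "\<epsilon> / (B + 1) > 0" using B(1) by simp
    then obtain N where N: "\<And>m n. m \<ge> N \<Longrightarrow> n \<ge> N \<Longrightarrow> len (\<lambda>i. t m i - t n i) < \<epsilon> / (B + 1)"
      using approximates_Cauchy[OF t] unfolding len_Cauchy_def by meson
    have "norm (lcomb (t m) h - lcomb (t n) h) < \<epsilon>" if "m \<ge> N" "n \<ge> N" for m n
    proof -
      have "norm (lcomb (t m) h - lcomb (t n) h) \<le> B * len (\<lambda>i. t m i - t n i)"
        using bspec[OF B(2) diff_mem[OF tm tm]] lcomb_diff[OF tm tm] by simp
      also have "\<dots> \<le> (B + 1) * len (\<lambda>i. t m i - t n i)"
        using diff_mem[OF tm tm] by (simp add: algebra_simps)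
      also have "\<dots> < \<epsilon>" using N[OF that] B(1) by (simp add: pos_less_divide_eq mult.commute)
      finally show ?thesis .
    qed
    then show "\<exists>M. \<forall>m\<ge>M. \<forall>n\<ge>M. norm (lcomb (t m) h - lcomb (t n) h) < \<epsilon>" by blast
  qed
  then have L: "(\<lambda>n. lcomb (t n) h) \<longlonglongrightarrow> ext h \<Phi>"
    unfolding ext_def t_def[symmetric] using Cauchy_convergent convergent_LIMSEQ_iff by blast
  have "(\<lambda>n. lcomb (\<lambda>p. s n p - t n p) h) \<longlonglongrightarrow> 0"
    using bounded_fun_null[OF h diff_mem[OF sm tm] approximates_diff_null[OF s t]] .
  from tendsto_add[OF this L] show ?thesis using lcomb_diff[OF sm tm] by simp
qed

lemma ext_add:
  assumes "bounded_fun E \<kappa> h" "\<Phi> \<in> carr hilb" "\<Psi> \<in> carr hilb"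
  shows "ext h (\<lambda>q. \<Phi> q + \<Psi> q) = ext h \<Phi> + ext h \<Psi>"
proof -
  obtain s t where st: "approximates K E \<kappa> s \<Phi>" "approximates K E \<kappa> t \<Psi>"
    using assms(2,3) unfolding carr_hull by blast
  have "(\<lambda>n. lcomb (\<lambda>p. s n p + t n p) h) \<longlonglongrightarrow> ext h \<Phi> + ext h \<Psi>"
    using lcomb_add[OF approximates_combs[OF st(1)] approximates_combs[OF st(2)]]
      tendsto_add[OF ext_tendsto[OF assms(1) st(1)] ext_tendsto[OF assms(1) st(2)]] by simp
  then show ?thesis using ext_tendsto[OF assms(1) approximates_add[OF st]] LIMSEQ_unique by blast
qed

lemma ext_scale:
  assumes "bounded_fun E \<kappa> h" "\<Phi> \<in> carr hilb" "k \<in> K"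
  shows "ext h (\<lambda>q. k * \<Phi> q) = k * ext h \<Phi>"
proof -
  obtain s where s: "approximates K E \<kappa> s \<Phi>" using assms(2) unfolding carr_hull by blast
  have "(\<lambda>n. lcomb (\<lambda>p. k * s n p) h) \<longlonglongrightarrow> k * ext h \<Phi>"
    unfolding lcomb_scale by (intro tendsto_mult_left ext_tendsto assms(1) s)
  then show ?thesis using ext_tendsto[OF assms(1) approximates_scale[OF s assms(3)]] LIMSEQ_unique by blast
qed

lemma ext_kvec:
  assumes "bounded_fun E \<kappa> h" "f \<in> E"
  shows "ext h (kvec E \<kappa> f) = h f"
  using ext_tendsto[OF assms(1) approximates_kvec[OF assms(2)]] LIMSEQ_unique[OF tendsto_const]
  by (simp add: lcomb_indicator LIMSEQ_const_iff)

lemma ext_bounded: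
  assumes "bounded_fun E \<kappa> h"
  shows "\<exists>C. \<forall>\<Phi>\<in>carr hilb. cmod (ext h \<Phi>) \<le> C * nrm hilb \<Phi>"
proof -
  obtain B where B: "\<forall>c\<in>combs UNIV E. cmod (lcomb c h) \<le> B * len c"
    using bounded_funD[OF assms] by blast
  have "cmod (ext h \<Phi>) \<le> B * nrm hilb \<Phi>" if "approximates K E \<kappa> s \<Phi>" for s \<Phi>
  proof (rule LIMSEQ_le)
    show "(\<lambda>n. cmod (lcomb (s n) h)) \<longlonglongrightarrow> cmod (ext h \<Phi>)"
      by (intro tendsto_norm ext_tendsto assms that)
    show "(\<lambda>n. B * len (s n)) \<longlonglongrightarrow> B * nrm hilb \<Phi>"
      by (intro tendsto_mult_left nrm_tendsto that)
    show "\<exists>N. \<forall>n\<ge>N. cmod (lcomb (s n) h) \<le> B * len (s n)"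
      using B len_Cauchy_mem[OF approximates_Cauchy[OF that]] by blast
  qed
  then show ?thesis by (intro exI[of _ B]) (auto simp: carr_hull)
qed

lemma eqI_vanishing:
  assumes "approximates K E \<kappa> s \<Phi>" "approximates K E \<kappa> t \<Psi>"
    and "\<And>q. q \<in> E \<Longrightarrow> (\<lambda>n. lcomb (\<lambda>p. s n p - t n p) (\<lambda>p. \<kappa> p q)) \<longlonglongrightarrow> 0"
  shows "\<Phi> = \<Psi>"
proof
  fix q show "\<Phi> q = \<Psi> q"
  proof (cases "q \<in> E")
    case True
    have "(\<lambda>n. lcomb (\<lambda>p. s n p - t n p) (\<lambda>p. \<kappa> p q)) \<longlonglongrightarrow> \<Phi> q - \<Psi> q"
      using lcomb_diff[OF approximates_combs[OF assms(1)] approximates_combs[OF assms(2)]]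
        tendsto_diff[OF approximates_lim[OF assms(1) True] approximates_lim[OF assms(2) True]] by simp
    then show ?thesis using assms(3)[OF True] LIMSEQ_unique by fastforce
  next
    case False
    then show ?thesis using approximates_zero[OF assms(1)] approximates_zero[OF assms(2)] by simp
  qed
qed

end

text \<open>The map is built coordinatewise: the coordinate of the image at \<open>q\<close> extends
  \<open>\<lambda>p. \<kappa>' p q\<close>, which is bounded on the source by Cauchy-Schwarz in the
  target. Domination of the kernels says nothing about the kernel of the extended map, so
  \<open>inj\<close> is required separately, for sequences rather than for vectors.\<close>

lemma hull_embedding:
  assumes K: "K = \<real> \<or> K = UNIV" and V: "psd E \<kappa>" and W: "psd E' \<kappa>'" and sub: "E \<subseteq> E'"
    and B: "0 \<le> B" "psd E (\<lambda>p q. of_real B * \<kappa> p q - \<kappa>' p q)"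
    and inj: "\<And>d q. herm_form.len_Cauchy (combs UNIV E) (comb_ip \<kappa>) d \<Longrightarrow>
        (\<lambda>n. sqrt (Re (comb_ip \<kappa>' (d n) (d n)))) \<longlonglongrightarrow> 0 \<Longrightarrow> q \<in> E \<Longrightarrow>
        (\<lambda>n. lcomb (d n) (\<lambda>p. \<kappa> p q)) \<longlonglongrightarrow> 0"
  shows "\<exists>T. T \<in> carr (hilbert_hull K E \<kappa>) \<rightarrow> carr (hilbert_hull K E' \<kappa>') \<and>
          lin_map K (carr (hilbert_hull K E \<kappa>)) T \<and>
          inj_on T (carr (hilbert_hull K E \<kappa>)) \<and>
          (\<exists>C. \<forall>\<Phi>\<in>carr (hilbert_hull K E \<kappa>).
             nrm (hilbert_hull K E' \<kappa>') (T \<Phi>) \<le> C * nrm (hilbert_hull K E \<kappa>) \<Phi>) \<and>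
          (\<forall>f\<in>E. T (kvec E \<kappa> f) = kvec E' \<kappa>' f)"
proof -
  interpret V: hull K E \<kappa> using K V by unfold_locales
  interpret W: hull K E' \<kappa>' using K W by unfold_locales
  have le: "W.len c \<le> sqrt B * V.len c" if "c \<in> combs UNIV E" for c
    using psd_diff_comb_le[OF B(2) that] by (simp add: V.len_def W.len_def real_sqrt_mult[symmetric])
  have bf: "bounded_fun E \<kappa> (\<lambda>p. \<kappa>' p q)" if q: "q \<in> E'" for q
    unfolding bounded_fun_def
  proof (intro exI[of _ "sqrt B * W.len (\<lambda>p. if p = q then 1 else 0)"] conjI ballI)
    have qm: "(\<lambda>p. if p = q then 1 else 0) \<in> combs UNIV E'" using q by (auto simp: combs_def)
    then show "0 \<le> sqrt B * W.len (\<lambda>p. if p = q then 1 else 0)" using B(1) by simp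
    fix c assume c: "c \<in> combs UNIV E"
    have "{p. (if p = q then 1 else 0 :: complex) \<noteq> 0} = {q}" by auto
    then have "comb_ip \<kappa>' c (\<lambda>p. if p = q then 1 else 0) = lcomb c (\<lambda>p. \<kappa>' p q)"
      unfolding comb_ip_lcomb by simp
    then have "cmod (lcomb c (\<lambda>p. \<kappa>' p q)) \<le> W.len c * W.len (\<lambda>p. if p = q then 1 else 0)"
      using W.Cauchy_Schwarz_len[OF combs_mono[OF sub c] qm] by simp
    also have "\<dots> \<le> sqrt B * V.len c * W.len (\<lambda>p. if p = q then 1 else 0)"
      by (intro mult_right_mono le c W.len_nonneg qm)
    finally show "cmod (lcomb c (\<lambda>p. \<kappa>' p q))
        \<le> sqrt B * W.len (\<lambda>p. if p = q then 1 else 0) * sqrt (Re (comb_ip \<kappa> c c))"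
      by (simp add: V.len_def mult_ac)
  qed
  define T where "T \<Phi> = (\<lambda>q. if q \<in> E' then V.ext (\<lambda>p. \<kappa>' p q) \<Phi> else 0)" for \<Phi>
  have Cauchy: "W.len_Cauchy s" if s: "V.len_Cauchy s" for s
    by (rule len_Cauchy_map[where T = "\<lambda>x. x", OF V.herm_form_axioms W.herm_form_axioms combs_mono[OF sub] refl B(1)
          psd_diff_comb_le[OF B(2)] s])
  have appr: "approximates K E' \<kappa>' s (T \<Phi>)" if s: "approximates K E \<kappa> s \<Phi>" for s \<Phi>
    unfolding W.approximates_iff
    using V.approximates_combs[OF s] combs_mono[OF sub] Cauchy[OF V.approximates_Cauchy[OF s]]
      V.ext_tendsto[OF bf s] by (auto simp: T_def)
  have "inj_on T (carr V.hilb)"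
  proof (rule inj_onI)
    fix \<Phi> \<Psi> assume "\<Phi> \<in> carr V.hilb" "\<Psi> \<in> carr V.hilb" and eq: "T \<Phi> = T \<Psi>"
    then obtain s t where st: "approximates K E \<kappa> s \<Phi>" "approximates K E \<kappa> t \<Psi>"
      unfolding V.carr_hull by blast
    have "approximates K E' \<kappa>' t (T \<Phi>)" using appr[OF st(2)] eq by simp
    then have "(\<lambda>n. W.len (\<lambda>p. s n p - t n p)) \<longlonglongrightarrow> 0"
      using W.approximates_diff_null[OF appr[OF st(1)]] by blast
    then show "\<Phi> = \<Psi>"
      using V.eqI_vanishing[OF st] inj[OF V.len_Cauchy_diff[OF st[THEN V.approximates_Cauchy]]]
      by (simp add: W.len_def)
  qed
  moreover have "lin_map K (carr V.hilb) T"
    unfolding lin_map_def T_def using V.ext_add[OF bf] V.ext_scale[OF bf] by fastforce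
  moreover have "nrm W.hilb (T \<Phi>) \<le> sqrt B * nrm V.hilb \<Phi>" if "\<Phi> \<in> carr V.hilb" for \<Phi>
  proof -
    obtain s where s: "approximates K E \<kappa> s \<Phi>"
      using \<open>\<Phi> \<in> carr V.hilb\<close> unfolding V.carr_hull ..
    show ?thesis
    proof (rule LIMSEQ_le)
      show "(\<lambda>n. W.len (s n)) \<longlonglongrightarrow> nrm W.hilb (T \<Phi>)" by (intro W.nrm_tendsto appr s)
      show "(\<lambda>n. sqrt B * V.len (s n)) \<longlonglongrightarrow> sqrt B * nrm V.hilb \<Phi>"
        by (intro tendsto_mult_left V.nrm_tendsto s)
      show "\<exists>N. \<forall>n\<ge>N. W.len (s n) \<le> sqrt B * V.len (s n)"
        using le V.len_Cauchy_mem[OF V.approximates_Cauchy[OF s]] by blast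
    qed
  qed
  moreover have "T \<in> carr V.hilb \<rightarrow> carr W.hilb"
  proof
    fix \<Phi> assume "\<Phi> \<in> carr V.hilb"
    then obtain s where "approximates K E \<kappa> s \<Phi>" unfolding V.carr_hull ..
    show "T \<Phi> \<in> carr W.hilb"
      unfolding W.carr_hull by (rule exI[of _ s]) (rule appr[OF \<open>approximates K E \<kappa> s \<Phi>\<close>])
  qed
  moreover have "T (kvec E \<kappa> f) = kvec E' \<kappa>' f" if "f \<in> E" for f
    using V.ext_kvec[OF bf that] by (auto simp: T_def kvec_def)
  ultimately show ?thesis by (intro exI[of _ T]) blast
qed

text \<open>The construction of \<open>hull_embedding\<close> with the functionals
  \<open>h y\<close> in place of the coordinates of a second completion.\<close>

lemma hull_functions:
  assumes K: "K = \<real> \<or> K = UNIV" and V: "psd E \<kappa>"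
    and b: "\<And>y. y \<in> Y \<Longrightarrow> bounded_fun E \<kappa> (h y)"
    and inj: "\<And>d q. herm_form.len_Cauchy (combs UNIV E) (comb_ip \<kappa>) d \<Longrightarrow>
        (\<And>y. y \<in> Y \<Longrightarrow> (\<lambda>n. lcomb (d n) (h y)) \<longlonglongrightarrow> 0) \<Longrightarrow> q \<in> E \<Longrightarrow>
        (\<lambda>n. lcomb (d n) (\<lambda>p. \<kappa> p q)) \<longlonglongrightarrow> 0"
  shows "\<exists>R. lin_map K (carr (hilbert_hull K E \<kappa>)) R \<and>
          (\<forall>\<Phi>\<in>carr (hilbert_hull K E \<kappa>). \<forall>\<Psi>\<in>carr (hilbert_hull K E \<kappa>).
             (\<forall>y\<in>Y. R \<Phi> y = R \<Psi> y) \<longrightarrow> \<Phi> = \<Psi>) \<and>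
          (\<forall>y\<in>Y. \<exists>C. \<forall>\<Phi>\<in>carr (hilbert_hull K E \<kappa>).
             cmod (R \<Phi> y) \<le> C * nrm (hilbert_hull K E \<kappa>) \<Phi>) \<and>
          (\<forall>f\<in>E. \<forall>y\<in>Y. R (kvec E \<kappa> f) y = h y f)"
proof -
  interpret V: hull K E \<kappa> using K V by unfold_locales
  define R where "R \<Phi> = (\<lambda>y. if y \<in> Y then V.ext (h y) \<Phi> else 0)" for \<Phi>
  have "\<Phi> = \<Psi>" if "\<Phi> \<in> carr V.hilb" "\<Psi> \<in> carr V.hilb" and eq: "\<forall>y\<in>Y. R \<Phi> y = R \<Psi> y" for \<Phi> \<Psi>
  proof -
    obtain s t where st: "approximates K E \<kappa> s \<Phi>" "approximates K E \<kappa> t \<Psi>"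
      using \<open>\<Phi> \<in> carr V.hilb\<close> \<open>\<Psi> \<in> carr V.hilb\<close> unfolding V.carr_hull by blast
    have "(\<lambda>n. lcomb (\<lambda>p. s n p - t n p) (h y)) \<longlonglongrightarrow> 0" if "y \<in> Y" for y
      using lcomb_diff[OF V.approximates_combs[OF st(1)] V.approximates_combs[OF st(2)]] that eq
        tendsto_diff[OF V.ext_tendsto[OF b[OF that] st(1)] V.ext_tendsto[OF b[OF that] st(2)]]
      by (simp add: R_def)
    then show "\<Phi> = \<Psi>"
      by (intro V.eqI_vanishing[OF st] inj V.len_Cauchy_diff st[THEN V.approximates_Cauchy])
  qed
  moreover have "lin_map K (carr V.hilb) R"
    unfolding lin_map_def R_def using V.ext_add[OF b] V.ext_scale[OF b] by fastforce
  moreover have "\<exists>C. \<forall>\<Phi>\<in>carr V.hilb. cmod (R \<Phi> y) \<le> C * nrm V.hilb \<Phi>" if "y \<in> Y" for y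
    using V.ext_bounded[OF b[OF that]] that by (simp add: R_def)
  moreover have "R (kvec E \<kappa> f) y = h y f" if "f \<in> E" "y \<in> Y" for f y
    using V.ext_kvec[OF b that(1)] that by (simp add: R_def)
  ultimately show ?thesis by (intro exI[of _ R]) blast
qed

section \<open>Tensor products of kernels\<close>

definition linear_on :: "('i \<Rightarrow> complex) set \<Rightarrow> (('i \<Rightarrow> complex) \<Rightarrow> complex) \<Rightarrow> bool" where
  "linear_on X l \<longleftrightarrow> (\<forall>x\<in>X. \<forall>y\<in>X. l (\<lambda>i. x i + y i) = l x + l y) \<and>
     (\<forall>x\<in>X. \<forall>c. l (\<lambda>i. c * x i) = c * l x)"

lemma linear_onI:
  assumes "\<And>x y. x \<in> X \<Longrightarrow> y \<in> X \<Longrightarrow> l (\<lambda>i. x i + y i) = l x + l y"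
    and "\<And>x c. x \<in> X \<Longrightarrow> l (\<lambda>i. c * x i) = c * l x"
  shows "linear_on X l"
  using assms by (simp add: linear_on_def)

lemma linear_on_add: "linear_on X l \<Longrightarrow> x \<in> X \<Longrightarrow> y \<in> X \<Longrightarrow> l (\<lambda>i. x i + y i) = l x + l y"
  and linear_on_scale: "linear_on X l \<Longrightarrow> x \<in> X \<Longrightarrow> l (\<lambda>i. c * x i) = c * l x"
  by (simp_all add: linear_on_def)

context herm_form
begin

lemma linear_on_left: "y \<in> X \<Longrightarrow> linear_on X (\<lambda>x. k x y)"
  using add_left scale_left by (simp add: linear_on_def)

lemma linear_on_sum:
  assumes "linear_on X l" "finite A" "\<And>a. a \<in> A \<Longrightarrow> f a \<in> X"
  shows "l (\<lambda>i. \<Sum>a\<in>A. c a * f a i) = (\<Sum>a\<in>A. c a * l (f a))"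
  using assms(2,3)
proof (induction A rule: finite_induct)
  case empty
  show ?case using linear_on_scale[OF assms(1) zero_mem, of 0] by simp
next
  case (insert a A)
  have 1: "(\<lambda>i. c a * f a i) \<in> X" "(\<lambda>i. \<Sum>a\<in>A. c a * f a i) \<in> X"
    using insert.prems by (auto intro: scale_mem sum_mem)
  have "l (\<lambda>i. c a * f a i + (\<Sum>a\<in>A. c a * f a i)) = l (\<lambda>i. c a * f a i) + l (\<lambda>i. \<Sum>a\<in>A. c a * f a i)"
    by (rule linear_on_add[OF assms(1) 1])
  moreover have "l (\<lambda>i. c a * f a i) = c a * l (f a)"
    using insert.prems by (intro linear_on_scale[OF assms(1)]) simp
  ultimately show ?case using insert by simp
qed

lemma herm_form_rank_one:
  assumes "linear_on X l"
  shows "herm_form X (\<lambda>x y. l x * cnj (l y))"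
proof
  fix x assume "x \<in> X"
  show "0 \<le> Re (l x * cnj (l x))" by simp
qed (use assms zero_mem add_mem scale_mem in \<open>auto simp: linear_on_def ring_distribs\<close>)

text \<open>An inequality between squared norms makes the difference a semidefinite form again, and
  its pullback is then a positive semidefinite kernel. This is how estimates in one factor become
  domination of kernels.\<close>

lemma herm_form_scaled_diff:
  assumes "herm_form X k'" "\<And>x. x \<in> X \<Longrightarrow> Re (k' x x) \<le> b * Re (k x x)"
  shows "herm_form X (\<lambda>x y. of_real b * k x y - k' x y)"
proof -
  interpret k': herm_form X k' by fact
  show ?thesis
  proof
    fix x y assume "x \<in> X" "y \<in> X"
    then show "of_real b * k y x - k' y x = cnj (of_real b * k x y - k' x y)"
      using herm[of x y] k'.herm[of x y] by simp
  qed (use assms(2) zero_mem add_mem scale_mem in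
      \<open>auto simp: add_left scale_left k'.add_left k'.scale_left algebra_simps\<close>)
qed

end

text \<open>The first \<open>n\<close> slots are always included, even where both entries equal
  \<open>u\<close>, so that the forms in these slots need not be normalised at \<open>u\<close>.
  With \<open>n = 0\<close> this is the inner product of elementary tensors.\<close>

definition prod_ker ::
  "'x \<Rightarrow> nat \<Rightarrow> (nat \<Rightarrow> 'x \<Rightarrow> 'x \<Rightarrow> complex) \<Rightarrow> (nat \<Rightarrow> 'x) \<Rightarrow> (nat \<Rightarrow> 'x) \<Rightarrow> complex" where
  "prod_ker u n A p q = (\<Prod>j | 1 \<le> j \<and> (j \<le> n \<or> p j \<noteq> u \<or> q j \<noteq> u). A j (p j) (q j))"

definition prod_fun :: "'x \<Rightarrow> nat \<Rightarrow> (nat \<Rightarrow> 'x \<Rightarrow> complex) \<Rightarrow> (nat \<Rightarrow> 'x) \<Rightarrow> complex" where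
  "prod_fun u n l p = (\<Prod>j | 1 \<le> j \<and> (j \<le> n \<or> p j \<noteq> u). l j (p j))"

lemma prod_ker_superset:
  assumes "finite J" "J \<subseteq> {1..}" "{j. 1 \<le> j \<and> (j \<le> n \<or> p j \<noteq> u \<or> q j \<noteq> u)} \<subseteq> J"
    and "\<And>j. 1 \<le> j \<Longrightarrow> n < j \<Longrightarrow> A j u u = 1"
  shows "prod_ker u n A p q = (\<Prod>j\<in>J. A j (p j) (q j))"
  unfolding prod_ker_def using assms by (intro prod.mono_neutral_left) (auto simp: not_le)

lemma prod_fun_superset:
  assumes "finite J" "J \<subseteq> {1..}" "{j. 1 \<le> j \<and> (j \<le> n \<or> p j \<noteq> u)} \<subseteq> J"
    and "\<And>j. 1 \<le> j \<Longrightarrow> n < j \<Longrightarrow> l j u = 1"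
  shows "prod_fun u n l p = (\<Prod>j\<in>J. l j (p j))"
  unfolding prod_fun_def using assms by (intro prod.mono_neutral_left) (auto simp: not_le)

lemma prod_ip_prod_ker: "prod_ip V u = prod_ker u 0 (\<lambda>j. ip (V j))"
  unfolding prod_ip_def prod_ker_def by (intro ext prod.cong) auto

lemma elem_seqs_finite: "p \<in> elem_seqs V u \<Longrightarrow> finite {j \<in> {1..}. p j \<noteq> u}"
  by (simp add: elem_seqs_def)

lemma elem_seqs_carr: "p \<in> elem_seqs V u \<Longrightarrow> 1 \<le> j \<Longrightarrow> p j \<in> carr (V j)"
  by (auto simp: elem_seqs_def PiE_iff)

lemma elem_seqs_mono:
  assumes "\<And>j. 1 \<le> j \<Longrightarrow> carr (V j) \<subseteq> carr (W j)"
  shows "elem_seqs V u \<subseteq> elem_seqs W u"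
  using assms by (fastforce simp: elem_seqs_def PiE_iff)

lemma prod_ker_rank_one:
  assumes "finite {j \<in> {1..}. p j \<noteq> u}" "finite {j \<in> {1..}. q j \<noteq> u}"
    and "\<And>j. 1 \<le> j \<Longrightarrow> n < j \<Longrightarrow> l j u = 1"
  shows "prod_ker u n (\<lambda>j x y. l j x * cnj (l j y)) p q = prod_fun u n l p * cnj (prod_fun u n l q)"
proof -
  let ?J = "{1..n} \<union> {j \<in> {1..}. p j \<noteq> u} \<union> {j \<in> {1..}. q j \<noteq> u}"
  have J: "finite ?J" "?J \<subseteq> {1..}" using assms(1,2) by auto
  have "prod_ker u n (\<lambda>j x y. l j x * cnj (l j y)) p q = (\<Prod>j\<in>?J. l j (p j) * cnj (l j (q j)))"
    using assms(3) by (intro prod_ker_superset[OF J]) auto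
  moreover have "prod_fun u n l p = (\<Prod>j\<in>?J. l j (p j))"
    using assms(3) by (intro prod_fun_superset[OF J]) auto
  moreover have "prod_fun u n l q = (\<Prod>j\<in>?J. l j (q j))"
    using assms(3) by (intro prod_fun_superset[OF J]) auto
  ultimately show ?thesis by (simp add: prod.distrib cnj_prod)
qed

text \<open>The map \<open>h\<close> need not be injective: coefficients of points with the same
  image are added up first.\<close>

lemma psd_pullback_map:
  assumes "psd S \<kappa>" "h ` E \<subseteq> S"
  shows "psd E (\<lambda>p q. \<kappa> (h p) (h q))"
  unfolding psd_def
proof (intro allI impI)
  fix F and c :: "_ \<Rightarrow> complex" assume F: "finite F" "F \<subseteq> E"
  define d where "d x = (\<Sum>p\<in>{p \<in> F. h p = x}. c p)" for x
  have group: "(\<Sum>p\<in>F. c p * g (h p)) = (\<Sum>x\<in>h ` F. d x * g x)" for g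
    unfolding d_def sum_distrib_right by (subst sum.image_gen[OF F(1), of _ h]) simp
  have group': "(\<Sum>p\<in>F. cnj (c p) * g (h p)) = (\<Sum>x\<in>h ` F. cnj (d x) * g x)" for g
    unfolding d_def cnj_sum sum_distrib_right by (subst sum.image_gen[OF F(1), of _ h]) simp
  have "(\<Sum>p\<in>F. \<Sum>q\<in>F. c p * cnj (c q) * \<kappa> (h p) (h q))
      = (\<Sum>p\<in>F. c p * (\<Sum>q\<in>F. cnj (c q) * \<kappa> (h p) (h q)))"
    by (simp add: sum_distrib_left mult.assoc)
  also have "\<dots> = (\<Sum>x\<in>h ` F. d x * (\<Sum>y\<in>h ` F. cnj (d y) * \<kappa> x y))"
    unfolding group' by (rule group)
  also have "\<dots> = (\<Sum>x\<in>h ` F. \<Sum>y\<in>h ` F. d x * cnj (d y) * \<kappa> x y)"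
    by (simp add: sum_distrib_left mult.assoc)
  also have "\<dots> \<in> \<real>\<^sub>\<ge>\<^sub>0" using F assms(2) by (intro psdD[OF assms(1)]) auto
  finally show "(\<Sum>p\<in>F. \<Sum>q\<in>F. c p * cnj (c q) * \<kappa> (h p) (h q)) \<in> \<real>\<^sub>\<ge>\<^sub>0" .
qed

lemma psd_slot:
  assumes "psd (carr (V j)) A" "F \<subseteq> elem_seqs V u" "1 \<le> j"
  shows "psd F (\<lambda>p q. A (p j) (q j))"
  using assms by (intro psd_pullback_map[OF assms(1)]) (auto intro: elem_seqs_carr)

lemma psd_prod_ker:
  assumes "\<And>j. 1 \<le> j \<Longrightarrow> psd (carr (V j)) (A j)" "\<And>j. 1 \<le> j \<Longrightarrow> A j u u = 1"
  shows "psd (elem_seqs V u) (prod_ker u 0 A)"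
proof (rule psd_finiteI)
  fix F assume F: "finite F" "F \<subseteq> elem_seqs V u"
  let ?J = "\<Union>p\<in>F. {j \<in> {1..}. p j \<noteq> u}"
  have J: "finite ?J" "?J \<subseteq> {1..}" using F elem_seqs_finite by blast+
  have "psd F (\<lambda>p q. \<Prod>j\<in>?J. A j (p j) (q j))"
    by (intro psd_prod psd_slot[OF _ F(2)] assms(1)) auto
  moreover have "prod_ker u 0 A p q = (\<Prod>j\<in>?J. A j (p j) (q j))" if "p \<in> F" "q \<in> F" for p q
    using that assms(2) by (intro prod_ker_superset J) auto
  ultimately show "\<exists>\<kappa>'. psd F \<kappa>' \<and> (\<forall>p\<in>F. \<forall>q\<in>F. prod_ker u 0 A p q = \<kappa>' p q)" by blast
qed

text \<open>The set of slots that matter grows with the finite set \<open>F\<close>, so the bound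
  \<open>Bd\<close> has to hold for all finite partial products of the constants at once.\<close>

lemma psd_prod_ker_dominated:
  assumes A: "\<And>j. 1 \<le> j \<Longrightarrow> psd (carr (V j)) (A j)" "\<And>j. 1 \<le> j \<Longrightarrow> A j u u = 1"
    and B: "\<And>j. 1 \<le> j \<Longrightarrow> psd (carr (V j)) (B j)" "\<And>j. 1 \<le> j \<Longrightarrow> n < j \<Longrightarrow> B j u u = 1"
    and AB: "\<And>j. 1 \<le> j \<Longrightarrow> psd (carr (V j)) (\<lambda>x y. of_real (b j) * A j x y - B j x y)"
    and b: "\<And>j. 1 \<le> j \<Longrightarrow> 0 \<le> b j" "\<And>J. finite J \<Longrightarrow> J \<subseteq> {1..} \<Longrightarrow> (\<Prod>j\<in>J. b j) \<le> Bd"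
  shows "psd (elem_seqs V u) (\<lambda>p q. of_real Bd * prod_ker u 0 A p q - prod_ker u n B p q)"
proof (rule psd_finiteI)
  fix F assume F: "finite F" "F \<subseteq> elem_seqs V u"
  let ?J = "{1..n} \<union> (\<Union>p\<in>F. {j \<in> {1..}. p j \<noteq> u})"
  have "finite {j \<in> {1..}. p j \<noteq> u}" if "p \<in> F" for p using that F elem_seqs_finite by blast
  then have J: "finite ?J" "?J \<subseteq> {1..}" using F(1) by auto
  \<comment> \<open>The excess of \<open>Bd\<close> over the partial product gives a nonnegative
    multiple of a Schur product. What remains is a difference of two products whose factors dominate
    each other slot by slot.\<close>
  let ?\<kappa> = "\<lambda>p q. of_real (Bd - (\<Prod>j\<in>?J. b j)) * (\<Prod>j\<in>?J. A j (p j) (q j))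
      + ((\<Prod>j\<in>?J. of_real (b j) * A j (p j) (q j)) - (\<Prod>j\<in>?J. B j (p j) (q j)))"
  have "psd F ?\<kappa>"
  proof (rule psd_add)
    show "psd F (\<lambda>p q. of_real (Bd - (\<Prod>j\<in>?J. b j)) * (\<Prod>j\<in>?J. A j (p j) (q j)))"
    proof (rule psd_scale)
      show "psd F (\<lambda>p q. \<Prod>j\<in>?J. A j (p j) (q j))"
        by (intro psd_prod psd_slot[OF _ F(2)] A(1)) auto
      show "0 \<le> Bd - (\<Prod>j\<in>?J. b j)" using b(2)[OF J] by simp
    qed
    show "psd F (\<lambda>p q. (\<Prod>j\<in>?J. of_real (b j) * A j (p j) (q j)) - (\<Prod>j\<in>?J. B j (p j) (q j)))"
    proof (rule psd_prod_diff)
      fix j assume "j \<in> ?J"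
      then have j: "1 \<le> j" by auto
      show "psd F (\<lambda>p q. of_real (b j) * A j (p j) (q j))"
        by (intro psd_scale psd_slot[OF _ F(2) j] A(1) j b(1))
      show "psd F (\<lambda>p q. B j (p j) (q j))" by (intro psd_slot[OF _ F(2) j] B(1) j)
      show "psd F (\<lambda>p q. of_real (b j) * A j (p j) (q j) - B j (p j) (q j))"
        using psd_slot[OF AB[OF j] F(2) j] .
    qed
  qed
  moreover have "of_real Bd * prod_ker u 0 A p q - prod_ker u n B p q = ?\<kappa> p q" if "p \<in> F" "q \<in> F" for p q
  proof -
    have "prod_ker u 0 A p q = (\<Prod>j\<in>?J. A j (p j) (q j))"
      using that A(2) by (intro prod_ker_superset J) auto
    moreover have "prod_ker u n B p q = (\<Prod>j\<in>?J. B j (p j) (q j))"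
      using that B(2) by (intro prod_ker_superset J) auto
    ultimately show ?thesis by (simp add: prod.distrib algebra_simps)
  qed
  ultimately show "\<exists>\<kappa>'. psd F \<kappa>' \<and> (\<forall>p\<in>F. \<forall>q\<in>F. of_real Bd * prod_ker u 0 A p q - prod_ker u n B p q = \<kappa>' p q)"
    by blast
qed

text \<open>Factors of at least 1 make the partial products monotone in the index set, so that no
  infinite product has to be formed.\<close>

definition bounded_prods :: "(nat \<Rightarrow> real) \<Rightarrow> bool" where
  "bounded_prods b \<longleftrightarrow> (\<forall>j\<ge>1. 1 \<le> b j) \<and> (\<exists>B\<ge>0. \<forall>J. finite J \<longrightarrow> J \<subseteq> {1..} \<longrightarrow> (\<Prod>j\<in>J. b j) \<le> B)"

lemma bounded_prods_one [simp]: "bounded_prods (\<lambda>_. 1)"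
  unfolding bounded_prods_def by (auto intro: exI[of _ 1])

text \<open>Finitely many factors may be arbitrary. Taking \<open>max 1\<close> keeps monotonicity,
  so \<open>J\<close> can be enlarged by all slots up to \<open>n\<close> before the product is
  split there.\<close>

lemma bounded_prods_initial:
  assumes "bounded_prods b"
  shows "bounded_prods (\<lambda>j. if j \<le> n then max 1 (c j) else b j)"
proof -
  obtain B where B: "B \<ge> 0" "\<And>J. finite J \<Longrightarrow> J \<subseteq> {1..} \<Longrightarrow> (\<Prod>j\<in>J. b j) \<le> B"
    using assms unfolding bounded_prods_def by blast
  let ?f = "\<lambda>j. if j \<le> n then max 1 (c j) else b j"
  have ge: "1 \<le> ?f j" if "1 \<le> j" for j using assms that by (simp add: bounded_prods_def)
  have "(\<Prod>j\<in>J. ?f j) \<le> (\<Prod>j\<in>{1..n}. max 1 (c j)) * B" if J: "finite J" "J \<subseteq> {1..}" for J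
  proof -
    have "(\<Prod>j\<in>J. ?f j) \<le> (\<Prod>j\<in>{1..n} \<union> (J - {1..n}). ?f j)"
    proof (rule prod_mono2)
      show "1 \<le> ?f j" if "j \<in> {1..n} \<union> (J - {1..n}) - J" for j
        using ge that by auto
      show "0 \<le> ?f j" if "j \<in> J" for j
        using order_trans[OF zero_le_one ge[of j]] J that by auto
    qed (use J in auto)
    also have "\<dots> = (\<Prod>j\<in>{1..n}. ?f j) * (\<Prod>j\<in>J - {1..n}. ?f j)"
      using J by (intro prod.union_disjoint) auto
    also have "(\<Prod>j\<in>J - {1..n}. ?f j) = (\<Prod>j\<in>J - {1..n}. b j)"
      using J by (intro prod.cong) auto
    also have "(\<Prod>j\<in>{1..n}. ?f j) = (\<Prod>j\<in>{1..n}. max 1 (c j))"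
      by (intro prod.cong) auto
    also have "(\<Prod>j\<in>{1..n}. max 1 (c j)) * (\<Prod>j\<in>J - {1..n}. b j) \<le> (\<Prod>j\<in>{1..n}. max 1 (c j)) * B"
      using J by (intro mult_left_mono B(2) prod_nonneg) (auto simp: le_max_iff_disj)
    finally show ?thesis .
  qed
  moreover have "0 \<le> (\<Prod>j\<in>{1..n}. max 1 (c j)) * B"
    using B(1) by (intro mult_nonneg_nonneg prod_nonneg) (auto simp: le_max_iff_disj)
  ultimately show ?thesis
    unfolding bounded_prods_def using ge by blast
qed

section \<open>Bounded maps between tensor products\<close>

definition bounded_on ::
  "('i \<Rightarrow> complex) set \<Rightarrow> (('i \<Rightarrow> complex) \<Rightarrow> ('i \<Rightarrow> complex) \<Rightarrow> complex) \<Rightarrow>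
    (('i \<Rightarrow> complex) \<Rightarrow> complex) \<Rightarrow> bool" where
  "bounded_on X k l \<longleftrightarrow> linear_on X l \<and> (\<exists>b\<ge>0. \<forall>x\<in>X. (cmod (l x))\<^sup>2 \<le> b * Re (k x x))"

text \<open>The functionals in \<open>Z\<close> are total on the completion of \<open>(X, k)\<close>.\<close>

definition separating ::
  "('i \<Rightarrow> complex) set \<Rightarrow> (('i \<Rightarrow> complex) \<Rightarrow> ('i \<Rightarrow> complex) \<Rightarrow> complex) \<Rightarrow>
    (('i \<Rightarrow> complex) \<Rightarrow> complex) set \<Rightarrow> bool" where
  "separating X k Z \<longleftrightarrow> (\<forall>g. herm_form.len_Cauchy X k g \<longrightarrow>
     (\<forall>l\<in>Z. (\<lambda>n. l (g n)) \<longlonglongrightarrow> 0) \<longrightarrow> (\<forall>y\<in>X. (\<lambda>n. k (g n) y) \<longlonglongrightarrow> 0))"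

text \<open>Immediate for the form itself. It applies when in each factor separately the source form
  is bounded by the target form, with constants whose product may diverge.\<close>

lemma separating_dual: "separating X k ((\<lambda>y x. k x y) ` X)"
  by (auto simp: separating_def)

lemma (in herm_form) bounded_on_left:
  assumes "y \<in> X" "\<And>x. x \<in> X \<Longrightarrow> Re (k x x) \<le> b * Re (k' x x)" "0 \<le> b"
  shows "bounded_on X k' (\<lambda>x. k x y)"
  unfolding bounded_on_def
proof (intro conjI exI[of _ "b * Re (k y y)"] ballI)
  fix x assume "x \<in> X"
  then have "(cmod (k x y))\<^sup>2 \<le> Re (k x x) * Re (k y y)" by (rule Cauchy_Schwarz[OF _ assms(1)])
  also have "\<dots> \<le> (b * Re (k' x x)) * Re (k y y)"
    using assms(2)[OF \<open>x \<in> X\<close>] nonneg[OF assms(1)] by (rule mult_right_mono)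
  finally show "(cmod (k x y))\<^sup>2 \<le> b * Re (k y y) * Re (k' x x)" by (simp add: mult_ac)
qed (use linear_on_left assms nonneg in auto)

text \<open>Through the coordinate map \<open>\<phi>\<close> the inner product of the factor \<open>V j\<close> becomes the form \<open>k j\<close> on a
  complex vector space \<open>X j\<close>, so that the arguments below do not distinguish the two scalar fields.\<close>

locale tensor_factors =
  fixes u :: "'d \<Rightarrow> complex" and V :: "nat \<Rightarrow> 'd ips" and \<phi> :: "('d \<Rightarrow> complex) \<Rightarrow> ('i \<Rightarrow> complex)"
    and X :: "nat \<Rightarrow> ('i \<Rightarrow> complex) set"
    and k :: "nat \<Rightarrow> ('i \<Rightarrow> complex) \<Rightarrow> ('i \<Rightarrow> complex) \<Rightarrow> complex"
  assumes form: "\<And>j. 1 \<le> j \<Longrightarrow> herm_form (X j) (k j)"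
    and coord: "\<And>j f. 1 \<le> j \<Longrightarrow> f \<in> carr (V j) \<Longrightarrow> \<phi> f \<in> X j"
    and ip_coord: "\<And>j f g. 1 \<le> j \<Longrightarrow> f \<in> carr (V j) \<Longrightarrow> g \<in> carr (V j) \<Longrightarrow> ip (V j) f g = k j (\<phi> f) (\<phi> g)"
    and unit_mem: "\<And>j. 1 \<le> j \<Longrightarrow> u \<in> carr (V j)"
    and unit: "\<And>j. 1 \<le> j \<Longrightarrow> k j (\<phi> u) (\<phi> u) = 1"
begin

abbreviation "E \<equiv> elem_seqs V u"
abbreviation "\<kappa> \<equiv> prod_ip V u"

lemma psd_factor:
  assumes "1 \<le> j"
  shows "psd (carr (V j)) (\<lambda>x y. k j (\<phi> x) (\<phi> y))"
  using coord[OF assms] by (rule herm_form.psd_pullback[OF form[OF assms]])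

lemma prod_ip_eq:
  assumes "p \<in> E" "q \<in> E"
  shows "\<kappa> p q = prod_ker u 0 (\<lambda>j x y. k j (\<phi> x) (\<phi> y)) p q"
  unfolding prod_ip_prod_ker prod_ker_def
  using assms by (intro prod.cong refl ip_coord) (auto intro: elem_seqs_carr)

lemma psd_prod_ip: "psd E \<kappa>"
proof (rule psd_cong)
  show "psd E (prod_ker u 0 (\<lambda>j x y. k j (\<phi> x) (\<phi> y)))"
    by (intro psd_prod_ker psd_factor unit)
qed (rule prod_ip_eq)

text \<open>In the first \<open>n\<close> slots the constants are arbitrary and no normalisation at
  \<open>u\<close> is required; only the tail needs constants with bounded products.\<close>

lemma dominated:
  assumes B: "\<And>j. 1 \<le> j \<Longrightarrow> herm_form (X j) (B j)" "\<And>j. 1 \<le> j \<Longrightarrow> n < j \<Longrightarrow> B j (\<phi> u) (\<phi> u) = 1"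
    and le: "\<And>j. 1 \<le> j \<Longrightarrow> j \<le> n \<Longrightarrow> \<exists>c. \<forall>x\<in>X j. Re (B j x x) \<le> c * Re (k j x x)"
      "\<And>j x. 1 \<le> j \<Longrightarrow> n < j \<Longrightarrow> x \<in> X j \<Longrightarrow> Re (B j x x) \<le> b j * Re (k j x x)"
    and b: "bounded_prods b"
  shows "\<exists>Bd\<ge>0. psd E (\<lambda>p q. of_real Bd * \<kappa> p q - prod_ker u n (\<lambda>j x y. B j (\<phi> x) (\<phi> y)) p q)"
proof -
  have "\<forall>j. \<exists>c. 1 \<le> j \<longrightarrow> j \<le> n \<longrightarrow> (\<forall>x\<in>X j. Re (B j x x) \<le> c * Re (k j x x))" using le(1) by blast
  then obtain c where c: "\<And>j x. 1 \<le> j \<Longrightarrow> j \<le> n \<Longrightarrow> x \<in> X j \<Longrightarrow> Re (B j x x) \<le> c j * Re (k j x x)"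
    by metis
  define b' where "b' j = (if j \<le> n then max 1 (c j) else b j)" for j
  have b': "bounded_prods b'" unfolding b'_def by (rule bounded_prods_initial[OF b])
  have le': "Re (B j x x) \<le> b' j * Re (k j x x)" if "1 \<le> j" "x \<in> X j" for j x
  proof (cases "j \<le> n")
    case True
    have "Re (B j x x) \<le> c j * Re (k j x x)" by (rule c[OF that(1) True that(2)])
    also have "\<dots> \<le> max 1 (c j) * Re (k j x x)"
      using herm_form.nonneg[OF form[OF that(1)] that(2)] by (intro mult_right_mono) auto
    finally show ?thesis using True by (simp add: b'_def)
  next
    case False
    then show ?thesis using le(2)[OF that(1) _ that(2)] by (simp add: b'_def)
  qed
  obtain Bd where Bd: "Bd \<ge> 0" "\<And>J. finite J \<Longrightarrow> J \<subseteq> {1..} \<Longrightarrow> (\<Prod>j\<in>J. b' j) \<le> Bd"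
    using b' unfolding bounded_prods_def by blast
  have "psd E (\<lambda>p q. of_real Bd * prod_ker u 0 (\<lambda>j x y. k j (\<phi> x) (\<phi> y)) p q
      - prod_ker u n (\<lambda>j x y. B j (\<phi> x) (\<phi> y)) p q)"
  proof (rule psd_prod_ker_dominated[where b = b'])
    fix j :: nat assume j: "1 \<le> j"
    show "psd (carr (V j)) (\<lambda>x y. B j (\<phi> x) (\<phi> y))"
      using coord[OF j] by (rule herm_form.psd_pullback[OF B(1)[OF j]])
    have "herm_form (X j) (\<lambda>x y. of_real (b' j) * k j x y - B j x y)"
      by (rule herm_form.herm_form_scaled_diff[OF form[OF j] B(1)[OF j] le'[OF j]])
    then show "psd (carr (V j)) (\<lambda>x y. of_real (b' j) * k j (\<phi> x) (\<phi> y) - B j (\<phi> x) (\<phi> y))"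
      using coord[OF j] by (rule herm_form.psd_pullback)
    show "0 \<le> b' j" using b' j unfolding bounded_prods_def by (meson order_trans zero_le_one)
  qed (use psd_factor unit B(2) Bd(2) in auto)
  then have "psd E (\<lambda>p q. of_real Bd * \<kappa> p q - prod_ker u n (\<lambda>j x y. B j (\<phi> x) (\<phi> y)) p q)"
    by (rule psd_cong[rotated]) (simp add: prod_ip_eq)
  then show ?thesis using Bd(1) by blast
qed

text \<open>The case of \<open>dominated\<close> for the rank one forms
  \<open>l j x * cnj (l j y)\<close>, whose product kernel is again of rank one.\<close>

lemma bounded_prod_fun:
  assumes l: "\<And>j. 1 \<le> j \<Longrightarrow> j \<le> n \<Longrightarrow> bounded_on (X j) (k j) (l j)"
    and tail: "\<And>j. 1 \<le> j \<Longrightarrow> n < j \<Longrightarrow> linear_on (X j) (l j)" "\<And>j. 1 \<le> j \<Longrightarrow> n < j \<Longrightarrow> l j (\<phi> u) = 1"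
      "\<And>j x. 1 \<le> j \<Longrightarrow> n < j \<Longrightarrow> x \<in> X j \<Longrightarrow> (cmod (l j x))\<^sup>2 \<le> b j * Re (k j x x)"
    and b: "bounded_prods b"
  shows "bounded_fun E \<kappa> (prod_fun u n (\<lambda>j f. l j (\<phi> f)))"
proof -
  have sq: "Re (l j x * cnj (l j x)) = (cmod (l j x))\<^sup>2" for j x
    by (simp add: complex_norm_square[symmetric] del: of_real_power)
  have "\<exists>Bd\<ge>0. psd E (\<lambda>p q. of_real Bd * \<kappa> p q - prod_ker u n (\<lambda>j x y. l j (\<phi> x) * cnj (l j (\<phi> y))) p q)"
  proof (rule dominated[OF _ _ _ _ b])
    fix j :: nat assume j: "1 \<le> j"
    have "linear_on (X j) (l j)"
      using l[OF j] tail(1)[OF j] by (cases "j \<le> n") (auto simp: bounded_on_def)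
    then show "herm_form (X j) (\<lambda>x y. l j x * cnj (l j y))"
      by (rule herm_form.herm_form_rank_one[OF form[OF j]])
    show "l j (\<phi> u) * cnj (l j (\<phi> u)) = 1" if "n < j" using tail(2)[OF j that] by simp
    show "\<exists>c. \<forall>x\<in>X j. Re (l j x * cnj (l j x)) \<le> c * Re (k j x x)" if "j \<le> n"
      unfolding sq using l[OF j that] unfolding bounded_on_def by blast
    show "Re (l j x * cnj (l j x)) \<le> b j * Re (k j x x)" if "n < j" "x \<in> X j" for x
      unfolding sq by (rule tail(3)[OF j that])
  qed
  then obtain Bd where Bd: "0 \<le> Bd"
    "psd E (\<lambda>p q. of_real Bd * \<kappa> p q - prod_ker u n (\<lambda>j x y. l j (\<phi> x) * cnj (l j (\<phi> y))) p q)" by blast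
  have "prod_ker u n (\<lambda>j x y. l j (\<phi> x) * cnj (l j (\<phi> y))) p q
      = prod_fun u n (\<lambda>j f. l j (\<phi> f)) p * cnj (prod_fun u n (\<lambda>j f. l j (\<phi> f)) q)" if "p \<in> E" "q \<in> E" for p q
    using tail(2) by (intro prod_ker_rank_one elem_seqs_finite[OF that(1)] elem_seqs_finite[OF that(2)]) auto
  then have "psd E (\<lambda>p q. of_real Bd * \<kappa> p q
      - prod_fun u n (\<lambda>j f. l j (\<phi> f)) p * cnj (prod_fun u n (\<lambda>j f. l j (\<phi> f)) q))"
    by (intro psd_cong[OF _ Bd(2)]) simp
  then show ?thesis by (rule bounded_funI_psd[OF Bd(1)])
qed

text \<open>Contracting a tensor against bounded functionals in all slots but one is a bounded map into the
  remaining factor.\<close>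

lemma contraction:
  assumes i: "1 \<le> i" "i \<le> n" and d: "herm_form.len_Cauchy (combs UNIV E) (comb_ip \<kappa>) d"
    and l: "\<And>j. 1 \<le> j \<Longrightarrow> j \<le> n \<Longrightarrow> bounded_on (X j) (k j) (l j)"
      "\<And>j. n < j \<Longrightarrow> l j = (\<lambda>x. k j x (\<phi> u))"
  shows "\<exists>g. herm_form.len_Cauchy (X i) (k i) g \<and>
    (\<forall>l' m. linear_on (X i) l' \<longrightarrow> l' (g m) = lcomb (d m) (prod_fun u n (\<lambda>j f. (l(i := l')) j (\<phi> f))))"
proof -
  interpret Xi: herm_form "X i" "k i" by (rule form[OF i(1)])
  interpret C: herm_form "combs UNIV E" "comb_ip \<kappa>" by (rule herm_form_combs[OF psd_prod_ip])
  define r where "r p = (\<Prod>j | 1 \<le> j \<and> j \<noteq> i \<and> (j \<le> n \<or> p j \<noteq> u). l j (\<phi> (p j)))" for p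
  define G where "G c = (\<lambda>x. \<Sum>p | c p \<noteq> 0. (c p * r p) * \<phi> (p i) x)" for c
  have dE: "d m \<in> combs UNIV E" for m by (rule C.len_Cauchy_mem[OF d])
  have pi: "\<phi> (p i) \<in> X i" if "p \<in> E" for p using coord[OF i(1)] elem_seqs_carr[OF that i(1)] .
  have Gmem: "G c \<in> X i" if "c \<in> combs UNIV E" for c
    unfolding G_def using pi combs_support[OF that] by (intro Xi.sum_mem) blast
  have split: "prod_fun u n (\<lambda>j f. (l(i := l')) j (\<phi> f)) p = l' (\<phi> (p i)) * r p" if "p \<in> E" for p l'
  proof -
    let ?J = "{j. 1 \<le> j \<and> (j \<le> n \<or> p j \<noteq> u)}"
    have "?J \<subseteq> {1..n} \<union> {j \<in> {1..}. p j \<noteq> u}" by auto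
    then have "finite ?J" using elem_seqs_finite[OF that] by (meson finite_Un finite_atLeastAtMost finite_subset)
    moreover have "i \<in> ?J" using i by simp
    moreover have "?J - {i} = {j. 1 \<le> j \<and> j \<noteq> i \<and> (j \<le> n \<or> p j \<noteq> u)}" by auto
    ultimately show ?thesis
    proof -
      have "prod_fun u n (\<lambda>j f. (l(i := l')) j (\<phi> f)) p
          = (l(i := l')) i (\<phi> (p i)) * (\<Prod>j\<in>?J - {i}. (l(i := l')) j (\<phi> (p j)))"
        unfolding prod_fun_def by (rule prod.remove) fact+
      also have "(\<Prod>j\<in>?J - {i}. (l(i := l')) j (\<phi> (p j))) = r p"
        unfolding r_def using \<open>?J - {i} = _\<close> by (intro prod.cong) auto
      finally show ?thesis by simp
    qed
  qed
  have val: "l' (G c) = lcomb c (prod_fun u n (\<lambda>j f. (l(i := l')) j (\<phi> f)))"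
    if "linear_on (X i) l'" "c \<in> combs UNIV E" for l' c
  proof -
    have "l' (G c) = (\<Sum>p | c p \<noteq> 0. (c p * r p) * l' (\<phi> (p i)))"
      unfolding G_def using pi combs_support[OF that(2)]
      by (intro Xi.linear_on_sum that(1) combs_finite[OF that(2)]) blast
    also have "\<dots> = lcomb c (prod_fun u n (\<lambda>j f. (l(i := l')) j (\<phi> f)))"
      unfolding lcomb_def using combs_support[OF that(2)] split by (intro sum.cong refl) simp
    finally show ?thesis .
  qed
  \<comment> \<open>The inner product itself in slot \<open>i\<close> and rank one forms in all
    others: the resulting product kernel gives exactly the squared length of the contracted vector
    \<open>G c\<close>.\<close>
  define B where "B j = (if j = i then k i else (\<lambda>x y. l j x * cnj (l j y)))" for j
  \<comment> \<open>Beyond \<open>n\<close> the functionals are inner products with a unit vector,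
    so Cauchy-Schwarz gives the constant 1 and no summability enters here.\<close>
  have tail: "linear_on (X j) (l j)" "l j (\<phi> u) = 1"
    "\<And>x. x \<in> X j \<Longrightarrow> (cmod (l j x))\<^sup>2 \<le> 1 * Re (k j x x)" if "1 \<le> j" "n < j" for j
  proof -
    interpret Xj: herm_form "X j" "k j" by (rule form[OF that(1)])
    have u: "\<phi> u \<in> X j" using coord unit_mem that(1) by blast
    show "linear_on (X j) (l j)" unfolding l(2)[OF that(2)] by (rule Xj.linear_on_left[OF u])
    show "l j (\<phi> u) = 1" unfolding l(2)[OF that(2)] by (rule unit[OF that(1)])
    show "(cmod (l j x))\<^sup>2 \<le> 1 * Re (k j x x)" if "x \<in> X j" for x
      using Xj.Cauchy_Schwarz[OF that u] unit[OF \<open>1 \<le> j\<close>] unfolding l(2)[OF \<open>n < j\<close>] by simp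
  qed
  have "\<exists>Bd\<ge>0. psd E (\<lambda>p q. of_real Bd * \<kappa> p q - prod_ker u n (\<lambda>j x y. B j (\<phi> x) (\<phi> y)) p q)"
  proof (rule dominated[OF _ _ _ _ bounded_prods_one])
    fix j :: nat assume j: "1 \<le> j"
    have lin: "linear_on (X j) (l j)"
      using l(1)[OF j] tail(1)[OF j] unfolding bounded_on_def by (cases "j \<le> n") auto
    have sq: "Re (l j x * cnj (l j x)) = (cmod (l j x))\<^sup>2" for x
      by (simp add: complex_norm_square[symmetric] del: of_real_power)
    show "herm_form (X j) (B j)"
      using form[OF j] herm_form.herm_form_rank_one[OF form[OF j] lin] by (auto simp: B_def)
    show "B j (\<phi> u) (\<phi> u) = 1" if "n < j" using tail(2)[OF j that] i that by (simp add: B_def)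
    show "\<exists>c. \<forall>x\<in>X j. Re (B j x x) \<le> c * Re (k j x x)" if "j \<le> n"
    proof (cases "j = i")
      case True
      then show ?thesis by (intro exI[of _ 1]) (simp add: B_def)
    next
      case False
      then have B: "B j = (\<lambda>x y. l j x * cnj (l j y))" by (simp add: B_def)
      show ?thesis unfolding B sq using l(1)[OF j that] unfolding bounded_on_def by blast
    qed
    show "Re (B j x x) \<le> 1 * Re (k j x x)" if "n < j" "x \<in> X j" for x
    proof -
      have B: "B j = (\<lambda>x y. l j x * cnj (l j y))" using i that by (simp add: B_def)
      show ?thesis unfolding B sq by (rule tail(3)[OF j that])
    qed
  qed
  then obtain Bd where Bd: "0 \<le> Bd"
    "psd E (\<lambda>p q. of_real Bd * \<kappa> p q - prod_ker u n (\<lambda>j x y. B j (\<phi> x) (\<phi> y)) p q)" by blast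
  have slot_split: "prod_ker u n (\<lambda>j x y. B j (\<phi> x) (\<phi> y)) p q = r p * cnj (r q) * k i (\<phi> (p i)) (\<phi> (q i))"
    if "p \<in> E" "q \<in> E" for p q
  proof -
    let ?J = "{1..n} \<union> {j \<in> {1..}. p j \<noteq> u} \<union> {j \<in> {1..}. q j \<noteq> u}"
    have J: "finite ?J" "?J \<subseteq> {1..}" using elem_seqs_finite that by auto
    have B1: "B j (\<phi> u) (\<phi> u) = 1" if "1 \<le> j" "n < j" for j
      using tail(2)[OF that] i that by (simp add: B_def)
    have r: "r p' = (\<Prod>j\<in>?J - {i}. l j (\<phi> (p' j)))" if "p' \<in> {p, q}" for p'
      unfolding r_def using J that tail(2) by (intro prod.mono_neutral_left) (auto simp: not_le)
    have "prod_ker u n (\<lambda>j x y. B j (\<phi> x) (\<phi> y)) p q = (\<Prod>j\<in>?J. B j (\<phi> (p j)) (\<phi> (q j)))"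
      using B1 by (intro prod_ker_superset[OF J]) auto
    also have "\<dots> = k i (\<phi> (p i)) (\<phi> (q i)) * (\<Prod>j\<in>?J - {i}. B j (\<phi> (p j)) (\<phi> (q j)))"
      using i J by (subst prod.remove[of ?J i]) (auto simp: B_def)
    also have "(\<Prod>j\<in>?J - {i}. B j (\<phi> (p j)) (\<phi> (q j)))
        = (\<Prod>j\<in>?J - {i}. l j (\<phi> (p j)) * cnj (l j (\<phi> (q j))))"
      by (intro prod.cong) (auto simp: B_def)
    also have "\<dots> = r p * cnj (r q)" by (simp add: r prod.distrib cnj_prod)
    finally show ?thesis by (simp add: mult_ac)
  qed
  have "Xi.len_Cauchy (\<lambda>m. G (d m))"
  proof (rule len_Cauchy_map[where T = G, OF C.herm_form_axioms Xi.herm_form_axioms Gmem _ Bd(1) _ d])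
    fix c c' assume c: "c \<in> combs UNIV E" "c' \<in> combs UNIV E"
    have lc: "G c = (\<lambda>x. lcomb c (\<lambda>p. r p * \<phi> (p i) x))" for c
      by (simp add: G_def lcomb_def mult.assoc)
    show "G (\<lambda>p. c p - c' p) = (\<lambda>x. G c x - G c' x)"
      unfolding lc lcomb_diff[OF c] ..
  next
    fix c assume c: "c \<in> combs UNIV E"
    have "k i (G c) (G c) = (\<Sum>p | c p \<noteq> 0. \<Sum>q | c q \<noteq> 0.
        (c p * r p) * cnj (c q * r q) * k i (\<phi> (p i)) (\<phi> (q i)))"
      unfolding G_def using pi combs_support[OF c] by (intro Xi.sum_sum) blast
    also have "\<dots> = comb_ip (prod_ker u n (\<lambda>j x y. B j (\<phi> x) (\<phi> y))) c c"
      unfolding comb_ip_def using combs_support[OF c] by (intro sum.cong refl) (simp add: slot_split)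
    finally show "Re (k i (G c) (G c)) \<le> Bd * Re (comb_ip \<kappa> c c)"
      using psd_diff_comb_le[OF Bd(2) c] by simp
  qed
  then show ?thesis using val dE by (intro exI[of _ "\<lambda>m. G (d m)"]) blast
qed

text \<open>The slots are exchanged one after the other: by the previous lemma and separation in one factor,
  the functionals from \<open>Z j\<close> may be replaced by all inner products with vectors of \<open>V j\<close>.\<close>

lemma vanishing:
  assumes d: "herm_form.len_Cauchy (combs UNIV E) (comb_ip \<kappa>) d"
    and Z: "\<And>j l. 1 \<le> j \<Longrightarrow> l \<in> Z j \<Longrightarrow> bounded_on (X j) (k j) l"
    and sep: "\<And>j. 1 \<le> j \<Longrightarrow> separating (X j) (k j) (Z j)"
    and lim: "\<And>n l. (\<And>j. 1 \<le> j \<Longrightarrow> j \<le> n \<Longrightarrow> l j \<in> Z j) \<Longrightarrow> (\<And>j. n < j \<Longrightarrow> l j = (\<lambda>x. k j x (\<phi> u))) \<Longrightarrow>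
        (\<lambda>m. lcomb (d m) (prod_fun u n (\<lambda>j f. l j (\<phi> f)))) \<longlonglongrightarrow> 0"
    and q: "q \<in> E"
  shows "(\<lambda>m. lcomb (d m) (\<lambda>p. \<kappa> p q)) \<longlonglongrightarrow> 0"
proof -
  have dE: "d m \<in> combs UNIV E" for m
    using d herm_form.len_Cauchy_mem[OF herm_form_combs[OF psd_prod_ip]] by blast
  have full: "bounded_on (X j) (k j) (\<lambda>x. k j x (\<phi> f))" if "1 \<le> j" "f \<in> carr (V j)" for j f
    using herm_form.bounded_on_left[OF form[OF that(1)] coord[OF that], of 1] by simp
  have "finite {j \<in> {1..}. q j \<noteq> u}" using elem_seqs_finite[OF q] .
  then obtain n where "\<forall>j\<in>{j \<in> {1..}. q j \<noteq> u}. j \<le> n" using finite_nat_set_iff_bounded_le by blast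
  then have n: "q j = u" if "n < j" for j
    using that by (metis (mono_tags, lifting) One_nat_def Suc_leI atLeast_iff leD le_less_trans
        le0 mem_Collect_eq)
  \<comment> \<open>Induction on the number \<open>m\<close> of exchanged slots: inner products with
    arbitrary vectors up to \<open>m\<close>, functionals from \<open>Z\<close> between
    \<open>m\<close> and \<open>n\<close>, and the unit vector beyond \<open>n\<close>, where
    \<open>q\<close> equals \<open>u\<close> anyway.\<close>
  have "(\<lambda>i. lcomb (d i) (prod_fun u n (\<lambda>j f. l j (\<phi> f)))) \<longlonglongrightarrow> 0"
    if "m \<le> n" "\<And>j. 1 \<le> j \<Longrightarrow> j \<le> m \<Longrightarrow> \<exists>f\<in>carr (V j). l j = (\<lambda>x. k j x (\<phi> f))"
      "\<And>j. m < j \<Longrightarrow> j \<le> n \<Longrightarrow> l j \<in> Z j" "\<And>j. n < j \<Longrightarrow> l j = (\<lambda>x. k j x (\<phi> u))" for m l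
    using that
  proof (induction m arbitrary: l)
    case 0
    show ?case
    proof (rule lim)
      show "l j \<in> Z j" if "1 \<le> j" "j \<le> n" for j using 0(3)[of j] that by simp
    qed (rule 0(4))
  next
    case (Suc m)
    let ?i = "Suc m"
    have i: "1 \<le> ?i" "?i \<le> n" using Suc.prems(1) by simp_all
    obtain f where f: "f \<in> carr (V ?i)" "l ?i = (\<lambda>x. k ?i x (\<phi> f))" using Suc.prems(2)[of ?i] by auto
    have bd: "bounded_on (X j) (k j) (l j)" if "1 \<le> j" "j \<le> n" for j
    proof (cases "j \<le> ?i")
      case True
      then show ?thesis using Suc.prems(2)[OF that(1)] full[OF that(1)] by auto
    next
      case False
      then show ?thesis using Suc.prems(3)[of j] Z[OF that(1)] that by auto
    qed
    obtain g where g: "herm_form.len_Cauchy (X ?i) (k ?i) g"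
      "\<And>l' m. linear_on (X ?i) l' \<Longrightarrow> l' (g m) = lcomb (d m) (prod_fun u n (\<lambda>j f. (l(?i := l')) j (\<phi> f)))"
      using contraction[OF i d bd Suc.prems(4)] by blast
    have "(\<lambda>m. l' (g m)) \<longlonglongrightarrow> 0" if l': "l' \<in> Z ?i" for l'
    proof -
      have "linear_on (X ?i) l'" using Z[OF i(1) l'] by (simp add: bounded_on_def)
      moreover have "(\<lambda>m. lcomb (d m) (prod_fun u n (\<lambda>j f. (l(?i := l')) j (\<phi> f)))) \<longlonglongrightarrow> 0"
      proof (rule Suc.IH)
        show "m \<le> n" using i by simp
        show "\<exists>f\<in>carr (V j). (l(?i := l')) j = (\<lambda>x. k j x (\<phi> f))" if "1 \<le> j" "j \<le> m" for j
          using Suc.prems(2)[of j] that by auto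
        show "(l(?i := l')) j \<in> Z j" if "m < j" "j \<le> n" for j
          using Suc.prems(3)[of j] that l' by auto
        show "(l(?i := l')) j = (\<lambda>x. k j x (\<phi> u))" if "n < j" for j
          using Suc.prems(4)[OF that] that i by auto
      qed
      ultimately show ?thesis using g(2) by simp
    qed
    then have "(\<lambda>m. k ?i (g m) (\<phi> f)) \<longlonglongrightarrow> 0"
      using sep[OF i(1)] g(1) coord[OF i(1) f(1)] unfolding separating_def by blast
    moreover have "linear_on (X ?i) (l ?i)" using bd[OF i] by (simp add: bounded_on_def)
    then have "l ?i (g m) = lcomb (d m) (prod_fun u n (\<lambda>j f. l j (\<phi> f)))" for m
      using g(2)[of "l ?i" m] by simp
    ultimately show ?case using f(2) by simp
  qed
  \<comment> \<open>With all \<open>n\<close> slots exchanged, the product functional is the inner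
    product with the elementary tensor \<open>q\<close>.\<close>
  from this[of n "\<lambda>j x. k j x (\<phi> (q j))"]
  have "(\<lambda>i. lcomb (d i) (prod_fun u n (\<lambda>j f. k j (\<phi> f) (\<phi> (q j))))) \<longlonglongrightarrow> 0"
    using elem_seqs_carr[OF q] n by fastforce
  moreover have "prod_fun u n (\<lambda>j f. k j (\<phi> f) (\<phi> (q j))) p = \<kappa> p q" if p: "p \<in> E" for p
  proof -
    let ?J = "{1..n} \<union> {j \<in> {1..}. p j \<noteq> u}"
    have J: "finite ?J" "?J \<subseteq> {1..}" using elem_seqs_finite[OF p] by auto
    have "prod_fun u n (\<lambda>j f. k j (\<phi> f) (\<phi> (q j))) p = (\<Prod>j\<in>?J. k j (\<phi> (p j)) (\<phi> (q j)))"
      using n unit by (intro prod_fun_superset[OF J]) auto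
    moreover have "j \<le> n" if "q j \<noteq> u" for j using n[of j] that by (meson not_less)
    then have "prod_ker u 0 (\<lambda>j x y. k j (\<phi> x) (\<phi> y)) p q = (\<Prod>j\<in>?J. k j (\<phi> (p j)) (\<phi> (q j)))"
      using unit by (intro prod_ker_superset[OF J]) auto
    ultimately show ?thesis using prod_ip_eq[OF p q] by simp
  qed
  then have "lcomb (d i) (prod_fun u n (\<lambda>j f. k j (\<phi> f) (\<phi> (q j)))) = lcomb (d i) (\<lambda>p. \<kappa> p q)" for i
    by (rule lcomb_cong[OF dE])
  ultimately show ?thesis by simp
qed

end

text \<open>\<open>C\<close> yields continuity. \<open>C'\<close> and \<open>Z\<close> yield
  injectivity: products of functionals from \<open>Z\<close> in finitely many slots and of the
  source functional \<open>k j x (\<phi> u)\<close> in the others must be bounded in the target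
  norm. This estimate runs against the direction of the map, but is needed for one tail functional
  only.\<close>

lemma tensor_embedsI:
  assumes K: "K = \<real> \<or> K = UNIV"
    and V: "tensor_factors u V \<phi> X k" and W: "tensor_factors u W \<phi> X' k'"
    and sub: "\<And>j. 1 \<le> j \<Longrightarrow> carr (V j) \<subseteq> carr (W j)" "\<And>j. 1 \<le> j \<Longrightarrow> X j \<subseteq> X' j"
    and C: "\<And>j x. 1 \<le> j \<Longrightarrow> x \<in> X j \<Longrightarrow> Re (k' j x x) \<le> C j * Re (k j x x)" "bounded_prods C"
    and tail: "\<And>j x. 1 \<le> j \<Longrightarrow> x \<in> X j \<Longrightarrow> (cmod (k j x (\<phi> u)))\<^sup>2 \<le> C' j * Re (k' j x x)" "bounded_prods C'"
    and Z: "\<And>j l. 1 \<le> j \<Longrightarrow> l \<in> Z j \<Longrightarrow> bounded_on (X j) (k' j) l"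
    and sep: "\<And>j. 1 \<le> j \<Longrightarrow> separating (X j) (k j) (Z j)"
  shows "tensor_embeds K u V W"
proof -
  interpret V: tensor_factors u V \<phi> X k by fact
  interpret W: tensor_factors u W \<phi> X' k' by fact
  \<comment> \<open>The vectors of the source with the inner product of the target: the test
    functionals live on \<open>X j\<close>, but have to be estimated by \<open>k' j\<close>.\<close>
  define V' where "V' j = \<lparr>carr = carr (V j), ip = ip (W j)\<rparr>" for j
  have X'form: "herm_form (X j) (k' j)" if "1 \<le> j" for j
  proof -
    interpret herm_form "X j" "k j" by (rule V.form[OF that])
    show ?thesis
      by (rule herm_form_subset[OF W.form[OF that] sub(2)[OF that] zero_mem add_mem scale_mem])
  qed
  interpret V': tensor_factors u V' \<phi> X k'
  proof (rule tensor_factors.intro)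
    fix j :: nat assume j: "1 \<le> j"
    show "herm_form (X j) (k' j)" using X'form[OF j] .
    show "\<phi> f \<in> X j" if "f \<in> carr (V' j)" for f using V.coord[OF j] that by (simp add: V'_def)
    show "u \<in> carr (V' j)" using V.unit_mem[OF j] by (simp add: V'_def)
    show "k' j (\<phi> u) (\<phi> u) = 1" using W.unit[OF j] .
    show "ip (V' j) f g = k' j (\<phi> f) (\<phi> g)" if "f \<in> carr (V' j)" "g \<in> carr (V' j)" for f g
      using W.ip_coord[OF j, of f g] sub(1)[OF j] that by (auto simp: V'_def)
  qed
  have EV': "elem_seqs V' u = elem_seqs V u" by (simp add: elem_seqs_def V'_def)
  have kV': "prod_ip V' u = prod_ip W u" by (simp add: fun_eq_iff prod_ip_def V'_def)
  have EE: "elem_seqs V u \<subseteq> elem_seqs W u" by (rule elem_seqs_mono[OF sub(1)])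
  obtain B where B: "0 \<le> B" "psd (elem_seqs V u) (\<lambda>p q. of_real B * prod_ip V u p q
      - prod_ker u 0 (\<lambda>j x y. k' j (\<phi> x) (\<phi> y)) p q)"
    using V.dominated[of k' 0 C] X'form W.unit C by blast
  have B': "psd (elem_seqs V u) (\<lambda>p q. of_real B * prod_ip V u p q - prod_ip W u p q)"
    by (rule psd_cong[OF _ B(2)]) (use EE in \<open>simp add: W.prod_ip_eq subset_iff\<close>)
  have tail_lin: "linear_on (X j) (\<lambda>x. k j x (\<phi> u))" if "1 \<le> j" for j
    using herm_form.linear_on_left[OF V.form[OF that] V.coord[OF that V.unit_mem[OF that]]] .
  have inj: "(\<lambda>n. lcomb (d n) (\<lambda>p. prod_ip V u p q)) \<longlonglongrightarrow> 0"
    if d: "herm_form.len_Cauchy (combs UNIV (elem_seqs V u)) (comb_ip (prod_ip V u)) d"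
      and null: "(\<lambda>n. sqrt (Re (comb_ip (prod_ip W u) (d n) (d n)))) \<longlonglongrightarrow> 0"
      and q: "q \<in> elem_seqs V u" for d q
  proof (rule V.vanishing[OF d _ sep _ q])
    show "bounded_on (X j) (k j) l" if j: "1 \<le> j" and l: "l \<in> Z j" for j l
    proof -
      obtain b where b: "b \<ge> 0" "\<forall>x\<in>X j. (cmod (l x))\<^sup>2 \<le> b * Re (k' j x x)" "linear_on (X j) l"
        using Z[OF j l] unfolding bounded_on_def by blast
      have "(cmod (l x))\<^sup>2 \<le> b * C j * Re (k j x x)" if "x \<in> X j" for x
        using b(2) that mult_left_mono[OF C(1)[OF j that] b(1)] by (fastforce simp: mult.assoc)
      moreover have "0 \<le> C j" using C(2) j unfolding bounded_prods_def by (meson order_trans zero_le_one)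
      then have "0 \<le> b * C j" using b(1) by simp
      ultimately show ?thesis using b(3) unfolding bounded_on_def by blast
    qed
    fix n l assume l: "\<And>j. 1 \<le> j \<Longrightarrow> j \<le> n \<Longrightarrow> l j \<in> Z j" "\<And>j. n < j \<Longrightarrow> l j = (\<lambda>x. k j x (\<phi> u))"
    have "bounded_fun (elem_seqs V' u) (prod_ip V' u) (prod_fun u n (\<lambda>j f. l j (\<phi> f)))"
    proof (rule V'.bounded_prod_fun[OF _ _ _ _ tail(2)])
      fix j :: nat assume j: "1 \<le> j"
      show "bounded_on (X j) (k' j) (l j)" if "j \<le> n" using Z[OF j l(1)[OF j that]] .
      assume "n < j"
      note lj = l(2)[OF this]
      show "linear_on (X j) (l j)" unfolding lj by (rule tail_lin[OF j])
      show "l j (\<phi> u) = 1" unfolding lj by (rule V.unit[OF j])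
      show "(cmod (l j x))\<^sup>2 \<le> C' j * Re (k' j x x)" if "x \<in> X j" for x
        unfolding lj by (rule tail(1)[OF j that])
    qed
    then have bf: "bounded_fun (elem_seqs V u) (prod_ip W u) (prod_fun u n (\<lambda>j f. l j (\<phi> f)))"
      by (simp only: EV' kV')
    interpret H: hull K "elem_seqs V u" "prod_ip W u"
      using K V'.psd_prod_ip unfolding EV' kV' by unfold_locales
    show "(\<lambda>m. lcomb (d m) (prod_fun u n (\<lambda>j f. l j (\<phi> f)))) \<longlonglongrightarrow> 0"
    proof (rule H.bounded_fun_null[OF bf])
      show "d m \<in> combs UNIV (elem_seqs V u)" for m
        by (rule herm_form.len_Cauchy_mem[OF herm_form_combs[OF V.psd_prod_ip] d])
      show "(\<lambda>n. H.len (d n)) \<longlonglongrightarrow> 0" using null by (simp add: H.len_def)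
    qed
  qed
  show ?thesis
    unfolding tensor_embeds_def tensor_def elem_tensor_def
    using EE hull_embedding[OF K V.psd_prod_ip W.psd_prod_ip EE B(1) B' inj] by blast
qed

lemma tensor_embeds_trans:
  assumes "tensor_embeds K u V W" "tensor_embeds K u W Y"
    and K: "K = \<real> \<or> K = UNIV"
    and "tensor_factors u V \<phi> X k" "tensor_factors u W \<phi>' X' k'"
  shows "tensor_embeds K u V Y"
proof -
  interpret V: tensor_factors u V \<phi> X k by fact
  interpret W: tensor_factors u W \<phi>' X' k' by fact
  interpret VH: hull K V.E V.\<kappa> using K V.psd_prod_ip by unfold_locales
  interpret WH: hull K W.E W.\<kappa> using K W.psd_prod_ip by unfold_locales
  let ?V = "carr (tensor K u V)" and ?W = "carr (tensor K u W)" and ?Y = "carr (tensor K u Y)"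
  obtain T C where T: "T \<in> ?V \<rightarrow> ?W" "lin_map K ?V T" "inj_on T ?V"
    "\<forall>\<Phi>\<in>?V. nrm (tensor K u W) (T \<Phi>) \<le> C * nrm (tensor K u V) \<Phi>"
    "\<forall>f\<in>elem_seqs V u. T (elem_tensor u V f) = elem_tensor u W f" "elem_seqs V u \<subseteq> elem_seqs W u"
    using assms(1) unfolding tensor_embeds_def by blast
  obtain S D where S: "S \<in> ?W \<rightarrow> ?Y" "lin_map K ?W S" "inj_on S ?W"
    "\<forall>\<Phi>\<in>?W. nrm (tensor K u Y) (S \<Phi>) \<le> D * nrm (tensor K u W) \<Phi>"
    "\<forall>f\<in>elem_seqs W u. S (elem_tensor u W f) = elem_tensor u Y f" "elem_seqs W u \<subseteq> elem_seqs Y u"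
    using assms(2) unfolding tensor_embeds_def by blast
  have TW: "T \<Phi> \<in> ?W" if "\<Phi> \<in> ?V" for \<Phi> using T(1) that by blast
  show ?thesis
    unfolding tensor_embeds_def
  proof (intro conjI exI[of _ "\<lambda>\<Phi>. S (T \<Phi>)"])
    show "(\<lambda>\<Phi>. S (T \<Phi>)) \<in> ?V \<rightarrow> ?Y" using T(1) S(1) by auto
    show "lin_map K ?V (\<lambda>\<Phi>. S (T \<Phi>))"
      using T(2) S(2) TW unfolding lin_map_def by simp
    show "inj_on (\<lambda>\<Phi>. S (T \<Phi>)) ?V"
      using T(3) S(3) TW unfolding inj_on_def by blast
    show "\<exists>C. \<forall>\<Phi>\<in>?V. nrm (tensor K u Y) (S (T \<Phi>)) \<le> C * nrm (tensor K u V) \<Phi>"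
    \<comment> \<open>The constants in \<open>tensor_embeds\<close> carry no sign condition, hence
      the absolute values.\<close>
    proof (intro exI[of _ "\<bar>D\<bar> * \<bar>C\<bar>"] ballI)
      fix \<Phi> assume \<Phi>: "\<Phi> \<in> ?V"
      show "nrm (tensor K u Y) (S (T \<Phi>)) \<le> \<bar>D\<bar> * \<bar>C\<bar> * nrm (tensor K u V) \<Phi>"
      proof -
        have n: "0 \<le> nrm (tensor K u V) \<Phi>" "0 \<le> nrm (tensor K u W) (T \<Phi>)"
          using VH.nrm_nonneg WH.nrm_nonneg \<Phi> TW unfolding tensor_def by auto
        have "nrm (tensor K u Y) (S (T \<Phi>)) \<le> D * nrm (tensor K u W) (T \<Phi>)"
          using S(4) TW[OF \<Phi>] by blast
        also have "\<dots> \<le> \<bar>D\<bar> * nrm (tensor K u W) (T \<Phi>)" using n by (intro mult_right_mono) auto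
        also have "\<dots> \<le> \<bar>D\<bar> * (C * nrm (tensor K u V) \<Phi>)"
          using T(4) \<Phi> by (intro mult_left_mono) auto
        also have "\<dots> \<le> \<bar>D\<bar> * (\<bar>C\<bar> * nrm (tensor K u V) \<Phi>)"
          using n by (intro mult_left_mono mult_right_mono) auto
        finally show ?thesis by (simp add: mult.assoc)
      qed
    qed
    show "\<forall>f\<in>elem_seqs V u. S (T (elem_tensor u V f)) = elem_tensor u Y f"
      using T(5,6) S(5) by auto
  qed (use T(6) S(6) in blast)
qed

text \<open>Evaluation at \<open>a\<close> is the inner product with the unit vector, so a product
  of finitely many evaluations with the unit functional in the tail is itself an evaluation at a
  point of the product space.\<close>

lemma tensor_rkhsI:
  fixes D :: "'e set"
  assumes K: "K = \<real> \<or> K = UNIV"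
    and V: "tensor_factors u V \<phi> X k"
    and val: "\<And>j f y. 1 \<le> j \<Longrightarrow> f \<in> carr (V j) \<Longrightarrow> y \<in> D \<Longrightarrow> val f y = pt_eval y (\<phi> f)"
    and lin: "\<And>j y. 1 \<le> j \<Longrightarrow> y \<in> D \<Longrightarrow> linear_on (X j) (pt_eval y)"
    and unit: "\<And>y. y \<in> D \<Longrightarrow> pt_eval y (\<phi> u) = 1"
    and a: "a \<in> D" "\<And>j x. 1 \<le> j \<Longrightarrow> x \<in> X j \<Longrightarrow> k j x (\<phi> u) = pt_eval a x"
    and bd: "\<And>y. y \<in> {1..} \<rightarrow>\<^sub>E D \<Longrightarrow> \<exists>C. bounded_prods C \<and>
        (\<forall>j\<ge>1. \<forall>x\<in>X j. (cmod (pt_eval (y j) x))\<^sup>2 \<le> C j * Re (k j x x))"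
    and sep: "\<And>j. 1 \<le> j \<Longrightarrow> separating (X j) (k j) (pt_eval ` D)"
  shows "tensor_rkhs K u val D V"
proof -
  interpret V: tensor_factors u V \<phi> X k by fact
  define h where "h y f = (\<Prod>j | 1 \<le> j \<and> f j \<noteq> u. val (f j) (y j))" for y :: "nat \<Rightarrow> 'e" and f
  have h: "h y f = prod_fun u 0 (\<lambda>j f. pt_eval (y j) (\<phi> f)) f" if "y \<in> {1..} \<rightarrow>\<^sub>E D" "f \<in> V.E" for y f
  proof -
    have "val (f j) (y j) = pt_eval (y j) (\<phi> (f j))" if "1 \<le> j" for j
      using \<open>y \<in> _\<close> that by (intro val[OF that elem_seqs_carr[OF \<open>f \<in> V.E\<close> that]]) (auto simp: PiE_iff)
    then show ?thesis unfolding h_def prod_fun_def by (intro prod.cong) auto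
  qed
  have yD: "y j \<in> D" if "y \<in> {1..} \<rightarrow>\<^sub>E D" "1 \<le> j" for y :: "nat \<Rightarrow> 'e" and j
    using that by (auto simp: PiE_iff)
  have bf: "bounded_fun V.E V.\<kappa> (h y)" if y: "y \<in> {1..} \<rightarrow>\<^sub>E D" for y
  proof -
    obtain C where C: "bounded_prods C"
      "\<And>j x. 1 \<le> j \<Longrightarrow> x \<in> X j \<Longrightarrow> (cmod (pt_eval (y j) x))\<^sup>2 \<le> C j * Re (k j x x)"
      using bd[OF y] by blast
    have "bounded_fun V.E V.\<kappa> (prod_fun u 0 (\<lambda>j f. pt_eval (y j) (\<phi> f)))"
      by (rule V.bounded_prod_fun[OF _ _ _ C(2,1)]) (use yD[OF y] lin unit in auto)
    moreover have "lcomb c (h y) = lcomb c (prod_fun u 0 (\<lambda>j f. pt_eval (y j) (\<phi> f)))" if "c \<in> combs UNIV V.E" for c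
      using h[OF y] by (intro lcomb_cong[OF that])
    ultimately show ?thesis by (simp add: bounded_fun_def)
  qed
  have "(\<lambda>n. lcomb (d n) (\<lambda>p. V.\<kappa> p q)) \<longlonglongrightarrow> 0"
    if d: "herm_form.len_Cauchy (combs UNIV V.E) (comb_ip V.\<kappa>) d"
      and null: "\<And>y. y \<in> {1..} \<rightarrow>\<^sub>E D \<Longrightarrow> (\<lambda>n. lcomb (d n) (h y)) \<longlonglongrightarrow> 0"
      and q: "q \<in> V.E" for d q
  proof (rule V.vanishing[OF d _ sep _ q])
    show "bounded_on (X j) (k j) l" if j: "1 \<le> j" and l: "l \<in> pt_eval ` D" for j l
    proof -
      obtain y where y: "y \<in> D" "l = pt_eval y" using l by blast
      \<comment> \<open>The constant sequence \<open>y\<close> yields the bound for a single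
        evaluation in slot \<open>j\<close>.\<close>
      have "(\<lambda>j. if 1 \<le> j then y else undefined) \<in> {1..} \<rightarrow>\<^sub>E D"
        using y by (auto simp: PiE_iff extensional_def)
      from bd[OF this] obtain C where C: "bounded_prods C"
        "\<And>j x. 1 \<le> j \<Longrightarrow> x \<in> X j \<Longrightarrow> (cmod (pt_eval (if 1 \<le> j then y else undefined) x))\<^sup>2 \<le> C j * Re (k j x x)"
        by blast
      have "0 \<le> C j" using C(1) j unfolding bounded_prods_def by (meson order_trans zero_le_one)
      moreover have "\<forall>x\<in>X j. (cmod (l x))\<^sup>2 \<le> C j * Re (k j x x)" using C(2)[OF j] j y by simp
      ultimately show ?thesis using lin[OF j y(1)] y(2) unfolding bounded_on_def by blast
    qed
    fix n l assume l: "\<And>j. 1 \<le> j \<Longrightarrow> j \<le> n \<Longrightarrow> l j \<in> pt_eval ` D" "\<And>j. n < j \<Longrightarrow> l j = (\<lambda>x. k j x (\<phi> u))"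
    have "\<forall>j. \<exists>y. 1 \<le> j \<longrightarrow> j \<le> n \<longrightarrow> y \<in> D \<and> l j = pt_eval y" using l(1) by blast
    then obtain y0 where y0: "\<And>j. 1 \<le> j \<Longrightarrow> j \<le> n \<Longrightarrow> y0 j \<in> D \<and> l j = pt_eval (y0 j)" by metis
    \<comment> \<open>The prescribed points up to \<open>n\<close> and \<open>a\<close> afterwards.
      Index 0 receives \<open>undefined\<close> because the sequences are extensional on
      \<open>{1..}\<close>.\<close>
    define y where "y j = (if j = 0 then undefined else if j \<le> n then y0 j else a)" for j
    have y: "y \<in> {1..} \<rightarrow>\<^sub>E D" using y0 a(1) by (auto simp: y_def PiE_iff extensional_def)
    have lev: "l j x = pt_eval (y j) x" if "1 \<le> j" "x \<in> X j" for j x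
      using l(2)[of j] y0[of j] a(2)[OF that] that by (cases "j \<le> n") (auto simp: y_def)
    have "prod_fun u n (\<lambda>j f. l j (\<phi> f)) p = h y p" if p: "p \<in> V.E" for p
    proof -
      let ?J = "{1..n} \<union> {j \<in> {1..}. p j \<noteq> u}"
      have J: "finite ?J" "?J \<subseteq> {1..}" using elem_seqs_finite[OF p] by auto
      have "prod_fun u n (\<lambda>j f. l j (\<phi> f)) p = (\<Prod>j\<in>?J. l j (\<phi> (p j)))"
        using l(2) V.unit by (intro prod_fun_superset[OF J]) auto
      also have "\<dots> = (\<Prod>j\<in>?J. pt_eval (y j) (\<phi> (p j)))"
        using J(2) by (intro prod.cong refl lev V.coord elem_seqs_carr[OF p]) auto
      also have "\<dots> = prod_fun u 0 (\<lambda>j f. pt_eval (y j) (\<phi> f)) p"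
        using unit yD[OF y] by (intro prod_fun_superset[OF J, symmetric]) auto
      finally show ?thesis using h[OF y p] by simp
    qed
    then have "lcomb (d m) (prod_fun u n (\<lambda>j f. l j (\<phi> f))) = lcomb (d m) (h y)" for m
      by (rule lcomb_cong[OF herm_form.len_Cauchy_mem[OF herm_form_combs[OF V.psd_prod_ip] d]])
    then show "(\<lambda>m. lcomb (d m) (prod_fun u n (\<lambda>j f. l j (\<phi> f)))) \<longlonglongrightarrow> 0" using null[OF y] by simp
  qed
  from hull_functions[OF K V.psd_prod_ip, of "{1..} \<rightarrow>\<^sub>E D" h, OF bf this]
  show ?thesis unfolding tensor_rkhs_def tensor_def elem_tensor_def h_def .
qed

section \<open>Weighted square summable sequences\<close>

definition wl2 :: "(nat \<Rightarrow> real) \<Rightarrow> (nat \<Rightarrow> complex) set" where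
  "wl2 \<beta> = {x. (\<lambda>\<nu>. \<beta> \<nu> * (cmod (x \<nu>))\<^sup>2) summable_on UNIV}"

definition diag :: "(nat \<Rightarrow> real) \<Rightarrow> (nat \<Rightarrow> complex) \<Rightarrow> (nat \<Rightarrow> complex) \<Rightarrow> complex" where
  "diag \<beta> x y = (\<Sum>\<^sub>\<infinity>\<nu>. of_real (\<beta> \<nu>) * x \<nu> * cnj (y \<nu>))"

lemma wl2_D: "x \<in> wl2 \<beta> \<Longrightarrow> (\<lambda>\<nu>. \<beta> \<nu> * (cmod (x \<nu>))\<^sup>2) summable_on UNIV"
  by (simp add: wl2_def)

lemma summable_on_UNIV_remove: "f summable_on UNIV \<longleftrightarrow> f summable_on - {a}"
  for f :: "'a \<Rightarrow> 'b :: {ab_group_add, complete_uniform_space, topological_comm_monoid_add, uniform_topological_group_add}"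
proof -
  have "insert a (- {a}) = UNIV" by auto
  then show ?thesis using summable_on_insert_iff[of f a "- {a}"] by simp
qed

text \<open>One weight does not affect summability. The same space thus carries the norms with
  weight 1 at index 0 and the forms with weight 0 there.\<close>

lemma wl2_upd [simp]: "wl2 (\<beta>(0 := c)) = wl2 \<beta>"
proof -
  have "(\<lambda>\<nu>. (\<beta>(0 := c)) \<nu> * (cmod (x \<nu>))\<^sup>2) summable_on - {0}
      \<longleftrightarrow> (\<lambda>\<nu>. \<beta> \<nu> * (cmod (x \<nu>))\<^sup>2) summable_on - {0}" for x :: "nat \<Rightarrow> complex"
    by (rule summable_on_cong) auto
  then show ?thesis unfolding wl2_def summable_on_UNIV_remove[of _ 0] by blast
qed

lemma wl2_mono:
  assumes "x \<in> wl2 \<beta>" "\<And>\<nu>. 0 \<le> \<beta>' \<nu>" "\<And>\<nu>. \<beta>' \<nu> \<le> C * \<beta> \<nu>"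
  shows "x \<in> wl2 \<beta>'"
  unfolding wl2_def mem_Collect_eq
proof (rule summable_on_comparison_test)
  show "(\<lambda>\<nu>. C * (\<beta> \<nu> * (cmod (x \<nu>))\<^sup>2)) summable_on UNIV"
    by (intro summable_on_cmult_right wl2_D assms(1))
  show "\<beta>' \<nu> * (cmod (x \<nu>))\<^sup>2 \<le> C * (\<beta> \<nu> * (cmod (x \<nu>))\<^sup>2)" for \<nu>
    using mult_right_mono[OF assms(3), of "(cmod (x \<nu>))\<^sup>2" \<nu>] by (simp add: mult.assoc)
qed (use assms(2) in simp)

lemma diag_summable:
  assumes "\<And>\<nu>. 0 \<le> \<beta> \<nu>" "x \<in> wl2 \<beta>" "y \<in> wl2 \<beta>"
  shows "(\<lambda>\<nu>. of_real (\<beta> \<nu>) * x \<nu> * cnj (y \<nu>)) summable_on UNIV"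
proof -
  have le: "norm (of_real (\<beta> \<nu>) * x \<nu> * cnj (y \<nu>)) \<le> \<beta> \<nu> * (cmod (x \<nu>))\<^sup>2 + \<beta> \<nu> * (cmod (y \<nu>))\<^sup>2" for \<nu>
  proof -
    have "cmod (x \<nu>) * cmod (y \<nu>) \<le> (cmod (x \<nu>))\<^sup>2 + (cmod (y \<nu>))\<^sup>2"
      using sum_squares_bound[of "cmod (x \<nu>)" "cmod (y \<nu>)"]
        mult_nonneg_nonneg[OF norm_ge_zero norm_ge_zero, of "x \<nu>" "y \<nu>"] by linarith
    then have "\<beta> \<nu> * (cmod (x \<nu>) * cmod (y \<nu>)) \<le> \<beta> \<nu> * ((cmod (x \<nu>))\<^sup>2 + (cmod (y \<nu>))\<^sup>2)"
      using assms(1) by (rule mult_left_mono)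
    then show ?thesis using assms(1)[of \<nu>] by (simp add: norm_mult algebra_simps)
  qed
  have "(\<lambda>\<nu>. \<beta> \<nu> * (cmod (x \<nu>))\<^sup>2 + \<beta> \<nu> * (cmod (y \<nu>))\<^sup>2) summable_on UNIV"
    using assms by (intro summable_on_add wl2_D)
  then have "(\<lambda>\<nu>. norm (of_real (\<beta> \<nu>) * x \<nu> * cnj (y \<nu>))) summable_on UNIV"
    by (rule summable_on_comparison_test) (use le in auto)
  then show ?thesis by (rule abs_summable_summable)
qed

lemma diag_self:
  assumes "x \<in> wl2 \<beta>"
  shows "Re (diag \<beta> x x) = (\<Sum>\<^sub>\<infinity>\<nu>. \<beta> \<nu> * (cmod (x \<nu>))\<^sup>2)"
proof -
  have eq: "of_real (\<beta> \<nu>) * x \<nu> * cnj (x \<nu>) = complex_of_real (\<beta> \<nu> * (cmod (x \<nu>))\<^sup>2)" for \<nu>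
    unfolding of_real_mult complex_norm_square by (rule mult.assoc)
  have "((\<lambda>\<nu>. of_real (\<beta> \<nu>) * x \<nu> * cnj (x \<nu>)) has_sum of_real (\<Sum>\<^sub>\<infinity>\<nu>. \<beta> \<nu> * (cmod (x \<nu>))\<^sup>2)) UNIV"
    unfolding eq by (rule has_sum_of_real[OF has_sum_infsum[OF wl2_D[OF assms]]])
  then show ?thesis unfolding diag_def by (simp add: infsumI)
qed

lemma herm_form_diag:
  assumes nn: "\<And>\<nu>. 0 \<le> \<beta> \<nu>"
  shows "herm_form (wl2 \<beta>) (diag \<beta>)"
proof
  show "(\<lambda>i. 0) \<in> wl2 \<beta>" by (simp add: wl2_def)
next
  fix x y assume xy: "x \<in> wl2 \<beta>" "y \<in> wl2 \<beta>"
  show "(\<lambda>i. x i + y i) \<in> wl2 \<beta>"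
    unfolding wl2_def mem_Collect_eq
  proof (rule summable_on_comparison_test)
    show "(\<lambda>\<nu>. 2 * (\<beta> \<nu> * (cmod (x \<nu>))\<^sup>2 + \<beta> \<nu> * (cmod (y \<nu>))\<^sup>2)) summable_on UNIV"
      using xy by (intro summable_on_cmult_right summable_on_add wl2_D)
    fix \<nu>
    have "(cmod (x \<nu> + y \<nu>))\<^sup>2 \<le> (cmod (x \<nu>) + cmod (y \<nu>))\<^sup>2"
      by (intro power_mono norm_triangle_ineq) simp
    also have "\<dots> \<le> 2 * ((cmod (x \<nu>))\<^sup>2 + (cmod (y \<nu>))\<^sup>2)"
      using sum_squares_bound[of "cmod (x \<nu>)" "cmod (y \<nu>)"] by (simp add: power2_sum)
    finally show "\<beta> \<nu> * (cmod (x \<nu> + y \<nu>))\<^sup>2 \<le> 2 * (\<beta> \<nu> * (cmod (x \<nu>))\<^sup>2 + \<beta> \<nu> * (cmod (y \<nu>))\<^sup>2)"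
      using mult_left_mono[OF _ nn[of \<nu>]] by (fastforce simp: algebra_simps)
  qed (use nn in simp)
next
  fix x c assume "x \<in> wl2 \<beta>"
  then have "(\<lambda>\<nu>. (cmod c)\<^sup>2 * (\<beta> \<nu> * (cmod (x \<nu>))\<^sup>2)) summable_on UNIV"
    by (intro summable_on_cmult_right wl2_D)
  then show "(\<lambda>i. c * x i) \<in> wl2 \<beta>"
    by (simp add: wl2_def norm_mult power_mult_distrib mult_ac)
next
  fix x y z assume "x \<in> wl2 \<beta>" "y \<in> wl2 \<beta>" "z \<in> wl2 \<beta>"
  then show "diag \<beta> (\<lambda>i. x i + y i) z = diag \<beta> x z + diag \<beta> y z"
    unfolding diag_def using nn by (subst infsum_add[symmetric]) (auto intro!: diag_summable simp: ring_distribs)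
next
  fix x z :: "nat \<Rightarrow> complex" and c
  show "diag \<beta> (\<lambda>i. c * x i) z = c * diag \<beta> x z"
    unfolding diag_def infsum_cmult_right'[symmetric] by (simp add: mult_ac)
next
  fix x y
  show "diag \<beta> y x = cnj (diag \<beta> x y)"
    unfolding diag_def infsum_cnj[symmetric] by (simp add: mult_ac)
next
  fix x assume "x \<in> wl2 \<beta>"
  then show "0 \<le> Re (diag \<beta> x x)" using nn by (simp add: diag_self infsum_nonneg)
qed

lemma diag_coord:
  assumes "\<And>\<nu>. 0 \<le> \<beta> \<nu>" "x \<in> wl2 \<beta>"
  shows "\<beta> \<nu> * (cmod (x \<nu>))\<^sup>2 \<le> Re (diag \<beta> x x)"
  using finite_sum_le_infsum[of "\<lambda>\<nu>. \<beta> \<nu> * (cmod (x \<nu>))\<^sup>2" UNIV "{\<nu>}"] assms wl2_D[OF assms(2)]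
  by (simp add: diag_self)

lemma diag_split:
  assumes "\<And>\<nu>. 0 \<le> \<beta> \<nu>" "0 \<le> c" "x \<in> wl2 \<beta>" "y \<in> wl2 \<beta>"
  shows "diag (\<beta>(0 := c)) x y = of_real c * x 0 * cnj (y 0) + diag (\<beta>(0 := 0)) x y"
proof -
  have s: "(\<lambda>\<nu>. of_real ((\<beta>(0 := b)) \<nu>) * x \<nu> * cnj (y \<nu>)) summable_on - {0}" if "0 \<le> b" for b
  proof (rule summable_on_UNIV_remove[THEN iffD1, OF diag_summable])
    show "0 \<le> (\<beta>(0 := b)) \<nu>" for \<nu> using assms(1) that by simp
    show "x \<in> wl2 (\<beta>(0 := b))" "y \<in> wl2 (\<beta>(0 := b))" unfolding wl2_upd by fact+
  qed
  have "diag (\<beta>(0 := b)) x y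
      = of_real b * x 0 * cnj (y 0) + (\<Sum>\<^sub>\<infinity>\<nu>\<in>- {0}. of_real (\<beta> \<nu>) * x \<nu> * cnj (y \<nu>))" if "0 \<le> b" for b
  proof -
    have "diag (\<beta>(0 := b)) x y = (\<Sum>\<^sub>\<infinity>\<nu>\<in>insert 0 (- {0}). of_real ((\<beta>(0 := b)) \<nu>) * x \<nu> * cnj (y \<nu>))"
    proof -
      have "insert 0 (- {0}) = (UNIV :: nat set)" by auto
      then show ?thesis unfolding diag_def by (simp only:)
    qed
    also have "\<dots> = of_real b * x 0 * cnj (y 0)
        + (\<Sum>\<^sub>\<infinity>\<nu>\<in>- {0}. of_real ((\<beta>(0 := b)) \<nu>) * x \<nu> * cnj (y \<nu>))"
      by (subst infsum_insert) (use s[OF that] in auto)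
    also have "(\<Sum>\<^sub>\<infinity>\<nu>\<in>- {0}. of_real ((\<beta>(0 := b)) \<nu>) * x \<nu> * cnj (y \<nu>))
        = (\<Sum>\<^sub>\<infinity>\<nu>\<in>- {0}. of_real (\<beta> \<nu>) * x \<nu> * cnj (y \<nu>))"
      by (intro infsum_cong) auto
    finally show ?thesis .
  qed
  from this[of c] this[of 0] assms(2) show ?thesis by simp
qed

text \<open>Positive weights make the coordinates converge, and the Cauchy estimate passes to the
  limit on every finite set of coordinates with a bound independent of that set.\<close>

lemma diag_complete:
  assumes pos: "\<And>\<nu>. 0 < \<beta> \<nu>" and g: "herm_form.len_Cauchy (wl2 \<beta>) (diag \<beta>) g"
  shows "\<exists>x\<in>wl2 \<beta>. (\<lambda>n. herm_form.len (diag \<beta>) (\<lambda>\<nu>. g n \<nu> - x \<nu>)) \<longlonglongrightarrow> 0"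
proof -
  interpret herm_form "wl2 \<beta>" "diag \<beta>" using herm_form_diag pos less_imp_le by blast
  note gm = len_Cauchy_mem[OF g]
  have nn: "0 \<le> \<beta> \<nu>" for \<nu> using pos less_imp_le by blast
  have "Cauchy (\<lambda>n. g n \<nu>)" for \<nu>
  proof (rule CauchyI)
    fix \<epsilon> :: real assume e: "\<epsilon> > 0"
    then have "sqrt (\<beta> \<nu>) * \<epsilon> > 0" using pos by simp
    then obtain N where N: "\<And>m n. m \<ge> N \<Longrightarrow> n \<ge> N \<Longrightarrow> len (\<lambda>i. g m i - g n i) < sqrt (\<beta> \<nu>) * \<epsilon>"
      using g unfolding len_Cauchy_def by meson
    have "norm (g m \<nu> - g n \<nu>) < \<epsilon>" if "m \<ge> N" "n \<ge> N" for m n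
    proof -
      have "sqrt (\<beta> \<nu>) * cmod (g m \<nu> - g n \<nu>) \<le> len (\<lambda>i. g m i - g n i)"
        using real_sqrt_le_mono[OF diag_coord[OF nn diff_mem[OF gm gm], of \<nu> m n]]
        by (simp add: len_def real_sqrt_mult)
      then have "sqrt (\<beta> \<nu>) * cmod (g m \<nu> - g n \<nu>) < sqrt (\<beta> \<nu>) * \<epsilon>" using N[OF that] by simp
      then show ?thesis using pos[of \<nu>] by simp
    qed
    then show "\<exists>M. \<forall>m\<ge>M. \<forall>n\<ge>M. norm (g m \<nu> - g n \<nu>) < \<epsilon>" by blast
  qed
  then have "\<forall>\<nu>. \<exists>l. (\<lambda>n. g n \<nu>) \<longlonglongrightarrow> l" using Cauchy_convergent convergent_def by blast
  then obtain x where x: "\<And>\<nu>. (\<lambda>n. g n \<nu>) \<longlonglongrightarrow> x \<nu>" by metis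
  have key: "\<exists>N. \<forall>n\<ge>N. (\<lambda>\<nu>. g n \<nu> - x \<nu>) \<in> wl2 \<beta> \<and> len (\<lambda>\<nu>. g n \<nu> - x \<nu>) \<le> \<epsilon>" if e: "\<epsilon> > 0" for \<epsilon>
  proof -
    obtain N where N: "\<And>m n. m \<ge> N \<Longrightarrow> n \<ge> N \<Longrightarrow> len (\<lambda>i. g m i - g n i) < \<epsilon>"
      using g e unfolding len_Cauchy_def by meson
    have "(\<lambda>\<nu>. g n \<nu> - x \<nu>) \<in> wl2 \<beta> \<and> len (\<lambda>\<nu>. g n \<nu> - x \<nu>) \<le> \<epsilon>" if "n \<ge> N" for n
    proof -
      have fin: "(\<Sum>\<nu>\<in>F. \<beta> \<nu> * (cmod (g n \<nu> - x \<nu>))\<^sup>2) \<le> \<epsilon>\<^sup>2" if "finite F" for F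
      proof (rule LIMSEQ_le_const2)
        show "(\<lambda>m. \<Sum>\<nu>\<in>F. \<beta> \<nu> * (cmod (g n \<nu> - g m \<nu>))\<^sup>2) \<longlonglongrightarrow> (\<Sum>\<nu>\<in>F. \<beta> \<nu> * (cmod (g n \<nu> - x \<nu>))\<^sup>2)"
          by (intro tendsto_intros x)
        have "(\<Sum>\<nu>\<in>F. \<beta> \<nu> * (cmod (g n \<nu> - g m \<nu>))\<^sup>2) \<le> \<epsilon>\<^sup>2" if "m \<ge> N" for m
        proof -
          have "(\<Sum>\<nu>\<in>F. \<beta> \<nu> * (cmod (g n \<nu> - g m \<nu>))\<^sup>2) \<le> (\<Sum>\<^sub>\<infinity>\<nu>. \<beta> \<nu> * (cmod (g n \<nu> - g m \<nu>))\<^sup>2)"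
            using wl2_D[OF diff_mem[OF gm gm]] \<open>finite F\<close> nn by (intro finite_sum_le_infsum) auto
          also have "\<dots> = (len (\<lambda>i. g n i - g m i))\<^sup>2"
            using diag_self[OF diff_mem[OF gm gm]] len_sq[OF diff_mem[OF gm gm]] by simp
          also have "\<dots> \<le> \<epsilon>\<^sup>2"
            using N[of n m] \<open>n \<ge> N\<close> that len_nonneg[OF diff_mem[OF gm gm]]
            by (intro power_mono) (auto intro: less_imp_le)
          finally show ?thesis .
        qed
        then show "\<exists>N. \<forall>m\<ge>N. (\<Sum>\<nu>\<in>F. \<beta> \<nu> * (cmod (g n \<nu> - g m \<nu>))\<^sup>2) \<le> \<epsilon>\<^sup>2" by blast
      qed
      have mem: "(\<lambda>\<nu>. g n \<nu> - x \<nu>) \<in> wl2 \<beta>"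
        unfolding wl2_def mem_Collect_eq
      proof (rule nonneg_bdd_above_summable_on)
        show "bdd_above (sum (\<lambda>\<nu>. \<beta> \<nu> * (cmod (g n \<nu> - x \<nu>))\<^sup>2) ` {F. F \<subseteq> UNIV \<and> finite F})"
          by (rule bdd_aboveI2[of _ _ "\<epsilon>\<^sup>2"]) (simp add: fin)
      qed (simp add: nn)
      have "(\<Sum>\<^sub>\<infinity>\<nu>. \<beta> \<nu> * (cmod (g n \<nu> - x \<nu>))\<^sup>2) \<le> \<epsilon>\<^sup>2"
        by (rule infsum_le_finite_sums[OF wl2_D[OF mem]]) (use fin in auto)
      then have "len (\<lambda>\<nu>. g n \<nu> - x \<nu>) \<le> \<epsilon>"
        using diag_self[OF mem] \<open>\<epsilon> > 0\<close> by (simp add: len_def real_le_lsqrt)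
      then show ?thesis using mem by blast
    qed
    then show ?thesis by blast
  qed
  obtain n where n: "(\<lambda>\<nu>. g n \<nu> - x \<nu>) \<in> wl2 \<beta>" using key[of 1] by auto
  have "x \<in> wl2 \<beta>" using diff_mem[OF gm[of n] n] by simp
  moreover have "(\<lambda>n. len (\<lambda>\<nu>. g n \<nu> - x \<nu>)) \<longlonglongrightarrow> 0"
  proof (rule LIMSEQ_I)
    fix r :: real assume "r > 0"
    then obtain N where N: "\<And>n. n \<ge> N \<Longrightarrow> len (\<lambda>\<nu>. g n \<nu> - x \<nu>) \<le> r / 2" using key[of "r / 2"] by auto
    have "norm (len (\<lambda>\<nu>. g n \<nu> - x \<nu>) - 0) < r" if "n \<ge> N" for n
      using N[OF that] len_nonneg[OF diff_mem[OF gm \<open>x \<in> wl2 \<beta>\<close>]] \<open>r > 0\<close> by simp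
    then show "\<exists>no. \<forall>n\<ge>no. norm (len (\<lambda>\<nu>. g n \<nu> - x \<nu>) - 0) < r" by blast
  qed
  ultimately show ?thesis by blast
qed

lemma diag_coord_null:
  assumes "\<And>\<nu>. 0 < \<beta> \<nu>" "\<And>n. g n \<in> wl2 \<beta>" "(\<lambda>n. herm_form.len (diag \<beta>) (g n)) \<longlonglongrightarrow> 0"
  shows "(\<lambda>n. g n \<nu>) \<longlonglongrightarrow> 0"
proof -
  have nn: "\<And>\<nu>. 0 \<le> \<beta> \<nu>" using assms(1) less_imp_le by blast
  interpret herm_form "wl2 \<beta>" "diag \<beta>" by (rule herm_form_diag[OF nn])
  have "sqrt (\<beta> \<nu>) * cmod (g n \<nu>) \<le> len (g n)" for n
    using real_sqrt_le_mono[OF diag_coord[OF nn assms(2), of \<nu> n]] by (simp add: len_def real_sqrt_mult)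
  then have "norm (g n \<nu>) \<le> len (g n) / sqrt (\<beta> \<nu>)" for n
    using assms(1)[of \<nu>] by (simp add: pos_le_divide_eq mult.commute)
  then have "\<forall>\<^sub>F n in sequentially. norm (g n \<nu>) \<le> len (g n) / sqrt (\<beta> \<nu>)" by simp
  then show ?thesis by (rule Lim_null_comparison) (rule tendsto_divide_zero[OF assms(3)])
qed

text \<open>By completeness the Cauchy sequence has a limit in the space itself. Its coordinates are
  the limits of the coordinates, hence zero, so the sequence is null in norm.\<close>

lemma separating_coords:
  assumes pos: "\<And>\<nu>. 0 < \<beta> \<nu>"
  shows "separating (wl2 \<beta>) (diag \<beta>) (range (\<lambda>\<nu> x. x \<nu>))"
  unfolding separating_def
proof (intro allI impI ballI)
  have nn: "\<And>\<nu>. 0 \<le> \<beta> \<nu>" using pos less_imp_le by blast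
  interpret herm_form "wl2 \<beta>" "diag \<beta>" by (rule herm_form_diag[OF nn])
  fix g y assume g: "len_Cauchy g" and lim: "\<forall>l\<in>range (\<lambda>\<nu> x. x \<nu>). (\<lambda>n. l (g n)) \<longlonglongrightarrow> 0" and y: "y \<in> wl2 \<beta>"
  note gm = len_Cauchy_mem[OF g]
  obtain x where x: "x \<in> wl2 \<beta>" "(\<lambda>n. len (\<lambda>\<nu>. g n \<nu> - x \<nu>)) \<longlonglongrightarrow> 0"
    using diag_complete[OF pos g] by blast
  have "x \<nu> = 0" for \<nu>
  proof -
    have "(\<lambda>n. g n \<nu> - x \<nu>) \<longlonglongrightarrow> 0"
      using diag_coord_null[OF pos diff_mem[OF gm x(1)] x(2)] .
    moreover have "(\<lambda>n. g n \<nu>) \<longlonglongrightarrow> 0" using lim by auto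
    then have "(\<lambda>n. g n \<nu> - x \<nu>) \<longlonglongrightarrow> 0 - x \<nu>" by (intro tendsto_intros)
    ultimately show ?thesis using LIMSEQ_unique by fastforce
  qed
  then show "(\<lambda>n. diag \<beta> (g n) y) \<longlonglongrightarrow> 0"
    using x(2) by (intro len_null_imp_null gm y) simp
qed

text \<open>By \<open>1 + v \<le> exp v\<close> a partial product is at most the exponential of the
  whole sum.\<close>

lemma bounded_prods_summable:
  assumes "\<And>j. 1 \<le> j \<Longrightarrow> 0 \<le> v j" "v summable_on {1..}"
  shows "bounded_prods (\<lambda>j. 1 + v j)"
proof -
  have "(\<Prod>j\<in>J. 1 + v j) \<le> exp (infsum v {1..})" if J: "finite J" "J \<subseteq> {1..}" for J
  proof -
    have "(\<Prod>j\<in>J. 1 + v j) \<le> (\<Prod>j\<in>J. exp (v j))"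
      using J(2) assms(1) by (intro prod_mono conjI exp_ge_add_one_self) force
    also have "\<dots> = exp (sum v J)" by (simp add: exp_sum[OF J(1)])
    also have "\<dots> \<le> exp (infsum v {1..})"
      using finite_sum_le_infsum[OF assms(2) J] assms(1) by simp
    finally show ?thesis .
  qed
  moreover have "1 \<le> 1 + v j" if "1 \<le> j" for j using assms(1)[OF that] by simp
  ultimately show ?thesis unfolding bounded_prods_def by (meson exp_ge_zero)
qed

text \<open>The target norm need not dominate the source norm in any factor, which is why the
  coordinates serve as separating functionals. The tail functional is the coordinate at 0, which has
  norm at most 1 on the target because \<open>\<beta>' j 0 = 1\<close>.\<close>

lemma diag_embeds:
  assumes K: "K = \<real> \<or> K = UNIV"
    and V: "tensor_factors u V \<phi> (\<lambda>j. wl2 (\<beta> j)) (\<lambda>j. diag (\<beta> j))"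
    and W: "tensor_factors u W \<phi> (\<lambda>j. wl2 (\<beta>' j)) (\<lambda>j. diag (\<beta>' j))"
    and sub: "\<And>j. 1 \<le> j \<Longrightarrow> carr (V j) \<subseteq> carr (W j)"
    and pos: "\<And>j \<nu>. 1 \<le> j \<Longrightarrow> 0 < \<beta> j \<nu>" "\<And>j \<nu>. 1 \<le> j \<Longrightarrow> 0 < \<beta>' j \<nu>"
    and one: "\<And>j. 1 \<le> j \<Longrightarrow> \<beta> j 0 = 1" "\<And>j. 1 \<le> j \<Longrightarrow> \<beta>' j 0 = 1"
    and u: "\<phi> u = (\<lambda>\<nu>. if \<nu> = 0 then 1 else 0)"
    and C: "\<And>j \<nu>. 1 \<le> j \<Longrightarrow> \<beta>' j \<nu> \<le> C j * \<beta> j \<nu>" "bounded_prods C"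
  shows "tensor_embeds K u V W"
proof (rule tensor_embedsI[OF K V W sub _ _ C(2) _ bounded_prods_one,
      where Z = "\<lambda>j. range (\<lambda>\<nu> x. x \<nu>)"])
  fix j :: nat assume j: "1 \<le> j"
  have nn: "0 \<le> \<beta> j \<nu>" "0 \<le> \<beta>' j \<nu>" for \<nu> using pos[OF j] less_imp_le by blast+
  have mem: "x \<in> wl2 (\<beta>' j)" if "x \<in> wl2 (\<beta> j)" for x
    by (rule wl2_mono[OF that nn(2) C(1)[OF j]])
  then show "wl2 (\<beta> j) \<subseteq> wl2 (\<beta>' j)" by blast
  show "separating (wl2 (\<beta> j)) (diag (\<beta> j)) (range (\<lambda>\<nu> x. x \<nu>))"
    by (rule separating_coords[OF pos(1)[OF j]])
  fix x assume x: "x \<in> wl2 (\<beta> j)"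
  show "Re (diag (\<beta>' j) x x) \<le> C j * Re (diag (\<beta> j) x x)"
  proof -
    have "(\<Sum>\<^sub>\<infinity>\<nu>. \<beta>' j \<nu> * (cmod (x \<nu>))\<^sup>2) \<le> (\<Sum>\<^sub>\<infinity>\<nu>. C j * (\<beta> j \<nu> * (cmod (x \<nu>))\<^sup>2))"
      using wl2_D[OF mem[OF x]] summable_on_cmult_right[OF wl2_D[OF x]]
      by (rule infsum_mono) (use mult_right_mono[OF C(1)[OF j]] in \<open>simp add: mult.assoc[symmetric]\<close>)
    then show ?thesis by (simp add: diag_self x mem infsum_cmult_right')
  qed
  have "diag (\<beta> j) x (\<phi> u) = (\<Sum>\<^sub>\<infinity>\<nu>\<in>{0}. of_real (\<beta> j \<nu>) * x \<nu> * cnj (\<phi> u \<nu>))"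
    unfolding diag_def using u by (intro infsum_cong_neutral) auto
  then have "diag (\<beta> j) x (\<phi> u) = x 0" using u one(1)[OF j] by simp
  then show "(cmod (diag (\<beta> j) x (\<phi> u)))\<^sup>2 \<le> 1 * Re (diag (\<beta>' j) x x)"
    using diag_coord[OF nn(2) mem[OF x], of 0] one(2)[OF j] by simp
next
  fix j :: nat and l :: "(nat \<Rightarrow> complex) \<Rightarrow> complex"
  assume j: "1 \<le> j" and "l \<in> range (\<lambda>\<nu> x. x \<nu>)"
  then obtain \<nu> where l: "l = (\<lambda>x. x \<nu>)" by blast
  have nn: "0 \<le> \<beta>' j \<nu>" for \<nu> using pos[OF j] less_imp_le by blast
  have "(cmod (x \<nu>))\<^sup>2 \<le> 1 / \<beta>' j \<nu> * Re (diag (\<beta>' j) x x)" if "x \<in> wl2 (\<beta> j)" for x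
    using diag_coord[OF nn wl2_mono[OF that nn C(1)[OF j]], of \<nu>] pos(2)[OF j, of \<nu>]
    by (simp add: field_simps)
  moreover have "linear_on (wl2 (\<beta> j)) l" unfolding l by (rule linear_onI) auto
  ultimately show "bounded_on (wl2 (\<beta> j)) (diag (\<beta>' j)) l"
    unfolding bounded_on_def l using nn[of \<nu>] by (intro conjI exI[of _ "1 / \<beta>' j \<nu>"]) auto
qed

section \<open>Rank one perturbations of the weights\<close>

definition pform ::
  "(nat \<Rightarrow> real) \<Rightarrow> ((nat \<Rightarrow> complex) \<Rightarrow> complex) \<Rightarrow> real \<Rightarrow>
    (nat \<Rightarrow> complex) \<Rightarrow> (nat \<Rightarrow> complex) \<Rightarrow> complex" where
  "pform \<beta> l w x y = l x * cnj (l y) + of_real w * diag \<beta> x y"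

lemma pform_self: "Re (pform \<beta> l w x x) = (cmod (l x))\<^sup>2 + w * Re (diag \<beta> x x)"
  by (simp add: pform_def complex_norm_square[symmetric] del: of_real_power)

lemma herm_form_pform:
  assumes "\<And>\<nu>. 0 \<le> \<beta> \<nu>" "linear_on (wl2 \<beta>) l" "0 \<le> w"
  shows "herm_form (wl2 \<beta>) (pform \<beta> l w)"
proof -
  interpret D: herm_form "wl2 \<beta>" "diag \<beta>" by (rule herm_form_diag[OF assms(1)])
  show ?thesis
  proof
    fix x y assume xy: "x \<in> wl2 \<beta>" "y \<in> wl2 \<beta>"
    show "pform \<beta> l w y x = cnj (pform \<beta> l w x y)" by (simp add: pform_def D.herm[OF xy])
    fix z assume z: "z \<in> wl2 \<beta>"
    show "pform \<beta> l w (\<lambda>i. x i + y i) z = pform \<beta> l w x z + pform \<beta> l w y z"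
      by (simp add: pform_def D.add_left[OF xy z] linear_on_add[OF assms(2) xy] algebra_simps)
  next
    fix x z c assume xz: "x \<in> wl2 \<beta>" "z \<in> wl2 \<beta>"
    show "pform \<beta> l w (\<lambda>i. c * x i) z = c * pform \<beta> l w x z"
      by (simp add: pform_def D.scale_left[OF xz] linear_on_scale[OF assms(2) xz(1)] algebra_simps)
  next
    fix x assume x: "x \<in> wl2 \<beta>"
    show "0 \<le> Re (pform \<beta> l w x x)" unfolding pform_self using D.nonneg[OF x] assms(3) by simp
  qed (fact D.zero_mem D.add_mem D.scale_mem)+
qed

text \<open>Young's inequality
  \<open>(A + d)^2 \<le> (1 + \<delta>) A^2 + (1 + 1/\<delta>) d^2\<close>. The choice
  \<open>\<delta> = S / v\<close> gives \<open>(1 + 1/\<delta>) S = (1 + \<delta>) v\<close>, so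
  that the common factor \<open>1 + S / v\<close> can be taken out.\<close>

lemma norm_sq_perturb:
  assumes "(cmod (s - t))\<^sup>2 \<le> S * W" "0 < S" "0 < v"
  shows "(cmod s)\<^sup>2 \<le> (1 + S / v) * ((cmod t)\<^sup>2 + v * W)"
proof -
  let ?A = "cmod t" and ?d = "cmod (s - t)" and ?\<delta> = "S / v"
  have \<delta>: "0 < ?\<delta>" using assms by simp
  have "(cmod s)\<^sup>2 \<le> (?A + ?d)\<^sup>2"
    using norm_triangle_ineq[of t "s - t"] by (intro power_mono) auto
  also have "\<dots> \<le> (1 + ?\<delta>) * ?A\<^sup>2 + (1 + 1 / ?\<delta>) * ?d\<^sup>2"
  proof -
    have "0 \<le> (?\<delta> * ?A - ?d)\<^sup>2 / ?\<delta>" using \<delta> by (intro divide_nonneg_pos zero_le_power2)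
    also have "(?\<delta> * ?A - ?d)\<^sup>2 / ?\<delta> = ?\<delta> * ?A\<^sup>2 - 2 * ?A * ?d + ?d\<^sup>2 / ?\<delta>"
      using assms(2,3) by (simp add: power2_eq_square field_simps)
    finally show ?thesis by (simp add: power2_sum algebra_simps)
  qed
  also have "\<dots> \<le> (1 + ?\<delta>) * ?A\<^sup>2 + (1 + 1 / ?\<delta>) * (S * W)"
    using assms by (intro add_left_mono mult_left_mono) (auto intro!: add_nonneg_nonneg)
  also have "(1 + 1 / ?\<delta>) * (S * W) = (1 + ?\<delta>) * (v * W)"
    using assms(2,3) by (simp add: field_simps)
  finally show ?thesis by (simp add: algebra_simps)
qed

text \<open>Of the source weight \<open>w j\<close>, the share \<open>(1 - \<theta>) * w j\<close>
  pays for replacing \<open>l'\<close> by \<open>l\<close>, and the share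
  \<open>\<theta> * w j\<close> is left for the target. In the opposite direction only the tail
  functional \<open>l\<close> has to be bounded on the target, and there the weight
  \<open>\<theta> * w j\<close> pays.\<close>

lemma twisted_embeds:
  assumes K: "K = \<real> \<or> K = UNIV"
    and V: "tensor_factors u V \<phi> (\<lambda>j. wl2 \<beta>) (\<lambda>j. pform \<beta> l (w j))"
    and W: "tensor_factors u W \<phi> (\<lambda>j. wl2 \<beta>) (\<lambda>j. pform \<beta> l' (\<theta> * w j))"
    and sub: "\<And>j. 1 \<le> j \<Longrightarrow> carr (V j) \<subseteq> carr (W j)"
    and nn: "\<And>\<nu>. 0 \<le> \<beta> \<nu>"
    and lin: "linear_on (wl2 \<beta>) l" "linear_on (wl2 \<beta>) l'"
    and S: "0 < S" "\<And>x. x \<in> wl2 \<beta> \<Longrightarrow> (cmod (l x - l' x))\<^sup>2 \<le> S * Re (diag \<beta> x x)"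
    and w: "\<And>j. 1 \<le> j \<Longrightarrow> 0 < w j" "(\<lambda>j. 1 / w j) summable_on {1..}"
    and \<theta>: "0 < \<theta>" "\<theta> < 1"
    and u: "l (\<phi> u) = 1" "\<And>x. x \<in> wl2 \<beta> \<Longrightarrow> diag \<beta> x (\<phi> u) = 0"
  shows "tensor_embeds K u V W"
proof -
  interpret D: herm_form "wl2 \<beta>" "diag \<beta>" by (rule herm_form_diag[OF nn])
  have bp: "bounded_prods (\<lambda>j. 1 + c * (1 / w j))" if "0 \<le> c" for c
  proof (rule bounded_prods_summable)
    show "0 \<le> c * (1 / w j)" if "1 \<le> j" for j using w(1)[OF that] \<open>0 \<le> c\<close> by simp
    show "(\<lambda>j. c * (1 / w j)) summable_on {1..}" by (intro summable_on_cmult_right w(2))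
  qed
  show ?thesis
  proof (rule tensor_embedsI[OF K V W sub order_refl,
        where C = "\<lambda>j. 1 + S / (1 - \<theta>) * (1 / w j)" and C' = "\<lambda>j. 1 + S / \<theta> * (1 / w j)"
          and Z = "\<lambda>j. (\<lambda>y x. pform \<beta> l (w j) x y) ` wl2 \<beta>"])
    show "bounded_prods (\<lambda>j. 1 + S / (1 - \<theta>) * (1 / w j))" using S(1) \<theta> by (intro bp) simp
    show "bounded_prods (\<lambda>j. 1 + S / \<theta> * (1 / w j))" using S(1) \<theta> by (intro bp) simp
    fix j :: nat assume j: "1 \<le> j"
    note wj = w(1)[OF j]
    show "separating (wl2 \<beta>) (pform \<beta> l (w j)) ((\<lambda>y x. pform \<beta> l (w j) x y) ` wl2 \<beta>)"
      by (rule separating_dual)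
    fix x assume x: "x \<in> wl2 \<beta>"
    have W0: "0 \<le> Re (diag \<beta> x x)" by (rule D.nonneg[OF x])
    have S': "(cmod (l' x - l x))\<^sup>2 \<le> S * Re (diag \<beta> x x)" using S(2)[OF x] by (simp add: norm_minus_commute)
    show "Re (pform \<beta> l' (\<theta> * w j) x x) \<le> (1 + S / (1 - \<theta>) * (1 / w j)) * Re (pform \<beta> l (w j) x x)"
    proof -
      let ?c = "1 + S / (1 - \<theta>) * (1 / w j)"
      have c: "1 \<le> ?c" using S(1) \<theta> wj by simp
      have "(cmod (l' x))\<^sup>2 \<le> ?c * ((cmod (l x))\<^sup>2 + (1 - \<theta>) * w j * Re (diag \<beta> x x))"
        using norm_sq_perturb[OF S' S(1), of "(1 - \<theta>) * w j"] \<theta> wj by simp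
      moreover have "\<theta> * w j * Re (diag \<beta> x x) \<le> ?c * (\<theta> * w j * Re (diag \<beta> x x))"
        using mult_right_mono[OF c, of "\<theta> * w j * Re (diag \<beta> x x)"] W0 \<theta> wj by simp
      ultimately show ?thesis unfolding pform_self by (simp add: algebra_simps)
    qed
    show "(cmod (pform \<beta> l (w j) x (\<phi> u)))\<^sup>2 \<le> (1 + S / \<theta> * (1 / w j)) * Re (pform \<beta> l' (\<theta> * w j) x x)"
    proof -
      have "pform \<beta> l (w j) x (\<phi> u) = l x" using u(1) u(2)[OF x] by (simp add: pform_def)
      then show ?thesis
        using norm_sq_perturb[OF S(2)[OF x] S(1), of "\<theta> * w j"] \<theta> wj unfolding pform_self by simp
    qed
  next
    fix j :: nat and m assume j: "1 \<le> j" and "m \<in> (\<lambda>y x. pform \<beta> l (w j) x y) ` wl2 \<beta>"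
    then obtain y where y: "y \<in> wl2 \<beta>" "m = (\<lambda>x. pform \<beta> l (w j) x y)" by blast
    note wj = w(1)[OF j]
    interpret T: herm_form "wl2 \<beta>" "pform \<beta> l (w j)" by (rule herm_form_pform[OF nn lin(1) less_imp_le[OF wj]])
    \<comment> \<open>In a single factor the whole source norm is controlled by the target norm.
      This constant exceeds \<open>1 / \<theta>\<close> for every \<open>j\<close>, so it can only
      serve finitely many slots.\<close>
    have le: "Re (pform \<beta> l (w j) x x) \<le> (1 + S / (\<theta> * w j) + 1 / \<theta>) * Re (pform \<beta> l' (\<theta> * w j) x x)"
      if x: "x \<in> wl2 \<beta>" for x
    proof -
      have "(cmod (l x))\<^sup>2 \<le> (1 + S / (\<theta> * w j)) * Re (pform \<beta> l' (\<theta> * w j) x x)"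
        using norm_sq_perturb[OF S(2)[OF x] S(1), of "\<theta> * w j"] \<theta> wj unfolding pform_self by simp
      moreover have "w j * Re (diag \<beta> x x) \<le> 1 / \<theta> * Re (pform \<beta> l' (\<theta> * w j) x x)"
        unfolding pform_self using \<theta> by (simp add: field_simps)
      ultimately show ?thesis unfolding pform_self[of \<beta> l] by (simp only: ring_distribs)
    qed
    show "bounded_on (wl2 \<beta>) (pform \<beta> l' (\<theta> * w j)) m"
      unfolding y(2) by (rule T.bounded_on_left[where k' = "pform \<beta> l' (\<theta> * w j)", OF y(1) le]) (use S(1) \<theta> wj in auto)
  qed
qed


section \<open>Expansions in an orthonormal basis\<close>

lemma L2_fun_UNIV: "f \<in> L2_fun K M \<Longrightarrow> f \<in> L2_fun UNIV M"
  by (auto simp: L2_fun_def)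

lemma L2_integrable_mult:
  assumes "f \<in> L2_fun K M" "g \<in> L2_fun K' M"
  shows "integrable M (\<lambda>x. f x * cnj (g x))"
proof (rule Bochner_Integration.integrable_bound)
  show "integrable M (\<lambda>x. (cmod (f x))\<^sup>2 + (cmod (g x))\<^sup>2)"
    using assms by (intro Bochner_Integration.integrable_add) (auto simp: L2_fun_def)
  have fg [measurable]: "f \<in> borel_measurable M" "g \<in> borel_measurable M"
    using assms by (auto simp: L2_fun_def)
  have [measurable]: "(\<lambda>x. cnj (g x)) \<in> borel_measurable M"
    using measurable_compose[OF fg(2) borel_measurable_continuous_onI[OF continuous_on_cnj[OF continuous_on_id]]] .
  show "(\<lambda>x. f x * cnj (g x)) \<in> borel_measurable M" by measurable
  have "cmod (f x) * cmod (g x) \<le> (cmod (f x))\<^sup>2 + (cmod (g x))\<^sup>2" for x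
    using sum_squares_bound[of "cmod (f x)" "cmod (g x)"]
      mult_nonneg_nonneg[OF norm_ge_zero norm_ge_zero, of "f x" "g x"] by linarith
  then show "AE x in M. norm (f x * cnj (g x)) \<le> norm ((cmod (f x))\<^sup>2 + (cmod (g x))\<^sup>2)"
    by (simp add: norm_mult)
qed

lemma ip0_self: "Re (ip0 M f f) = (LINT x|M. (cmod (f x))\<^sup>2)"
  unfolding ip0_def complex_norm_square[symmetric] integral_complex_of_real by simp

lemma herm_form_ip0: "herm_form (L2_fun UNIV M) (ip0 M)"
proof
  show "(\<lambda>i. 0) \<in> L2_fun UNIV M" by (simp add: L2_fun_def)
next
  fix x y assume xy: "x \<in> L2_fun UNIV M" "y \<in> L2_fun UNIV M"
  have [measurable]: "x \<in> borel_measurable M" "y \<in> borel_measurable M"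
    using xy by (auto simp: L2_fun_def)
  have "integrable M (\<lambda>i. (cmod (x i + y i))\<^sup>2)"
  proof (rule Bochner_Integration.integrable_bound)
    show "integrable M (\<lambda>i. 2 * ((cmod (x i))\<^sup>2 + (cmod (y i))\<^sup>2))"
      using xy by (intro integrable_mult_right Bochner_Integration.integrable_add) (auto simp: L2_fun_def)
    have "(cmod (x i + y i))\<^sup>2 \<le> 2 * ((cmod (x i))\<^sup>2 + (cmod (y i))\<^sup>2)" for i
    proof -
      have "(cmod (x i + y i))\<^sup>2 \<le> (cmod (x i) + cmod (y i))\<^sup>2"
        by (intro power_mono norm_triangle_ineq) simp
      then show ?thesis
        using sum_squares_bound[of "cmod (x i)" "cmod (y i)"] by (simp add: power2_sum)
    qed
    then show "AE i in M. norm ((cmod (x i + y i))\<^sup>2) \<le> norm (2 * ((cmod (x i))\<^sup>2 + (cmod (y i))\<^sup>2))"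
      by (intro AE_I2) simp
  qed measurable
  then show "(\<lambda>i. x i + y i) \<in> L2_fun UNIV M" by (simp add: L2_fun_def)
next
  fix x c assume "x \<in> L2_fun UNIV M"
  then show "(\<lambda>i. c * x i) \<in> L2_fun UNIV M"
    by (auto simp: L2_fun_def norm_mult power_mult_distrib)
next
  fix x y z assume "x \<in> L2_fun UNIV M" "y \<in> L2_fun UNIV M" "z \<in> L2_fun UNIV M"
  then show "ip0 M (\<lambda>i. x i + y i) z = ip0 M x z + ip0 M y z"
    unfolding ip0_def
    by (subst Bochner_Integration.integral_add[symmetric]) (auto intro: L2_integrable_mult simp: ring_distribs)
next
  fix x z :: "'a \<Rightarrow> complex" and c
  show "ip0 M (\<lambda>i. c * x i) z = c * ip0 M x z"
    unfolding ip0_def by (simp add: mult.assoc)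
next
  fix x y
  show "ip0 M y x = cnj (ip0 M x y)"
    unfolding ip0_def Bochner_Integration.integral_cnj[symmetric] by (simp add: mult.commute)
next
  fix x
  show "0 \<le> Re (ip0 M x x)" unfolding ip0_self by simp
qed

definition fcoef :: "'d measure \<Rightarrow> (nat \<Rightarrow> 'd \<Rightarrow> complex) \<Rightarrow> ('d \<Rightarrow> complex) \<Rightarrow> nat \<Rightarrow> complex" where
  "fcoef M e f = (\<lambda>\<nu>. ip0 M f (e \<nu>))"

locale onb_L2 =
  fixes K :: "complex set" and M :: "'d measure" and e :: "nat \<Rightarrow> 'd \<Rightarrow> complex"
  assumes onb: "onb K M e"
begin

sublocale L: herm_form "L2_fun UNIV M" "ip0 M" by (rule herm_form_ip0)

lemma e_L2: "e \<nu> \<in> L2_fun K M"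
  using onb by (simp add: onb_def)

lemma e_L2_UNIV: "e \<nu> \<in> L2_fun UNIV M"
  by (rule L2_fun_UNIV[OF e_L2])

lemma e_orth: "ip0 M (e \<nu>) (e \<nu>') = (if \<nu> = \<nu>' then 1 else 0)"
  using onb by (simp add: onb_def)

lemma fcoef_e: "fcoef M e (e \<nu>) = (\<lambda>\<nu>'. if \<nu>' = \<nu> then 1 else 0)"
  by (auto simp: fcoef_def e_orth)

lemma ip0_e: "g \<in> L2_fun UNIV M \<Longrightarrow> ip0 M (e \<nu>) g = cnj (fcoef M e g \<nu>)"
  unfolding fcoef_def by (rule L.herm[OF _ e_L2_UNIV])

section \<open>Fourier partial sums, Bessel's inequality and Parseval's identity\<close>

lemma partial_sum_mem: "(\<lambda>x. \<Sum>\<nu>\<in>A. c \<nu> * e \<nu> x) \<in> L2_fun UNIV M"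
  by (intro L.sum_mem e_L2_UNIV)

lemma ip0_partial_sum: "g \<in> L2_fun UNIV M \<Longrightarrow> ip0 M (\<lambda>x. \<Sum>\<nu>\<in>A. c \<nu> * e \<nu> x) g = (\<Sum>\<nu>\<in>A. c \<nu> * cnj (fcoef M e g \<nu>))"
  by (subst L.sum_left[OF e_L2_UNIV]) (simp_all add: ip0_e)

lemma ip0_partial_sum_self:
  assumes "finite A"
  shows "ip0 M (\<lambda>x. \<Sum>\<nu>\<in>A. c \<nu> * e \<nu> x) (\<lambda>x. \<Sum>\<nu>\<in>A. c \<nu> * e \<nu> x) = of_real (\<Sum>\<nu>\<in>A. (cmod (c \<nu>))\<^sup>2)"
proof -
  have "ip0 M (\<lambda>x. \<Sum>\<nu>\<in>A. c \<nu> * e \<nu> x) (\<lambda>x. \<Sum>\<nu>\<in>A. c \<nu> * e \<nu> x)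
      = (\<Sum>\<nu>\<in>A. \<Sum>\<nu>'\<in>A. c \<nu> * cnj (c \<nu>') * (if \<nu> = \<nu>' then 1 else 0))"
    unfolding e_orth[symmetric] by (rule L.sum_sum[OF e_L2_UNIV])
  also have "\<dots> = (\<Sum>\<nu>\<in>A. c \<nu> * cnj (c \<nu>))"
    using assms by (simp add: if_distrib[of "(*) _"] cong: if_cong)
  finally show ?thesis by (simp only: of_real_sum complex_norm_square)
qed

text \<open>Completing the square in each coefficient. It contains Bessel's inequality (with
  \<open>c\<close> the Fourier coefficients) and the best approximation property.\<close>

lemma dist_partial_sum:
  assumes f: "f \<in> L2_fun UNIV M" and "finite A"
  shows "(L.len (\<lambda>x. f x - (\<Sum>\<nu>\<in>A. c \<nu> * e \<nu> x)))\<^sup>2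
    = Re (ip0 M f f) - (\<Sum>\<nu>\<in>A. (cmod (fcoef M e f \<nu>))\<^sup>2) + (\<Sum>\<nu>\<in>A. (cmod (fcoef M e f \<nu> - c \<nu>))\<^sup>2)"
proof -
  let ?q = "\<lambda>x. \<Sum>\<nu>\<in>A. c \<nu> * e \<nu> x"
  have q: "?q \<in> L2_fun UNIV M" by (rule partial_sum_mem)
  note d = L.diff_mem[OF f q]
  have fq: "ip0 M f ?q = (\<Sum>\<nu>\<in>A. cnj (c \<nu>) * fcoef M e f \<nu>)"
    using L.herm[OF q f] ip0_partial_sum[OF f, of c A] by simp
  have "(L.len (\<lambda>x. f x - ?q x))\<^sup>2 = Re (ip0 M f f - ip0 M f ?q - (ip0 M ?q f - ip0 M ?q ?q))"
    using L.len_sq[OF d] L.diff_left[OF f q d] L.diff_right[OF f q f] L.diff_right[OF f q q] by simp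
  also have "\<dots> = Re (ip0 M f f) - (\<Sum>\<nu>\<in>A. Re (cnj (c \<nu>) * fcoef M e f \<nu>))
      - (\<Sum>\<nu>\<in>A. Re (c \<nu> * cnj (fcoef M e f \<nu>))) + (\<Sum>\<nu>\<in>A. (cmod (c \<nu>))\<^sup>2)"
    unfolding fq ip0_partial_sum[OF f] ip0_partial_sum_self[OF assms(2)] by (simp add: Re_sum)
  also have "\<dots> = Re (ip0 M f f) - (\<Sum>\<nu>\<in>A. (cmod (fcoef M e f \<nu>))\<^sup>2)
      + (\<Sum>\<nu>\<in>A. (cmod (fcoef M e f \<nu>))\<^sup>2 - Re (cnj (c \<nu>) * fcoef M e f \<nu>)
        - Re (c \<nu> * cnj (fcoef M e f \<nu>)) + (cmod (c \<nu>))\<^sup>2)"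
    by (simp only: sum_subtractf sum.distrib)
  also have "(\<lambda>\<nu>. (cmod (fcoef M e f \<nu>))\<^sup>2 - Re (cnj (c \<nu>) * fcoef M e f \<nu>)
        - Re (c \<nu> * cnj (fcoef M e f \<nu>)) + (cmod (c \<nu>))\<^sup>2) = (\<lambda>\<nu>. (cmod (fcoef M e f \<nu> - c \<nu>))\<^sup>2)"
    unfolding cmod_power2 by (intro ext) (simp add: power2_eq_square algebra_simps)
  finally show ?thesis .
qed

text \<open>\<open>onb\<close> only promises some approximating combination; the Fourier partial sum
  of the same or greater order is at least as close.\<close>

lemma partial_sums_converge:
  assumes f: "f \<in> L2_fun K M"
  shows "(\<lambda>n. L.len (\<lambda>x. f x - (\<Sum>\<nu><n. fcoef M e f \<nu> * e \<nu> x))) \<longlonglongrightarrow> 0"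
proof (rule LIMSEQ_I)
  fix \<epsilon> :: real assume e: "\<epsilon> > 0"
  have f': "f \<in> L2_fun UNIV M" using f by (rule L2_fun_UNIV)
  obtain n c where nc: "nrm (L2_space K M) (\<lambda>x. f x - (\<Sum>\<nu><n. c \<nu> * e \<nu> x)) < \<epsilon>"
    using onb f e unfolding onb_def by meson
  have "L.len (\<lambda>x. f x - (\<Sum>\<nu><m. fcoef M e f \<nu> * e \<nu> x)) < \<epsilon>" if "m \<ge> n" for m
  proof -
    have "(\<Sum>\<nu><n. (cmod (fcoef M e f \<nu>))\<^sup>2) \<le> (\<Sum>\<nu><m. (cmod (fcoef M e f \<nu>))\<^sup>2)"
      using that by (intro sum_mono2) auto
    moreover have "0 \<le> (\<Sum>\<nu><n. (cmod (fcoef M e f \<nu> - c \<nu>))\<^sup>2)" by (rule sum_nonneg) simp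
    ultimately have "(L.len (\<lambda>x. f x - (\<Sum>\<nu><m. fcoef M e f \<nu> * e \<nu> x)))\<^sup>2
        \<le> (L.len (\<lambda>x. f x - (\<Sum>\<nu><n. c \<nu> * e \<nu> x)))\<^sup>2"
      unfolding dist_partial_sum[OF f' finite_lessThan] by simp
    then have "L.len (\<lambda>x. f x - (\<Sum>\<nu><m. fcoef M e f \<nu> * e \<nu> x))
        \<le> L.len (\<lambda>x. f x - (\<Sum>\<nu><n. c \<nu> * e \<nu> x))"
      by (rule power2_le_imp_le) (intro L.len_nonneg L.diff_mem f' partial_sum_mem)
    also have "\<dots> < \<epsilon>" using nc by (simp add: nrm_def L2_space_def L.len_def)
    finally show ?thesis .
  qed
  then show "\<exists>no. \<forall>m\<ge>no. norm (L.len (\<lambda>x. f x - (\<Sum>\<nu><m. fcoef M e f \<nu> * e \<nu> x)) - 0) < \<epsilon>"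
    using L.len_nonneg[OF L.diff_mem[OF f' partial_sum_mem]] by (intro exI[of _ n]) simp
qed

text \<open>Bessel's inequality bounds all finite sums of squared coefficients.\<close>

lemma fcoef_wl2_one:
  assumes f: "f \<in> L2_fun K M"
  shows "fcoef M e f \<in> wl2 (\<lambda>_. 1)"
proof -
  have f': "f \<in> L2_fun UNIV M" using f by (rule L2_fun_UNIV)
  have "(\<Sum>\<nu>\<in>A. (cmod (fcoef M e f \<nu>))\<^sup>2) \<le> Re (ip0 M f f)" if "finite A" for A
    using dist_partial_sum[OF f' that, of "fcoef M e f"]
      zero_le_power2[of "L.len (\<lambda>x. f x - (\<Sum>\<nu>\<in>A. fcoef M e f \<nu> * e \<nu> x))"] by simp
  then have "bdd_above (sum (\<lambda>\<nu>. (cmod (fcoef M e f \<nu>))\<^sup>2) ` {A. A \<subseteq> UNIV \<and> finite A})"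
    by (intro bdd_aboveI2[of _ _ "Re (ip0 M f f)"]) simp
  then show ?thesis unfolding wl2_def by (simp add: nonneg_bdd_above_summable_on)
qed

lemma Parseval:
  assumes f: "f \<in> L2_fun K M" and g: "g \<in> L2_fun K M"
  shows "ip0 M f g = diag (\<lambda>_. 1) (fcoef M e f) (fcoef M e g)"
proof -
  have f': "f \<in> L2_fun UNIV M" and g': "g \<in> L2_fun UNIV M" using f g by (auto intro: L2_fun_UNIV)
  let ?P = "\<lambda>n x. \<Sum>\<nu><n. fcoef M e f \<nu> * e \<nu> x"
  have "(\<lambda>n. ip0 M (\<lambda>x. f x - ?P n x) g) \<longlonglongrightarrow> 0"
    by (rule L.len_null_imp_null[OF L.diff_mem[OF f' partial_sum_mem] g' partial_sums_converge[OF f]])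
  moreover have "ip0 M (\<lambda>x. f x - ?P n x) g = ip0 M f g - (\<Sum>\<nu><n. fcoef M e f \<nu> * cnj (fcoef M e g \<nu>))" for n
    unfolding L.diff_left[OF f' partial_sum_mem g'] ip0_partial_sum[OF g'] ..
  ultimately have "(\<lambda>n. ip0 M f g - (\<Sum>\<nu><n. fcoef M e f \<nu> * cnj (fcoef M e g \<nu>))) \<longlonglongrightarrow> 0" by simp
  from tendsto_diff[OF tendsto_const[of "ip0 M f g"] this]
  have 1: "(\<lambda>n. \<Sum>\<nu><n. fcoef M e f \<nu> * cnj (fcoef M e g \<nu>)) \<longlonglongrightarrow> ip0 M f g" by simp
  have "(\<lambda>\<nu>. of_real 1 * fcoef M e f \<nu> * cnj (fcoef M e g \<nu>)) summable_on UNIV"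
    by (rule diag_summable[OF _ fcoef_wl2_one[OF f] fcoef_wl2_one[OF g]]) simp
  then have "(\<lambda>\<nu>. fcoef M e f \<nu> * cnj (fcoef M e g \<nu>)) sums diag (\<lambda>_. 1) (fcoef M e f) (fcoef M e g)"
    unfolding diag_def by (intro has_sum_imp_sums) simp
  then show ?thesis using 1 LIMSEQ_unique unfolding sums_def by blast
qed

text \<open>By Fatou's lemma the partial sums \<open>S n\<close> satisfy \<open>\<parallel>S n\<parallel> \<le> liminf\<^sub>m \<parallel>S n - S m\<parallel>\<close> if they tend to
  zero pointwise, and the right-hand side is small for large \<open>n\<close>.\<close>

lemma pointwise_zero_imp_zero:
  assumes x: "x \<in> wl2 (\<lambda>_. 1)"
    and lim: "\<And>y. y \<in> space M \<Longrightarrow> (\<lambda>n. \<Sum>\<nu><n. x \<nu> * e \<nu> y) \<longlonglongrightarrow> 0"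
  shows "x = (\<lambda>_. 0)"
proof -
  let ?S = "\<lambda>n y. \<Sum>\<nu><n. x \<nu> * e \<nu> y"
  have [measurable]: "?S n \<in> borel_measurable M" for n
    using partial_sum_mem[where A = "{..<n}" and c = x] by (simp add: L2_fun_def)
  have norm: "(\<integral>\<^sup>+y. ennreal ((cmod (\<Sum>\<nu>\<in>A. x \<nu> * e \<nu> y))\<^sup>2) \<partial>M) = ennreal (\<Sum>\<nu>\<in>A. (cmod (x \<nu>))\<^sup>2)"
    if "finite A" for A
  proof -
    have "integrable M (\<lambda>y. (cmod (\<Sum>\<nu>\<in>A. x \<nu> * e \<nu> y))\<^sup>2)"
      using partial_sum_mem[where A = A and c = x] by (simp add: L2_fun_def)
    then have "(\<integral>\<^sup>+y. ennreal ((cmod (\<Sum>\<nu>\<in>A. x \<nu> * e \<nu> y))\<^sup>2) \<partial>M)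
        = ennreal (LINT y|M. (cmod (\<Sum>\<nu>\<in>A. x \<nu> * e \<nu> y))\<^sup>2)"
      by (intro nn_integral_eq_integral) auto
    also have "(LINT y|M. (cmod (\<Sum>\<nu>\<in>A. x \<nu> * e \<nu> y))\<^sup>2) = (\<Sum>\<nu>\<in>A. (cmod (x \<nu>))\<^sup>2)"
      unfolding ip0_self[symmetric] ip0_partial_sum_self[OF that] by simp
    finally show ?thesis .
  qed
  have summ: "(\<lambda>\<nu>. (cmod (x \<nu>))\<^sup>2) summable_on UNIV" using wl2_D[OF x] by simp
  define Q where "Q = (\<Sum>\<^sub>\<infinity>\<nu>. (cmod (x \<nu>))\<^sup>2)"
  have Q: "(\<lambda>n. \<Sum>\<nu><n. (cmod (x \<nu>))\<^sup>2) \<longlonglongrightarrow> Q"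
    using has_sum_imp_sums[OF has_sum_infsum[OF summ]] by (simp add: Q_def sums_def)
  have tail: "(\<Sum>\<nu><n. (cmod (x \<nu>))\<^sup>2) \<le> Q - (\<Sum>\<nu><n. (cmod (x \<nu>))\<^sup>2)" for n
  proof -
    have "(\<integral>\<^sup>+y. ennreal ((cmod (?S n y))\<^sup>2) \<partial>M)
        = (\<integral>\<^sup>+y. liminf (\<lambda>m. ennreal ((cmod (?S m y - ?S n y))\<^sup>2)) \<partial>M)"
    proof (rule nn_integral_cong)
      fix y assume "y \<in> space M"
      have "(\<lambda>m. ennreal ((cmod (?S m y - ?S n y))\<^sup>2)) \<longlonglongrightarrow> ennreal ((cmod (0 - ?S n y))\<^sup>2)"
        by (intro tendsto_intros lim \<open>y \<in> space M\<close>)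
      from lim_imp_Liminf[OF _ this] show "ennreal ((cmod (?S n y))\<^sup>2) = liminf (\<lambda>m. ennreal ((cmod (?S m y - ?S n y))\<^sup>2))"
        by (simp only: trivial_limit_sequentially not_False_eq_True diff_0 norm_minus_cancel)
    qed
    also have "\<dots> \<le> liminf (\<lambda>m. \<integral>\<^sup>+y. ennreal ((cmod (?S m y - ?S n y))\<^sup>2) \<partial>M)"
      by (intro nn_integral_liminf) measurable
    also have "\<dots> = ennreal (Q - (\<Sum>\<nu><n. (cmod (x \<nu>))\<^sup>2))"
    proof (rule lim_imp_Liminf)
      have "(\<lambda>m. ennreal ((\<Sum>\<nu><m. (cmod (x \<nu>))\<^sup>2) - (\<Sum>\<nu><n. (cmod (x \<nu>))\<^sup>2)))
          \<longlonglongrightarrow> ennreal (Q - (\<Sum>\<nu><n. (cmod (x \<nu>))\<^sup>2))"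
        by (intro tendsto_ennrealI tendsto_diff Q tendsto_const)
      moreover have "\<forall>\<^sub>F m in sequentially. ennreal ((\<Sum>\<nu><m. (cmod (x \<nu>))\<^sup>2) - (\<Sum>\<nu><n. (cmod (x \<nu>))\<^sup>2))
          = (\<integral>\<^sup>+y. ennreal ((cmod (?S m y - ?S n y))\<^sup>2) \<partial>M)"
      proof (rule eventually_sequentiallyI[of n])
        fix m assume "n \<le> m"
        then have split: "sum h {..<m} - sum h {..<n} = sum h {n..<m}" for h :: "nat \<Rightarrow> 'z :: ab_group_add"
          using sum.atLeastLessThan_concat[of 0 n m h] by (simp add: lessThan_atLeast0 algebra_simps)
        show "ennreal ((\<Sum>\<nu><m. (cmod (x \<nu>))\<^sup>2) - (\<Sum>\<nu><n. (cmod (x \<nu>))\<^sup>2))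
            = (\<integral>\<^sup>+y. ennreal ((cmod (?S m y - ?S n y))\<^sup>2) \<partial>M)"
          unfolding split by (simp add: norm)
      qed
      ultimately show "(\<lambda>m. \<integral>\<^sup>+y. ennreal ((cmod (?S m y - ?S n y))\<^sup>2) \<partial>M)
          \<longlonglongrightarrow> ennreal (Q - (\<Sum>\<nu><n. (cmod (x \<nu>))\<^sup>2))"
        by (rule Lim_transform_eventually)
    qed simp
    finally have "ennreal (\<Sum>\<nu><n. (cmod (x \<nu>))\<^sup>2) \<le> ennreal (Q - (\<Sum>\<nu><n. (cmod (x \<nu>))\<^sup>2))"
      by (simp add: norm)
    moreover have "(\<Sum>\<nu><n. (cmod (x \<nu>))\<^sup>2) \<le> Q"
      unfolding Q_def by (rule finite_sum_le_infsum[OF summ]) auto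
    ultimately show ?thesis by (simp add: ennreal_le_iff)
  qed
  \<comment> \<open>Letting \<open>n\<close> tend to infinity in \<open>tail\<close> makes both
    sides converge, the left one to the full sum and the right one to zero.\<close>
  have "Q \<le> Q - Q" by (rule LIMSEQ_le[OF Q tendsto_diff[OF tendsto_const Q]]) (use tail in blast)
  then have "Q \<le> 0" by simp
  have "(cmod (x \<nu>))\<^sup>2 \<le> Q" for \<nu>
    using finite_sum_le_infsum[OF summ, of "{\<nu>}"] by (simp add: Q_def)
  then have "(cmod (x \<nu>))\<^sup>2 \<le> 0" for \<nu> using \<open>Q \<le> 0\<close> order_trans by blast
  then show ?thesis by (intro ext) simp
qed

end

section \<open>The spaces of the theorem\<close>

lemma wl2_scale:
  assumes "0 < v"
  shows "wl2 (\<lambda>\<nu>. v * \<beta> \<nu>) = wl2 \<beta>"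
  using assms by (simp add: wl2_def mult.assoc summable_on_cmult_right')

lemma diag_scale: "diag (\<lambda>\<nu>. v * \<beta> \<nu>) x y = of_real v * diag \<beta> x y"
  unfolding diag_def infsum_cmult_right'[symmetric] by (simp add: mult.assoc)

locale weighted_L2 = onb_L2 K M e
  for K :: "complex set" and M :: "'d measure" and e :: "nat \<Rightarrow> 'd \<Rightarrow> complex" +
  fixes \<alpha> :: "nat \<Rightarrow> nat \<Rightarrow> real" and a :: 'd
  assumes K: "K = \<real> \<or> K = UNIV"
    and e0: "\<And>x. x \<in> space M \<Longrightarrow> e 0 x = 1"
    and \<alpha>: "\<And>\<nu> j. 1 \<le> \<nu> \<Longrightarrow> 1 \<le> j \<Longrightarrow> max (\<alpha> \<nu> 1) (\<alpha> 1 j) \<le> \<alpha> \<nu> j"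
    and \<alpha>11: "1 < \<alpha> 1 1"
    and a: "a \<in> space M"
    and rkhs: "G_is_rkhs M e \<alpha>"
begin

abbreviation "\<phi> \<equiv> fcoef M e"
abbreviation "C1 \<equiv> H_set K M e \<alpha> 1"

text \<open>Index 0 is overwritten because the hypotheses do not constrain
  \<open>\<alpha> 0 j\<close>. The value 0 makes the coefficients of \<open>e 0\<close> a null
  vector of \<open>diag wt\<close>.\<close>

definition wt :: "nat \<Rightarrow> real" where "wt = (\<lambda>\<nu>. \<alpha> \<nu> 1)(0 := 0)"

lemma \<alpha>_ge:
  assumes "1 \<le> \<nu>" "1 \<le> j"
  shows "\<alpha> \<nu> 1 \<le> \<alpha> \<nu> j" "\<alpha> 1 j \<le> \<alpha> \<nu> j" "1 < \<alpha> \<nu> 1" "1 < \<alpha> \<nu> j"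
  using \<alpha>[OF assms] \<alpha>[of \<nu> 1] \<alpha>11 assms by auto

lemma wt_nonneg: "0 \<le> wt \<nu>"
  using \<alpha>_ge(3)[of \<nu> 1] by (cases "\<nu> = 0") (simp_all add: wt_def)

sublocale D: herm_form "wl2 wt" "diag wt"
  by (rule herm_form_diag[OF wt_nonneg])

lemma wl2_wt: "wl2 wt = wl2 (\<lambda>\<nu>. \<alpha> \<nu> 1)"
  by (simp only: wt_def wl2_upd)

lemma compl_zero: "- {0} = {1::nat..}"
  by auto

lemma coef_wl2:
  assumes "f \<in> H_set K M e \<alpha> j"
  shows "\<phi> f \<in> wl2 (\<lambda>\<nu>. \<alpha> \<nu> j)"
  using assms summable_on_UNIV_remove[of "\<lambda>\<nu>. \<alpha> \<nu> j * (cmod (\<phi> f \<nu>))\<^sup>2" 0]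
  by (simp add: H_set_def wl2_def compl_zero fcoef_def)

lemma H_setI: "f \<in> L2_fun K M \<Longrightarrow> \<phi> f \<in> wl2 (\<lambda>\<nu>. \<alpha> \<nu> j) \<Longrightarrow> f \<in> H_set K M e \<alpha> j"
  using summable_on_UNIV_remove[of "\<lambda>\<nu>. \<alpha> \<nu> j * (cmod (\<phi> f \<nu>))\<^sup>2" 0]
  by (simp add: H_set_def wl2_def compl_zero fcoef_def)

lemma H_set_L2: "f \<in> H_set K M e \<alpha> j \<Longrightarrow> f \<in> L2_fun K M"
  by (simp add: H_set_def)

lemma H_set_mono:
  assumes "1 \<le> j"
  shows "H_set K M e \<alpha> j \<subseteq> C1"
proof
  fix f assume f: "f \<in> H_set K M e \<alpha> j"
  have "\<phi> f \<in> wl2 ((\<lambda>\<nu>. \<alpha> \<nu> j)(0 := 0))" using coef_wl2[OF f] by (simp only: wl2_upd)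
  then have "\<phi> f \<in> wl2 wt"
    by (rule wl2_mono[OF _ wt_nonneg, where C = 1]) (use \<alpha>_ge[OF _ assms] in \<open>auto simp: wt_def\<close>)
  then show "f \<in> C1" using H_setI[OF H_set_L2[OF f]] by (simp add: wl2_wt)
qed

lemma wsum_diag:
  assumes "g \<in> L2_fun K M"
  shows "wsum M e \<alpha> j f g = diag ((\<lambda>\<nu>. \<alpha> \<nu> j)(0 := 0)) (\<phi> f) (\<phi> g)"
  unfolding wsum_def diag_def ip0_e[OF L2_fun_UNIV[OF assms]] fcoef_def
  by (rule infsum_cong_neutral) auto

lemma e_mem: "e 0 \<in> C1"
proof (rule H_setI[OF e_L2])
  have "(\<lambda>\<nu>. \<alpha> \<nu> 1 * (cmod (\<phi> (e 0) \<nu>))\<^sup>2) summable_on {0}" by simp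
  then have "(\<lambda>\<nu>. \<alpha> \<nu> 1 * (cmod (\<phi> (e 0) \<nu>))\<^sup>2) summable_on UNIV"
    by (rule summable_on_cong_neutral[THEN iffD1, rotated -1]) (auto simp: fcoef_e)
  then show "\<phi> (e 0) \<in> wl2 (\<lambda>\<nu>. \<alpha> \<nu> 1)" by (simp add: wl2_def)
qed

lemma coef_unit: "diag \<beta> x (\<phi> (e 0)) = of_real (\<beta> 0) * x 0"
proof -
  have "diag \<beta> x (\<phi> (e 0)) = (\<Sum>\<^sub>\<infinity>\<nu>\<in>{0}. of_real (\<beta> \<nu>) * x \<nu> * cnj (\<phi> (e 0) \<nu>))"
    unfolding diag_def by (intro infsum_cong_neutral) (auto simp: fcoef_e)
  then show ?thesis by (simp add: fcoef_e)
qed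

lemma span01_coef:
  assumes "f \<in> span01 K e"
  shows "f \<in> L2_fun K M" "\<nu> \<noteq> 0 \<Longrightarrow> \<nu> \<noteq> 1 \<Longrightarrow> \<phi> f \<nu> = 0"
proof -
  obtain s t where f: "f = (\<lambda>x. s * e 0 x + t * e 1 x)" and st: "s \<in> K" "t \<in> K"
    using assms by (auto simp: span01_def)
  have m: "(\<lambda>x. s * e 0 x) \<in> L2_fun UNIV M" "(\<lambda>x. t * e 1 x) \<in> L2_fun UNIV M"
    using L.scale_mem e_L2_UNIV by blast+
  have "f \<in> L2_fun UNIV M" unfolding f by (rule L.add_mem[OF m])
  moreover have "f x \<in> K" if "x \<in> space M" for x
  proof -
    have "e 0 x \<in> K" "e 1 x \<in> K" using e_L2 that by (auto simp: L2_fun_def)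
    then show ?thesis using K st by (auto simp: f)
  qed
  ultimately show "f \<in> L2_fun K M" by (auto simp: L2_fun_def)
  show "\<phi> f \<nu> = 0" if "\<nu> \<noteq> 0" "\<nu> \<noteq> 1"
    unfolding f fcoef_def L.add_left[OF m e_L2_UNIV]
    using that L.scale_left[OF e_L2_UNIV e_L2_UNIV] by (simp add: e_orth)
qed

lemma span01_H:
  assumes "f \<in> span01 K e"
  shows "f \<in> H_set K M e \<alpha> j"
proof (rule H_setI[OF span01_coef(1)[OF assms]])
  have "(\<lambda>\<nu>. \<alpha> \<nu> j * (cmod (\<phi> f \<nu>))\<^sup>2) summable_on {0, 1}" by simp
  then have "(\<lambda>\<nu>. \<alpha> \<nu> j * (cmod (\<phi> f \<nu>))\<^sup>2) summable_on UNIV"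
    by (rule summable_on_cong_neutral[THEN iffD1, rotated -1]) (auto simp: span01_coef(2)[OF assms])
  then show "\<phi> f \<in> wl2 (\<lambda>\<nu>. \<alpha> \<nu> j)" by (simp add: wl2_def)
qed

lemma span01_diag:
  assumes "f \<in> span01 K e" "\<beta> 0 = 0"
  shows "diag \<beta> (\<phi> f) x = of_real (\<beta> 1) * \<phi> f 1 * cnj (x 1)"
proof -
  have "diag \<beta> (\<phi> f) x = (\<Sum>\<^sub>\<infinity>\<nu>\<in>{1}. of_real (\<beta> \<nu>) * \<phi> f \<nu> * cnj (x \<nu>))"
    unfolding diag_def
  proof (rule infsum_cong_neutral)
    show "of_real (\<beta> \<nu>) * \<phi> f \<nu> * cnj (x \<nu>) = 0" if "\<nu> \<in> UNIV - {1}" for \<nu>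
      using assms(2) span01_coef(2)[OF assms(1), of \<nu>] that by (cases "\<nu> = 0") auto
  qed auto
  then show ?thesis by simp
qed

lemma e_mem_span01: "e 0 \<in> span01 K e"
proof -
  have "(1::complex) \<in> K" "(0::complex) \<in> K" using K by auto
  then show ?thesis unfolding span01_def by (intro CollectI exI[of _ 1] exI[of _ 0]) auto
qed


subsection \<open>The weights\<close>

lemma gam_ge:
  assumes "1 \<le> \<nu>" "1 \<le> j"
  shows "\<alpha> \<nu> 1 / \<alpha> \<nu> j \<le> gam \<alpha> j"
  unfolding gam_def
proof (rule cSUP_upper)
  show "bdd_above ((\<lambda>\<nu>. \<alpha> \<nu> 1 / \<alpha> \<nu> j) ` {1..})"
  proof (rule bdd_aboveI2[of _ _ 1])
    fix \<nu> :: nat assume "\<nu> \<in> {1..}"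
    then show "\<alpha> \<nu> 1 / \<alpha> \<nu> j \<le> 1" using \<alpha>_ge[of \<nu> j] assms(2) by simp
  qed
qed (use assms in simp)

lemma gam_pos: "1 \<le> j \<Longrightarrow> 0 < gam \<alpha> j"
  using gam_ge[of 1 j] \<alpha>_ge[of 1 j] by (meson divide_pos_pos less_le_trans order_refl zero_less_one order.strict_trans)

text \<open>\<open>eval_vec y\<close> represents the evaluation at \<open>y\<close> with respect to the weights \<open>\<alpha> \<nu> 1\<close>.\<close>

definition eval_vec :: "'d \<Rightarrow> nat \<Rightarrow> complex" where
  "eval_vec y \<nu> = (if \<nu> = 0 then 1 else cnj (e \<nu> y) / of_real (\<alpha> \<nu> 1))"

text \<open>\<open>pt_val\<close> in coordinates, so that it can be applied to limits of coefficient
  sequences as well.\<close>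

definition pt_eval :: "'d \<Rightarrow> (nat \<Rightarrow> complex) \<Rightarrow> complex" where
  "pt_eval y x = (\<Sum>\<^sub>\<infinity>\<nu>. x \<nu> * e \<nu> y)"

section \<open>Point evaluations and the reproducing kernel hypothesis\<close>

lemma rkhs_summable:
  assumes "y \<in> {1..} \<rightarrow>\<^sub>E space M"
  shows "(\<lambda>(j, \<nu>). gam \<alpha> j / \<alpha> \<nu> 1 * (cmod (e \<nu> (y j)))\<^sup>2) summable_on {1..} \<times> {1..}"
  using rkhs assms summable_on_swap[of "\<lambda>(\<nu>, j). gam \<alpha> j / \<alpha> \<nu> 1 * (cmod (e \<nu> (y j)))\<^sup>2" "{1..}" "{1..}"]
  by (simp add: G_is_rkhs_def case_prod_unfold)

lemma rkhs_summable_inner: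
  assumes "y \<in> {1..} \<rightarrow>\<^sub>E space M" "1 \<le> j"
  shows "(\<lambda>\<nu>. gam \<alpha> j / \<alpha> \<nu> 1 * (cmod (e \<nu> (y j)))\<^sup>2) summable_on {1..}"
  using summable_on_SigmaD1[OF rkhs_summable[OF assms(1)]] assms(2) by simp

lemma eval_vec_weight: "1 \<le> \<nu> \<Longrightarrow> \<alpha> \<nu> 1 * (cmod (eval_vec y \<nu>))\<^sup>2 = (cmod (e \<nu> y))\<^sup>2 / \<alpha> \<nu> 1"
  using \<alpha>_ge(3)[of \<nu> 1] by (simp add: eval_vec_def norm_divide power_divide power2_eq_square)

lemma const_mem: "y \<in> space M \<Longrightarrow> (\<lambda>j. if 1 \<le> j then y else undefined) \<in> {1..} \<rightarrow>\<^sub>E space M"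
  by (auto simp: PiE_iff extensional_def)

lemma eval_vec_mem:
  assumes "y \<in> space M"
  shows "eval_vec y \<in> wl2 wt"
proof -
  \<comment> \<open>The row \<open>j = 1\<close> of the hypothesis for the constant sequence
    \<open>y\<close>, from which the positive factor \<open>gam \<alpha> 1\<close> is then
    removed.\<close>
  have "(\<lambda>\<nu>. gam \<alpha> 1 / \<alpha> \<nu> 1 * (cmod (e \<nu> y))\<^sup>2) summable_on {1..}"
    using rkhs_summable_inner[OF const_mem[OF assms], of 1] by simp
  then have "(\<lambda>\<nu>. 1 / gam \<alpha> 1 * (gam \<alpha> 1 / \<alpha> \<nu> 1 * (cmod (e \<nu> y))\<^sup>2)) summable_on {1..}"
    by (rule summable_on_cmult_right)
  also have "?this \<longleftrightarrow> (\<lambda>\<nu>. \<alpha> \<nu> 1 * (cmod (eval_vec y \<nu>))\<^sup>2) summable_on - {0}"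
    unfolding compl_zero using gam_pos[of 1] by (intro summable_on_cong) (simp add: eval_vec_weight del: One_nat_def)
  finally show ?thesis
    unfolding wl2_wt unfolding wl2_def mem_Collect_eq by (simp add: summable_on_UNIV_remove[of _ 0])
qed

text \<open>Since \<open>e 0 = 1\<close>, the zeroth coordinate splits off with coefficient 1 and
  the rest is an inner product for \<open>diag wt\<close>. Evaluations therefore differ from the
  zeroth coordinate, and from each other, by functionals bounded by this form.\<close>

lemma pt_eval_diag:
  assumes "x \<in> wl2 wt" "y \<in> space M"
  shows "pt_eval y x = x 0 + diag wt x (eval_vec y)"
proof -
  have eq: "of_real (((\<lambda>\<nu>. \<alpha> \<nu> 1)(0 := 1)) \<nu>) * x \<nu> * cnj (eval_vec y \<nu>) = x \<nu> * e \<nu> y" for \<nu>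
    using \<alpha>_ge(3)[of \<nu> 1] e0[OF assms(2)] by (cases "\<nu> = 0") (simp_all add: eval_vec_def)
  have "pt_eval y x = diag ((\<lambda>\<nu>. \<alpha> \<nu> 1)(0 := 1)) x (eval_vec y)" unfolding pt_eval_def diag_def eq ..
  also have "\<dots> = diag (wt(0 := 1)) x (eval_vec y)" by (simp add: wt_def)
  also have "\<dots> = of_real 1 * x 0 * cnj (eval_vec y 0) + diag (wt(0 := 0)) x (eval_vec y)"
    by (rule diag_split[OF wt_nonneg _ assms(1) eval_vec_mem[OF assms(2)]]) simp
  also have "wt(0 := 0) = wt" by (simp add: wt_def)
  finally have "pt_eval y x = of_real 1 * x 0 * cnj (eval_vec y 0) + diag wt x (eval_vec y)" .
  moreover have "eval_vec y 0 = 1" by (simp add: eval_vec_def)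
  ultimately show ?thesis by simp
qed

text \<open>Unconditional summability gives convergence in the natural order, the form in which
  \<open>pointwise_zero_imp_zero\<close> asks for it.\<close>

lemma pt_eval_sums:
  assumes "x \<in> wl2 wt" "y \<in> space M"
  shows "(\<lambda>n. \<Sum>\<nu><n. x \<nu> * e \<nu> y) \<longlonglongrightarrow> pt_eval y x"
proof -
  have eq: "of_real (((\<lambda>\<nu>. \<alpha> \<nu> 1)(0 := 1)) \<nu>) * x \<nu> * cnj (eval_vec y \<nu>) = x \<nu> * e \<nu> y" for \<nu>
    using \<alpha>_ge(3)[of \<nu> 1] e0[OF assms(2)] by (cases "\<nu> = 0") (simp_all add: eval_vec_def)
  have "(\<lambda>\<nu>. of_real (((\<lambda>\<nu>. \<alpha> \<nu> 1)(0 := 1)) \<nu>) * x \<nu> * cnj (eval_vec y \<nu>)) summable_on UNIV"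
  proof (rule diag_summable)
    show "0 \<le> ((\<lambda>\<nu>. \<alpha> \<nu> 1)(0 := 1)) \<nu>" for \<nu>
      using \<alpha>_ge(3)[of \<nu> 1] by (cases "\<nu> = 0") simp_all
    show "x \<in> wl2 ((\<lambda>\<nu>. \<alpha> \<nu> 1)(0 := 1))" "eval_vec y \<in> wl2 ((\<lambda>\<nu>. \<alpha> \<nu> 1)(0 := 1))"
      using assms(1) eval_vec_mem[OF assms(2)] by (simp_all only: wl2_upd wl2_wt)
  qed
  then show ?thesis unfolding eq pt_eval_def using has_sum_imp_sums[OF has_sum_infsum] sums_def by blast
qed

lemma linear_coord: "linear_on (wl2 \<beta>) (\<lambda>x. x 0)"
  by (rule linear_onI) auto

lemma linear_pt_eval:
  assumes "y \<in> space M"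
  shows "linear_on (wl2 wt) (pt_eval y)"
proof (rule linear_onI)
  note z = eval_vec_mem[OF assms]
  fix u v assume u: "u \<in> wl2 wt" and v: "v \<in> wl2 wt"
  show "pt_eval y (\<lambda>i. u i + v i) = pt_eval y u + pt_eval y v"
    by (simp add: pt_eval_diag assms u v D.add_mem D.add_left z)
next
  fix u c assume u: "u \<in> wl2 wt"
  show "pt_eval y (\<lambda>i. c * u i) = c * pt_eval y u"
    by (simp add: pt_eval_diag assms u D.scale_mem D.scale_left eval_vec_mem ring_distribs)
qed

lemma pt_eval_unit: "y \<in> space M \<Longrightarrow> pt_eval y (\<phi> (e 0)) = 1"
proof -
  assume y: "y \<in> space M"
  have "pt_eval y (\<phi> (e 0)) = (\<Sum>\<^sub>\<infinity>\<nu>\<in>{0}. \<phi> (e 0) \<nu> * e \<nu> y)"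
    unfolding pt_eval_def by (intro infsum_cong_neutral) (auto simp: fcoef_e)
  then show ?thesis by (simp add: fcoef_e e0[OF y])
qed

text \<open>The diagonal value at \<open>y\<close> of the reproducing kernel without its constant
  part.\<close>

definition eval_sq :: "'d \<Rightarrow> real" where
  "eval_sq y = Re (diag wt (eval_vec y) (eval_vec y))"

lemma eval_sq_eq:
  assumes "y \<in> space M"
  shows "eval_sq y = (\<Sum>\<^sub>\<infinity>\<nu>\<in>{1..}. (cmod (e \<nu> y))\<^sup>2 / \<alpha> \<nu> 1)"
  unfolding eval_sq_def diag_self[OF eval_vec_mem[OF assms]]
  by (rule infsum_cong_neutral) (auto simp: wt_def eval_vec_weight simp del: One_nat_def)

lemma eval_sq_nonneg: "y \<in> space M \<Longrightarrow> 0 \<le> eval_sq y"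
  unfolding eval_sq_def by (intro D.nonneg eval_vec_mem)

text \<open>Cauchy-Schwarz with \<open>eval_vec y\<close>. The summand 1 makes the constant strictly
  positive, as \<open>norm_sq_perturb\<close> requires; \<open>eval_sq y\<close> may vanish.\<close>

lemma pt_eval_coord_diff:
  assumes "x \<in> wl2 wt" "y \<in> space M"
  shows "(cmod (x 0 - pt_eval y x))\<^sup>2 \<le> (eval_sq y + 1) * Re (diag wt x x)"
proof -
  have "(cmod (x 0 - pt_eval y x))\<^sup>2 \<le> Re (diag wt x x) * eval_sq y"
    using D.Cauchy_Schwarz[OF assms(1) eval_vec_mem[OF assms(2)]] by (simp add: pt_eval_diag assms eval_sq_def)
  then show ?thesis using D.nonneg[OF assms(1)] by (simp add: algebra_simps)
qed

text \<open>The zeroth coordinates cancel, which leaves the inner product with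
  \<open>eval_vec y - eval_vec a\<close>; the factor 2 stems from squaring a sum of two
  lengths.\<close>

lemma pt_eval_diff:
  assumes x: "x \<in> wl2 wt" and y: "y \<in> space M"
  shows "(cmod (pt_eval y x - pt_eval a x))\<^sup>2 \<le> (2 * (eval_sq y + eval_sq a) + 1) * Re (diag wt x x)"
proof -
  note z = eval_vec_mem[OF y] eval_vec_mem[OF a]
  have W: "0 \<le> Re (diag wt x x)" by (rule D.nonneg[OF x])
  have "(D.len (\<lambda>i. eval_vec y i - eval_vec a i))\<^sup>2 \<le> (D.len (eval_vec y) + D.len (eval_vec a))\<^sup>2"
  proof (rule power_mono)
    have m: "(\<lambda>i. -1 * eval_vec a i) \<in> wl2 wt" using D.scale_mem[OF z(2), of "-1"] .
    show "D.len (\<lambda>i. eval_vec y i - eval_vec a i) \<le> D.len (eval_vec y) + D.len (eval_vec a)"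
      using D.len_add[OF z(1) m] D.len_scale[OF z(2), of "-1"] by simp
  qed (rule D.len_nonneg[OF D.diff_mem[OF z]])
  also have "\<dots> \<le> 2 * ((D.len (eval_vec y))\<^sup>2 + (D.len (eval_vec a))\<^sup>2)"
    using sum_squares_bound[of "D.len (eval_vec y)" "D.len (eval_vec a)"] by (simp add: power2_sum)
  finally have zz: "Re (diag wt (\<lambda>i. eval_vec y i - eval_vec a i) (\<lambda>i. eval_vec y i - eval_vec a i)) \<le> 2 * (eval_sq y + eval_sq a)"
    unfolding D.len_sq[OF D.diff_mem[OF z]] D.len_sq[OF z(1)] D.len_sq[OF z(2)] eval_sq_def .
  have "pt_eval y x - pt_eval a x = diag wt x (\<lambda>i. eval_vec y i - eval_vec a i)"
    by (simp add: pt_eval_diag x y a D.diff_right[OF z x])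
  then have "(cmod (pt_eval y x - pt_eval a x))\<^sup>2 \<le> Re (diag wt x x) * Re (diag wt (\<lambda>i. eval_vec y i - eval_vec a i) (\<lambda>i. eval_vec y i - eval_vec a i))"
    using D.Cauchy_Schwarz[OF x D.diff_mem[OF z]] by simp
  also have "\<dots> \<le> Re (diag wt x x) * (2 * (eval_sq y + eval_sq a))" by (rule mult_left_mono[OF zz W])
  finally show ?thesis using W by (simp add: algebra_simps)
qed

text \<open>The double series of the hypothesis, summed over \<open>\<nu>\<close> first.\<close>

lemma gam_eval_sq_summable:
  assumes "y \<in> {1..} \<rightarrow>\<^sub>E space M"
  shows "(\<lambda>j. gam \<alpha> j * eval_sq (y j)) summable_on {1..}"
proof -
  have "(\<lambda>j. \<Sum>\<^sub>\<infinity>\<nu>\<in>{1..}. gam \<alpha> j / \<alpha> \<nu> 1 * (cmod (e \<nu> (y j)))\<^sup>2) summable_on {1..}"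
    using summable_on_Sigma_banach[OF rkhs_summable[OF assms]] by simp
  also have "?this \<longleftrightarrow> ?thesis"
  proof (rule summable_on_cong)
    fix j :: nat assume "j \<in> {1..}"
    then have "y j \<in> space M" using assms by (auto simp: PiE_iff)
    then show "(\<Sum>\<^sub>\<infinity>\<nu>\<in>{1..}. gam \<alpha> j / \<alpha> \<nu> 1 * (cmod (e \<nu> (y j)))\<^sup>2) = gam \<alpha> j * eval_sq (y j)"
      unfolding eval_sq_eq[OF \<open>y j \<in> space M\<close>] infsum_cmult_right'[symmetric] by (simp add: field_simps)
  qed
  finally show ?thesis .
qed

text \<open>At a point \<open>y\<close> with \<open>e 1 y \<noteq> 0\<close> the number
  \<open>eval_sq y\<close> is positive and can be divided out of the series for the constant
  sequence \<open>y\<close>.\<close>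

lemma gam_summable: "gam \<alpha> summable_on {1..}"
proof -
  have "\<exists>y\<in>space M. e 1 y \<noteq> 0"
  proof (rule ccontr)
    assume "\<not> ?thesis"
    then have "ip0 M (e 1) (e 1) = (LINT x|M. 0)" unfolding ip0_def by (intro Bochner_Integration.integral_cong) auto
    then show False by (simp add: e_orth)
  qed
  then obtain y where y: "y \<in> space M" "e 1 y \<noteq> 0" by blast
  have c: "0 < (cmod (e 1 y))\<^sup>2 / \<alpha> 1 1" using y \<alpha>11 by simp
  have "(\<lambda>j. gam \<alpha> j * eval_sq y) summable_on {1..}"
    using gam_eval_sq_summable[OF const_mem[OF y(1)]] by (rule summable_on_cong[THEN iffD1, rotated]) simp
  then have "(\<lambda>j. 1 / eval_sq y * (gam \<alpha> j * eval_sq y)) summable_on {1..}" by (rule summable_on_cmult_right)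
  moreover have "0 < eval_sq y"
  proof -
    have "wt 1 * (cmod (eval_vec y 1))\<^sup>2 \<le> eval_sq y" unfolding eval_sq_def by (rule diag_coord[OF wt_nonneg eval_vec_mem[OF y(1)]])
    then show ?thesis using c eval_vec_weight[of 1 y] by (simp add: wt_def)
  qed
  ultimately show ?thesis by simp
qed


subsection \<open>Identification of the factors\<close>

lemma pform_factors:
  assumes C: "\<And>j. 1 \<le> j \<Longrightarrow> carr (V j) \<subseteq> C1" "\<And>j. 1 \<le> j \<Longrightarrow> e 0 \<in> carr (V j)"
    and w: "\<And>j. 1 \<le> j \<Longrightarrow> 0 < w j"
    and l: "linear_on (wl2 wt) l" "l (\<phi> (e 0)) = 1"
    and ip: "\<And>j f g. 1 \<le> j \<Longrightarrow> f \<in> carr (V j) \<Longrightarrow> g \<in> carr (V j) \<Longrightarrow> ip (V j) f g = pform wt l (w j) (\<phi> f) (\<phi> g)"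
  shows "tensor_factors (e 0) V \<phi> (\<lambda>j. wl2 wt) (\<lambda>j. pform wt l (w j))"
proof (rule tensor_factors.intro)
  fix j :: nat assume j: "1 \<le> j"
  show "herm_form (wl2 wt) (pform wt l (w j))" by (rule herm_form_pform[OF wt_nonneg l(1) less_imp_le[OF w[OF j]]])
  show "\<phi> f \<in> wl2 wt" if "f \<in> carr (V j)" for f
    using coef_wl2[of f 1] C(1)[OF j] that by (auto simp: wl2_wt)
  show "pform wt l (w j) (\<phi> (e 0)) (\<phi> (e 0)) = 1"
    by (simp add: pform_def l(2) coef_unit) (simp add: wt_def)
qed (use C(2) ip in auto)

lemma diag_factors:
  assumes C: "\<And>j. 1 \<le> j \<Longrightarrow> \<phi> ` carr (V j) \<subseteq> wl2 (\<beta> j)" "\<And>j. 1 \<le> j \<Longrightarrow> e 0 \<in> carr (V j)"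
    and \<beta>: "\<And>j \<nu>. 1 \<le> j \<Longrightarrow> 0 < \<beta> j \<nu>" "\<And>j. 1 \<le> j \<Longrightarrow> \<beta> j 0 = 1"
    and ip: "\<And>j f g. 1 \<le> j \<Longrightarrow> f \<in> carr (V j) \<Longrightarrow> g \<in> carr (V j) \<Longrightarrow> ip (V j) f g = diag (\<beta> j) (\<phi> f) (\<phi> g)"
  shows "tensor_factors (e 0) V \<phi> (\<lambda>j. wl2 (\<beta> j)) (\<lambda>j. diag (\<beta> j))"
proof (rule tensor_factors.intro)
  fix j :: nat assume j: "1 \<le> j"
  show "herm_form (wl2 (\<beta> j)) (diag (\<beta> j))" by (rule herm_form_diag[OF less_imp_le[OF \<beta>(1)[OF j]]])
  show "diag (\<beta> j) (\<phi> (e 0)) (\<phi> (e 0)) = 1" 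
    unfolding coef_unit \<beta>(2)[OF j] by (simp add: fcoef_e)
qed (use C ip in auto)

text \<open>With the zeroth coordinate as functional the twisted form is diagonal, so that the
  results on weighted sequence spaces apply to it.\<close>

lemma pform_coord_diag:
  assumes "0 < v" "x \<in> wl2 wt" "y \<in> wl2 wt"
  shows "pform wt (\<lambda>x. x 0) v x y = diag ((\<lambda>\<nu>. v * \<alpha> \<nu> 1)(0 := 1)) x y"
proof -
  have eq: "(\<lambda>\<nu>. v * wt \<nu>)(0 := b) = (\<lambda>\<nu>. v * \<alpha> \<nu> 1)(0 := b)" for b by (auto simp: wt_def)
  have m: "x \<in> wl2 (\<lambda>\<nu>. v * wt \<nu>)" "y \<in> wl2 (\<lambda>\<nu>. v * wt \<nu>)" using assms by (simp_all add: wl2_scale)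
  have "diag ((\<lambda>\<nu>. v * wt \<nu>)(0 := 1)) x y
      = of_real 1 * x 0 * cnj (y 0) + diag ((\<lambda>\<nu>. v * wt \<nu>)(0 := 0)) x y"
    by (rule diag_split[OF _ _ m]) (use assms(1) wt_nonneg in auto)
  moreover have "(\<lambda>\<nu>. v * wt \<nu>)(0 := 0) = (\<lambda>\<nu>. v * wt \<nu>)" by (auto simp: wt_def)
  ultimately show ?thesis by (simp add: pform_def diag_scale eq)
qed

end

text \<open>Exchanges the functional without lowering the weight. The constant stays above 2, which
  is harmless because it is used within one factor only.\<close>

lemma pform_comparison:
  assumes "(cmod (l x - l' x))\<^sup>2 \<le> S * Re (diag \<beta> x x)" "0 < S" "0 < v" "0 \<le> Re (diag \<beta> x x)"
  shows "Re (pform \<beta> l v x x) \<le> (2 + S / v) * Re (pform \<beta> l' v x x)"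
proof -
  have "(cmod (l x))\<^sup>2 \<le> (1 + S / v) * Re (pform \<beta> l' v x x)"
    using norm_sq_perturb[OF assms(1-3)] by (simp add: pform_self)
  moreover have "v * Re (diag \<beta> x x) \<le> 1 * Re (pform \<beta> l' v x x)" by (simp add: pform_self)
  ultimately show ?thesis unfolding pform_self[of \<beta> l] by (simp add: distrib_right)
qed

context weighted_L2
begin

text \<open>Over the weights \<open>\<alpha> \<nu> 1\<close> a vector with vanishing point evaluations is zero, because its expansion
  converges to zero pointwise; completeness carries this over to Cauchy sequences.\<close>

lemma separating_pt_eval:
  assumes v: "0 < v"
  shows "separating (wl2 wt) (pform wt (pt_eval a) v) (pt_eval ` space M)"
  unfolding separating_def
proof (intro allI impI ballI)
  interpret T: herm_form "wl2 wt" "pform wt (pt_eval a) v"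
    by (rule herm_form_pform[OF wt_nonneg linear_pt_eval[OF a] less_imp_le[OF v]])
  \<comment> \<open>An equivalent diagonal norm, for which completeness is known.\<close>
  define \<beta> where "\<beta> = (\<lambda>\<nu>. v * \<alpha> \<nu> 1)(0 := 1)"
  have pos: "0 < \<beta> \<nu>" for \<nu> using v \<alpha>_ge(3)[of \<nu> 1] by (cases "\<nu> = 0") (simp_all add: \<beta>_def)
  have wl: "wl2 \<beta> = wl2 wt" using v unfolding \<beta>_def wl2_upd by (simp add: wl2_scale wl2_wt)
  interpret N: herm_form "wl2 wt" "diag \<beta>"
    using herm_form_diag[of \<beta>, OF less_imp_le[OF pos]] by (simp only: wl)
  have N: "diag \<beta> x x = pform wt (\<lambda>x. x 0) v x x" if "x \<in> wl2 wt" for x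
    unfolding \<beta>_def by (rule pform_coord_diag[OF v that that, symmetric])
  have S: "0 < eval_sq y + 1" if "y \<in> space M" for y using eval_sq_nonneg[OF that] by simp
  have NT: "Re (diag \<beta> x x) \<le> (2 + (eval_sq a + 1) / v) * Re (pform wt (pt_eval a) v x x)" if "x \<in> wl2 wt" for x
    unfolding N[OF that] by (rule pform_comparison[where l = "\<lambda>x. x 0" and l' = "pt_eval a",
          OF pt_eval_coord_diff[OF that a] S[OF a] v D.nonneg[OF that]])
  have TN: "Re (pform wt (pt_eval a) v x x) \<le> (2 + (eval_sq a + 1) / v) * Re (diag \<beta> x x)" if "x \<in> wl2 wt" for x
    unfolding N[OF that]
    by (rule pform_comparison[where l = "pt_eval a" and l' = "\<lambda>x. x 0", OF _ S[OF a] v D.nonneg[OF that]])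
      (use pt_eval_coord_diff[OF that a] in \<open>simp add: norm_minus_commute\<close>)
  have c: "0 \<le> 2 + (eval_sq a + 1) / v" using S[OF a] v by simp
  fix g y assume g: "T.len_Cauchy g" and lim: "\<forall>l\<in>pt_eval ` space M. (\<lambda>n. l (g n)) \<longlonglongrightarrow> 0" and y: "y \<in> wl2 wt"
  note gm = T.len_Cauchy_mem[OF g]
  have "N.len_Cauchy g"
    by (rule len_Cauchy_map[where T = "\<lambda>x. x", OF T.herm_form_axioms N.herm_form_axioms _ refl c NT g])
  then obtain x where x: "x \<in> wl2 wt" "(\<lambda>n. N.len (\<lambda>\<nu>. g n \<nu> - x \<nu>)) \<longlonglongrightarrow> 0"
    using diag_complete[of \<beta> g, OF pos] unfolding wl by blast
  have pe0: "pt_eval z x = 0" if z: "z \<in> space M" for z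
  proof -
    let ?c = "sqrt (1 + (eval_sq z + 1) / v)"
    have "cmod (pt_eval z d) \<le> ?c * N.len d" if d: "d \<in> wl2 wt" for d
    proof -
      have "(cmod (pt_eval z d))\<^sup>2 \<le> (1 + (eval_sq z + 1) / v) * Re (diag \<beta> d d)"
        unfolding N[OF d] pform_self
        by (rule norm_sq_perturb[OF _ S[OF z] v])
          (use pt_eval_coord_diff[OF d z] in \<open>simp add: norm_minus_commute\<close>)
      then show ?thesis unfolding N.len_def real_sqrt_mult[symmetric] by (rule real_le_rsqrt)
    qed
    then have "\<forall>\<^sub>F n in sequentially. norm (pt_eval z (\<lambda>\<nu>. g n \<nu> - x \<nu>)) \<le> ?c * N.len (\<lambda>\<nu>. g n \<nu> - x \<nu>)"
      using N.diff_mem[OF gm x(1)] by simp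
    then have 1: "(\<lambda>n. pt_eval z (\<lambda>\<nu>. g n \<nu> - x \<nu>)) \<longlonglongrightarrow> 0"
      by (rule Lim_null_comparison) (rule tendsto_mult_right_zero[OF x(2)])
    have "pt_eval z (\<lambda>\<nu>. g n \<nu> - x \<nu>) = pt_eval z (g n) - pt_eval z x" for n
      using pt_eval_diag[OF _ z] gm[of n] x(1) N.diff_mem[OF gm x(1), of n] D.diff_left[OF gm x(1) eval_vec_mem[OF z], of n]
      by simp
    moreover have "(\<lambda>n. pt_eval z (g n)) \<longlonglongrightarrow> 0" using lim z by blast
    ultimately have "(\<lambda>n. pt_eval z (g n) - (pt_eval z (g n) - pt_eval z x)) \<longlonglongrightarrow> 0 - 0"
      using 1 by (intro tendsto_diff) simp_all
    then show ?thesis by (simp add: LIMSEQ_const_iff)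
  qed
  \<comment> \<open>All these weights are at least 1, so the limit is square summable and its
    expansion is a series in \<open>L_2\<close>.\<close>
  have "x \<in> wl2 ((\<lambda>\<nu>. \<alpha> \<nu> 1)(0 := 1))" using x(1) by (simp only: wl2_upd wl2_wt)
  then have "x \<in> wl2 (\<lambda>_. 1)"
  proof (rule wl2_mono[where C = 1])
    show "1 \<le> 1 * ((\<lambda>\<nu>. \<alpha> \<nu> 1)(0 := 1)) \<nu>" for \<nu>
      using \<alpha>_ge(3)[of \<nu> 1] by (cases "\<nu> = 0") simp_all
  qed simp
  then have "x = (\<lambda>_. 0)"
    by (rule pointwise_zero_imp_zero) (use pt_eval_sums[OF x(1)] pe0 in metis)
  then have Ng: "(\<lambda>n. N.len (g n)) \<longlonglongrightarrow> 0" using x(2) by simp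
  have "T.len x \<le> sqrt (2 + (eval_sq a + 1) / v) * N.len x" if "x \<in> wl2 wt" for x
    using real_sqrt_le_mono[OF TN[OF that]] by (simp add: T.len_def N.len_def real_sqrt_mult[symmetric])
  then have "\<forall>\<^sub>F n in sequentially. norm (T.len (g n)) \<le> sqrt (2 + (eval_sq a + 1) / v) * N.len (g n)"
    using gm T.len_nonneg[OF gm] by simp
  then have "(\<lambda>n. T.len (g n)) \<longlonglongrightarrow> 0"
    by (rule Lim_null_comparison) (rule tendsto_mult_right_zero[OF Ng])
  then show "(\<lambda>n. pform wt (pt_eval a) v (g n) y) \<longlonglongrightarrow> 0" by (rule T.len_null_imp_null[OF gm y])
qed

lemma L2_factors: "tensor_factors (e 0) (\<lambda>_. L2_space K M) \<phi> (\<lambda>_. wl2 (\<lambda>_. 1)) (\<lambda>_. diag (\<lambda>_. 1))"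
  by (rule diag_factors) (auto simp: L2_space_def fcoef_wl2_one e_L2 Parseval)

text \<open>The chain \<open>V\<^sup>c \<rightarrow> V \<rightarrow> V\<^sup>1\<^sup>/\<^sup>c \<rightarrow> L\<^sub>2\<close> for \<open>c = 1 / 2\<close>; the functional that belongs to the unit vector of
  \<open>V\<^sup>1\<^sup>/\<^sup>c\<close> is the evaluation at \<open>a\<close>, which is unbounded on \<open>L\<^sub>2\<close>, so that the last embedding is factored
  through a space \<open>Z\<close> of the same type as \<open>V\<close>.\<close>

lemma embedding_chain:
  assumes C: "C \<subseteq> C1" "e 0 \<in> C"
    and w: "\<And>j. 1 \<le> j \<Longrightarrow> 0 < w j" "\<And>j. 1 \<le> j \<Longrightarrow> 1 / w j \<le> gam \<alpha> j"
    and V: "\<And>j. carr (V j) = C" "\<And>j f g. 1 \<le> j \<Longrightarrow> f \<in> C \<Longrightarrow> g \<in> C \<Longrightarrow>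
        ip (V j) f g = pform wt (\<lambda>x. x 0) (w j) (\<phi> f) (\<phi> g)"
    and Vc: "\<And>c j. carr (Vc c j) = C" "\<And>c j f g. 1 \<le> j \<Longrightarrow> f \<in> C \<Longrightarrow> g \<in> C \<Longrightarrow>
        ip (Vc c j) f g = pform wt (pt_eval a) (w j / c) (\<phi> f) (\<phi> g)"
  shows "tensor_embeds K (e 0) (Vc (1 / 2)) V" "tensor_embeds K (e 0) V (Vc 2)"
    "tensor_embeds K (e 0) (Vc 2) (\<lambda>_. L2_space K M)"
    "tensor_rkhs K (e 0) (pt_val M e) (space M) (Vc 2)"
proof -
  \<comment> \<open>One more halving of the weights \<open>w j / 2\<close> of \<open>Vc 2\<close>
    pays for the return from the evaluation at \<open>a\<close> to the zeroth coordinate.\<close>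
  define Z where "Z j = \<lparr>carr = C, ip = \<lambda>f g. pform wt (\<lambda>x. x 0) (1/2 * (1/2 * w j)) (\<phi> f) (\<phi> g)\<rparr>" for j
  have lin: "linear_on (wl2 wt) (\<lambda>x. x 0)" "linear_on (wl2 wt) (pt_eval a)"
    by (rule linear_coord, rule linear_pt_eval[OF a])
  have unit: "\<phi> (e 0) 0 = 1" "pt_eval a (\<phi> (e 0)) = 1"
    by (simp add: fcoef_e, rule pt_eval_unit[OF a])
  have ortho: "diag wt x (\<phi> (e 0)) = 0" for x unfolding coef_unit by (simp add: wt_def)
  have S: "0 < eval_sq a + 1" using eval_sq_nonneg[OF a] by simp
  have diff: "(cmod (x 0 - pt_eval a x))\<^sup>2 \<le> (eval_sq a + 1) * Re (diag wt x x)"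
    "(cmod (pt_eval a x - x 0))\<^sup>2 \<le> (eval_sq a + 1) * Re (diag wt x x)" if "x \<in> wl2 wt" for x
    using pt_eval_coord_diff[OF that a] by (simp_all add: norm_minus_commute)
  have sw: "(\<lambda>j. 1 / w j) summable_on {1..}"
    by (rule summable_on_comparison_test[OF gam_summable]) (use w in \<open>auto intro: less_imp_le\<close>)
  have fVc2: "tensor_factors (e 0) (Vc 2) \<phi> (\<lambda>j. wl2 wt) (\<lambda>j. pform wt (pt_eval a) (1/2 * w j))"
    by (rule pform_factors) (use C w(1) lin unit Vc in auto)
  have fVch: "tensor_factors (e 0) (Vc (1 / 2)) \<phi> (\<lambda>j. wl2 wt) (\<lambda>j. pform wt (pt_eval a) (2 * w j))"
    by (rule pform_factors) (use C w(1) lin unit Vc in \<open>auto simp: mult.commute\<close>)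
  have fV: "tensor_factors (e 0) V \<phi> (\<lambda>j. wl2 wt) (\<lambda>j. pform wt (\<lambda>x. x 0) (w j))"
    by (rule pform_factors) (use C w(1) lin unit V in auto)
  have fZ: "tensor_factors (e 0) Z \<phi> (\<lambda>j. wl2 wt) (\<lambda>j. pform wt (\<lambda>x. x 0) (1/2 * (1/2 * w j)))"
    by (rule pform_factors) (use C w(1) lin unit in \<open>auto simp: Z_def\<close>)
  show "tensor_embeds K (e 0) (Vc (1 / 2)) V"
  proof (rule twisted_embeds[OF K fVch _ _ wt_nonneg lin(2,1) S diff(2), where \<theta> = "1/2"])
    show "tensor_factors (e 0) V \<phi> (\<lambda>j. wl2 wt) (\<lambda>j. pform wt (\<lambda>x. x 0) (1/2 * (2 * w j)))"
      using fV by simp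
    show "(\<lambda>j. 1 / (2 * w j)) summable_on {1..}"
      using summable_on_cmult_right[OF sw, of "1/2"] by simp
  qed (use w(1) V Vc unit ortho in auto)
  show "tensor_embeds K (e 0) V (Vc 2)"
    by (rule twisted_embeds[OF K fV fVc2 _ wt_nonneg lin S diff(1) w(1) sw])
      (use V Vc unit ortho in auto)
  have VZ: "tensor_embeds K (e 0) (Vc 2) Z"
  proof (rule twisted_embeds[OF K fVc2 fZ _ wt_nonneg lin(2,1) S diff(2)])
    show "(\<lambda>j. 1 / (1/2 * w j)) summable_on {1..}"
      using summable_on_cmult_right[OF sw, of 2] by simp
  qed (use w(1) Vc unit ortho in \<open>auto simp: Z_def\<close>)
  have ZL: "tensor_embeds K (e 0) Z (\<lambda>_. L2_space K M)"
  \<comment> \<open>For \<open>\<nu> \<ge> 1\<close> the weights of \<open>Z\<close> are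
    \<open>w j / 4 * \<alpha> \<nu> 1\<close> with \<open>\<alpha> \<nu> 1 > 1\<close>, so
    \<open>4 / w j\<close> times them exceeds 1; the summand 1 takes care of index 0.\<close>
  proof (rule diag_embeds[OF K _ L2_factors, where \<beta> = "\<lambda>j. (\<lambda>\<nu>. 1/2 * (1/2 * w j) * \<alpha> \<nu> 1)(0 := 1)"
        and C = "\<lambda>j. 1 + 4 * (1 / w j)"])
    have pos: "0 < ((\<lambda>\<nu>. 1/2 * (1/2 * w j) * \<alpha> \<nu> 1)(0 := 1)) \<nu>" if "1 \<le> j" for j \<nu>
      using w(1)[OF that] \<alpha>_ge(3)[of \<nu> 1] by (cases "\<nu> = 0") simp_all
    then show "0 < ((\<lambda>\<nu>. 1/2 * (1/2 * w j) * \<alpha> \<nu> 1)(0 := 1)) \<nu>" if "1 \<le> j" for j \<nu> using that .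
    show "tensor_factors (e 0) Z \<phi> (\<lambda>j. wl2 ((\<lambda>\<nu>. 1/2 * (1/2 * w j) * \<alpha> \<nu> 1)(0 := 1)))
        (\<lambda>j. diag ((\<lambda>\<nu>. 1/2 * (1/2 * w j) * \<alpha> \<nu> 1)(0 := 1)))"
    proof (rule diag_factors[OF _ _ pos])
      fix j :: nat assume j: "1 \<le> j"
      have wj: "0 < 1/2 * (1/2 * w j)" using w(1)[OF j] by simp
      have m: "\<phi> f \<in> wl2 wt" if "f \<in> C" for f using coef_wl2[of f 1] C(1) that by (auto simp: wl2_wt)
      show "\<phi> ` carr (Z j) \<subseteq> wl2 ((\<lambda>\<nu>. 1/2 * (1/2 * w j) * \<alpha> \<nu> 1)(0 := 1))"
        unfolding wl2_upd wl2_scale[OF wj] wl2_wt[symmetric] using m by (auto simp: Z_def)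
      show "e 0 \<in> carr (Z j)" using C by (simp add: Z_def)
      fix f g assume "f \<in> carr (Z j)" "g \<in> carr (Z j)"
      then show "ip (Z j) f g = diag ((\<lambda>\<nu>. 1/2 * (1/2 * w j) * \<alpha> \<nu> 1)(0 := 1)) (\<phi> f) (\<phi> g)"
        using pform_coord_diag[OF wj m m, of f g] by (simp add: Z_def)
    qed auto
    show "1 \<le> (1 + 4 * (1 / w j)) * ((\<lambda>\<nu>. 1/2 * (1/2 * w j) * \<alpha> \<nu> 1)(0 := 1)) \<nu>" if "1 \<le> j" for j \<nu>
    proof (cases "\<nu> = 0")
      case True
      then show ?thesis using w(1)[OF that] by simp
    next
      case False
      then have "1 < \<alpha> \<nu> 1" using \<alpha>_ge(3)[of \<nu> 1] by simp
      then have "1 \<le> w j / 4 * \<alpha> \<nu> 1 + \<alpha> \<nu> 1" using w(1)[OF that] by (simp add: add_nonneg_pos less_imp_le pos_add_strict)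
      also have "\<dots> = (1 + 4 * (1 / w j)) * (1/2 * (1/2 * w j) * \<alpha> \<nu> 1)"
        using w(1)[OF that] by (simp add: field_simps)
      finally show ?thesis using False by simp
    qed
    show "bounded_prods (\<lambda>j. 1 + 4 * (1 / w j))"
      using w(1) by (intro bounded_prods_summable summable_on_cmult_right sw) (auto intro: less_imp_le)
  qed (use C(1) H_set_L2 in \<open>auto simp: Z_def L2_space_def fcoef_e\<close>)
  show "tensor_embeds K (e 0) (Vc 2) (\<lambda>_. L2_space K M)"
    by (rule tensor_embeds_trans[OF VZ ZL K fVc2 fZ])
  show "tensor_rkhs K (e 0) (pt_val M e) (space M) (Vc 2)"
  proof (rule tensor_rkhsI[OF K fVc2, where pt_eval = pt_eval and a = a])
    show "pt_val M e f y = pt_eval y (\<phi> f)" for f y by (simp add: pt_val_def pt_eval_def fcoef_def)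
    show "pform wt (pt_eval a) (1/2 * w j) x (\<phi> (e 0)) = pt_eval a x" for j x by (simp add: pform_def unit ortho)
    show "separating (wl2 wt) (pform wt (pt_eval a) (1/2 * w j)) (pt_eval ` space M)" if "1 \<le> j" for j
      using w(1)[OF that] by (intro separating_pt_eval) simp
    fix y :: "nat \<Rightarrow> 'd" assume y: "y \<in> {1..} \<rightarrow>\<^sub>E space M"
    have yj: "y j \<in> space M" if "1 \<le> j" for j using y that by (auto simp: PiE_iff)
    let ?S = "\<lambda>j. 2 * (eval_sq (y j) + eval_sq a) + 1"
    have S': "0 < ?S j" if "1 \<le> j" for j using eval_sq_nonneg[OF yj[OF that]] eval_sq_nonneg[OF a] by simp
    show "\<exists>C. bounded_prods C \<and> (\<forall>j\<ge>1. \<forall>x\<in>wl2 wt.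
        (cmod (pt_eval (y j) x))\<^sup>2 \<le> C j * Re (pform wt (pt_eval a) (1/2 * w j) x x))"
    proof (intro exI[of _ "\<lambda>j. 1 + ?S j / (1/2 * w j)"] conjI allI impI ballI)
      show "bounded_prods (\<lambda>j. 1 + ?S j / (1/2 * w j))"
      proof (rule bounded_prods_summable)
        \<comment> \<open>The majorant arises from \<open>1 / w j \<le> gam \<alpha> j\<close>. Its
          first part is summable by the kernel hypothesis at \<open>y\<close>, its second by
          \<open>gam_summable\<close>.\<close>
        have "(\<lambda>j. 4 * (gam \<alpha> j * eval_sq (y j)) + (4 * eval_sq a + 2) * gam \<alpha> j) summable_on {1..}"
          by (intro summable_on_add summable_on_cmult_right gam_eval_sq_summable[OF y] gam_summable)
        then show "(\<lambda>j. ?S j / (1/2 * w j)) summable_on {1..}"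
        proof (rule summable_on_comparison_test)
          fix j :: nat assume "j \<in> {1..}"
          then have j: "1 \<le> j" by simp
          show "0 \<le> ?S j / (1/2 * w j)" using S'[OF j] w(1)[OF j] by simp
          have "?S j / (1/2 * w j) = 2 * ?S j * (1 / w j)" by simp
          also have "\<dots> \<le> 2 * ?S j * gam \<alpha> j" using S'[OF j] by (intro mult_left_mono w(2)[OF j]) simp
          also have "\<dots> = 4 * (gam \<alpha> j * eval_sq (y j)) + (4 * eval_sq a + 2) * gam \<alpha> j" by (simp add: algebra_simps)
          finally show "?S j / (1/2 * w j) \<le> 4 * (gam \<alpha> j * eval_sq (y j)) + (4 * eval_sq a + 2) * gam \<alpha> j" .
        qed
        show "0 \<le> ?S j / (1/2 * w j)" if "1 \<le> j" for j using S'[OF that] w(1)[OF that] by simp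
      qed
      fix j :: nat and x assume j: "1 \<le> j" and x: "x \<in> wl2 wt"
      show "(cmod (pt_eval (y j) x))\<^sup>2 \<le> (1 + ?S j / (1/2 * w j)) * Re (pform wt (pt_eval a) (1/2 * w j) x x)"
        unfolding pform_self using w(1)[OF j] by (intro norm_sq_perturb[OF pt_eval_diff[OF x yj[OF j]] S'[OF j]]) simp
    qed
  qed (use a linear_pt_eval pt_eval_unit in auto)
qed

section \<open>The chains for \<open>F\<close> and \<open>G\<close>\<close>

lemma F_chain:
  "tensor_embeds K (e 0) (Fc_space K M e \<alpha> a (1 / 2)) (F_space K M e \<alpha>) \<and>
    tensor_embeds K (e 0) (F_space K M e \<alpha>) (Fc_space K M e \<alpha> a 2) \<and>
    tensor_embeds K (e 0) (Fc_space K M e \<alpha> a 2) (\<lambda>_. L2_space K M) \<and>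
    tensor_rkhs K (e 0) (pt_val M e) (space M) (Fc_space K M e \<alpha> a 2)"
proof -
  have d: "diag wt (\<phi> f) (\<phi> g) = of_real (\<alpha> 1 1) * \<phi> f 1 * cnj (\<phi> g 1)" if "f \<in> span01 K e" for f g
    using span01_diag[OF that, of wt "\<phi> g"] by (simp add: wt_def)
  have ip: "ip0 M f (e \<nu>) = \<phi> f \<nu>" "ip0 M (e \<nu>) g = cnj (\<phi> g \<nu>)" if "g \<in> span01 K e" for f g \<nu>
    using ip0_e[OF L2_fun_UNIV[OF span01_coef(1)[OF that]]] by (simp_all add: fcoef_def)
  have pv: "pt_val M e f a = pt_eval a (\<phi> f)" for f by (simp add: pt_val_def pt_eval_def fcoef_def)
  note chain = embedding_chain[of "span01 K e" "\<lambda>j. \<alpha> 1 j / \<alpha> 1 1" "F_space K M e \<alpha>" "Fc_space K M e \<alpha> a"]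
  have 1: "span01 K e \<subseteq> C1" using span01_H by blast
  \<comment> \<open>\<open>diag wt\<close> already contains the weight \<open>\<alpha> 1 1\<close>
    at index 1, hence the quotient. Its reciprocal is the term \<open>\<nu> = 1\<close> of the
    supremum that defines \<open>gam \<alpha> j\<close>.\<close>
  have 2: "0 < \<alpha> 1 j / \<alpha> 1 1" "1 / (\<alpha> 1 j / \<alpha> 1 1) \<le> gam \<alpha> j" if "1 \<le> j" for j
    using \<alpha>_ge(4)[of 1 j] \<alpha>11 gam_ge[of 1 j] that by simp_all
  have 3: "ip (F_space K M e \<alpha> j) f g = pform wt (\<lambda>x. x 0) (\<alpha> 1 j / \<alpha> 1 1) (\<phi> f) (\<phi> g)"
    if "f \<in> span01 K e" "g \<in> span01 K e" for j f g
    using \<alpha>11 by (simp add: F_space_def pform_def ip[OF that(2)] d[OF that(1)])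
  have 4: "ip (Fc_space K M e \<alpha> a c j) f g = pform wt (pt_eval a) (\<alpha> 1 j / \<alpha> 1 1 / c) (\<phi> f) (\<phi> g)"
    if "f \<in> span01 K e" "g \<in> span01 K e" for c j f g
    using \<alpha>11 by (simp add: Fc_space_def pform_def pv ip[OF that(2)] d[OF that(1)])
  have carr: "carr (F_space K M e \<alpha> j) = span01 K e" "carr (Fc_space K M e \<alpha> a c j) = span01 K e" for c j
    by (simp_all add: F_space_def Fc_space_def)
  show ?thesis
    using chain[OF 1 e_mem_span01 2 carr(1) 3 carr(2) 4] by blast
qed

lemma G_ip:
  assumes "1 \<le> j" "g \<in> C1"
  shows "ip (G_space K M e \<alpha> j) f g = pform wt (\<lambda>x. x 0) (1 / gam \<alpha> j) (\<phi> f) (\<phi> g)"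
  using wsum_diag[OF H_set_L2[OF assms(2)], of 1 f] ip0_e[OF L2_fun_UNIV[OF H_set_L2[OF assms(2)]], of 0]
  by (simp add: G_space_def pform_def wt_def fcoef_def)

lemma G_chain:
  "tensor_embeds K (e 0) (Gc_space K M e \<alpha> a (1 / 2)) (G_space K M e \<alpha>) \<and>
    tensor_embeds K (e 0) (G_space K M e \<alpha>) (Gc_space K M e \<alpha> a 2) \<and>
    tensor_embeds K (e 0) (Gc_space K M e \<alpha> a 2) (\<lambda>_. L2_space K M) \<and>
    tensor_rkhs K (e 0) (pt_val M e) (space M) (Gc_space K M e \<alpha> a 2)"
proof -
  have pv: "pt_val M e f a = pt_eval a (\<phi> f)" for f by (simp add: pt_val_def pt_eval_def fcoef_def)
  note chain = embedding_chain[of C1 "\<lambda>j. 1 / gam \<alpha> j" "G_space K M e \<alpha>" "Gc_space K M e \<alpha> a"]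
  have 2: "0 < 1 / gam \<alpha> j" "1 / (1 / gam \<alpha> j) \<le> gam \<alpha> j" if "1 \<le> j" for j
    using gam_pos[OF that] by simp_all
  have 4: "ip (Gc_space K M e \<alpha> a c j) f g = pform wt (pt_eval a) (1 / gam \<alpha> j / c) (\<phi> f) (\<phi> g)"
    if "g \<in> C1" for c j f g
    using wsum_diag[OF H_set_L2[OF that], of 1 f] by (simp add: Gc_space_def pform_def pv wt_def mult.commute)
  have carr: "carr (G_space K M e \<alpha> j) = C1" "carr (Gc_space K M e \<alpha> a c j) = C1" for c j
    by (simp_all add: G_space_def Gc_space_def)
  show ?thesis
    using chain[OF order_refl e_mem 2 carr(1) G_ip carr(2) 4] by blast
qed

section \<open>The embeddings of \<open>F\<close> into \<open>H\<close> and of \<open>H\<close> into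
  \<open>G\<close>\<close>

lemma H_weights:
  assumes "1 \<le> j"
  shows "0 < ((\<lambda>\<nu>. \<alpha> \<nu> j)(0 := 1)) \<nu>"
  using \<alpha>_ge(4)[of \<nu> j] assms by (cases "\<nu> = 0") simp_all

lemma H_split:
  assumes "1 \<le> j" "f \<in> H_set K M e \<alpha> j" "g \<in> H_set K M e \<alpha> j"
  shows "diag ((\<lambda>\<nu>. \<alpha> \<nu> j)(0 := 1)) (\<phi> f) (\<phi> g)
    = \<phi> f 0 * cnj (\<phi> g 0) + diag ((\<lambda>\<nu>. \<alpha> \<nu> j)(0 := 0)) (\<phi> f) (\<phi> g)"
proof -
  let ?\<beta> = "(\<lambda>\<nu>. \<alpha> \<nu> j)(0 := 1)"
  have m: "\<phi> f \<in> wl2 ?\<beta>" "\<phi> g \<in> wl2 ?\<beta>" using coef_wl2 assms(2,3) by (simp_all only: wl2_upd)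
  have "diag (?\<beta>(0 := 1)) (\<phi> f) (\<phi> g) = of_real 1 * \<phi> f 0 * cnj (\<phi> g 0) + diag (?\<beta>(0 := 0)) (\<phi> f) (\<phi> g)"
    by (rule diag_split[OF less_imp_le[OF H_weights[OF assms(1)]] _ m]) simp
  then show ?thesis by simp
qed

lemma H_factors:
  "tensor_factors (e 0) (H_space K M e \<alpha>) \<phi> (\<lambda>j. wl2 ((\<lambda>\<nu>. \<alpha> \<nu> j)(0 := 1)))
    (\<lambda>j. diag ((\<lambda>\<nu>. \<alpha> \<nu> j)(0 := 1)))"
proof (rule diag_factors[OF _ _ H_weights])
  fix j :: nat assume j: "1 \<le> j"
  show "\<phi> ` carr (H_space K M e \<alpha> j) \<subseteq> wl2 ((\<lambda>\<nu>. \<alpha> \<nu> j)(0 := 1))"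
    unfolding wl2_upd using coef_wl2 by (auto simp: H_space_def)
  show "e 0 \<in> carr (H_space K M e \<alpha> j)" using span01_H[OF e_mem_span01] by (simp add: H_space_def)
  fix f g assume "f \<in> carr (H_space K M e \<alpha> j)" "g \<in> carr (H_space K M e \<alpha> j)"
  then have fg: "f \<in> H_set K M e \<alpha> j" "g \<in> H_set K M e \<alpha> j" by (simp_all add: H_space_def)
  show "ip (H_space K M e \<alpha> j) f g = diag ((\<lambda>\<nu>. \<alpha> \<nu> j)(0 := 1)) (\<phi> f) (\<phi> g)"
    unfolding H_split[OF j fg] using wsum_diag[OF H_set_L2[OF fg(2)], of j f]
      ip0_e[OF L2_fun_UNIV[OF H_set_L2[OF fg(2)]], of 0]
    by (simp add: H_space_def fcoef_def)
qed simp_all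

text \<open>In each slot \<open>F\<close> carries the restriction of the inner product of
  \<open>H\<close>, so the constants are 1 and both can use the same coordinate space.\<close>

lemma F_H: "tensor_embeds K (e 0) (F_space K M e \<alpha>) (H_space K M e \<alpha>)"
proof (rule diag_embeds[OF K _ H_factors, where C = "\<lambda>_. 1"])
  show "tensor_factors (e 0) (F_space K M e \<alpha>) \<phi> (\<lambda>j. wl2 ((\<lambda>\<nu>. \<alpha> \<nu> j)(0 := 1)))
      (\<lambda>j. diag ((\<lambda>\<nu>. \<alpha> \<nu> j)(0 := 1)))"
  proof (rule diag_factors[OF _ _ H_weights])
    fix j :: nat assume j: "1 \<le> j"
    show "\<phi> ` carr (F_space K M e \<alpha> j) \<subseteq> wl2 ((\<lambda>\<nu>. \<alpha> \<nu> j)(0 := 1))"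
      unfolding wl2_upd using coef_wl2[OF span01_H] by (auto simp: F_space_def)
    show "e 0 \<in> carr (F_space K M e \<alpha> j)" using e_mem_span01 by (simp add: F_space_def)
    fix f g assume "f \<in> carr (F_space K M e \<alpha> j)" "g \<in> carr (F_space K M e \<alpha> j)"
    then have fg: "f \<in> span01 K e" "g \<in> span01 K e" by (simp_all add: F_space_def)
    show "ip (F_space K M e \<alpha> j) f g = diag ((\<lambda>\<nu>. \<alpha> \<nu> j)(0 := 1)) (\<phi> f) (\<phi> g)"
      unfolding H_split[OF j span01_H[OF fg(1)] span01_H[OF fg(2)]]
      using span01_diag[OF fg(1), of "(\<lambda>\<nu>. \<alpha> \<nu> j)(0 := 0)" "\<phi> g"]
        ip0_e[OF L2_fun_UNIV[OF span01_coef(1)[OF fg(2)]]]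
      by (simp add: F_space_def fcoef_def)
  qed simp_all
qed (use span01_H H_weights fcoef_e in \<open>auto simp: F_space_def H_space_def\<close>)

text \<open>The normalisation by \<open>gam \<alpha> j\<close> is what makes all constants 1: being
  a supremum, it yields \<open>\<alpha> \<nu> 1 / gam \<alpha> j \<le> \<alpha> \<nu> j\<close> for
  every \<open>\<nu> \<ge> 1\<close>.\<close>

lemma H_G: "tensor_embeds K (e 0) (H_space K M e \<alpha>) (G_space K M e \<alpha>)"
proof (rule diag_embeds[OF K H_factors, where C = "\<lambda>_. 1" and \<beta>' = "\<lambda>j. (\<lambda>\<nu>. 1 / gam \<alpha> j * \<alpha> \<nu> 1)(0 := 1)"])
  have pos: "0 < ((\<lambda>\<nu>. 1 / gam \<alpha> j * \<alpha> \<nu> 1)(0 := 1)) \<nu>" if "1 \<le> j" for j \<nu>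
    using gam_pos[OF that] \<alpha>_ge(3)[of \<nu> 1] by (cases "\<nu> = 0") simp_all
  then show "0 < ((\<lambda>\<nu>. 1 / gam \<alpha> j * \<alpha> \<nu> 1)(0 := 1)) \<nu>" if "1 \<le> j" for j \<nu> using that .
  show "tensor_factors (e 0) (G_space K M e \<alpha>) \<phi> (\<lambda>j. wl2 ((\<lambda>\<nu>. 1 / gam \<alpha> j * \<alpha> \<nu> 1)(0 := 1)))
      (\<lambda>j. diag ((\<lambda>\<nu>. 1 / gam \<alpha> j * \<alpha> \<nu> 1)(0 := 1)))"
  proof (rule diag_factors[OF _ _ pos])
    fix j :: nat assume j: "1 \<le> j"
    have wj: "0 < 1 / gam \<alpha> j" using gam_pos[OF j] by simp
    have m: "\<phi> f \<in> wl2 wt" if "f \<in> C1" for f using coef_wl2[OF that] by (simp add: wl2_wt)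
    show "\<phi> ` carr (G_space K M e \<alpha> j) \<subseteq> wl2 ((\<lambda>\<nu>. 1 / gam \<alpha> j * \<alpha> \<nu> 1)(0 := 1))"
      unfolding wl2_upd wl2_scale[OF wj] wl2_wt[symmetric] using m by (auto simp: G_space_def)
    show "e 0 \<in> carr (G_space K M e \<alpha> j)" using e_mem by (simp add: G_space_def)
    fix f g assume "f \<in> carr (G_space K M e \<alpha> j)" "g \<in> carr (G_space K M e \<alpha> j)"
    then have fg: "f \<in> C1" "g \<in> C1" by (simp_all add: G_space_def)
    show "ip (G_space K M e \<alpha> j) f g = diag ((\<lambda>\<nu>. 1 / gam \<alpha> j * \<alpha> \<nu> 1)(0 := 1)) (\<phi> f) (\<phi> g)"
      unfolding G_ip[OF j fg(2)] by (rule pform_coord_diag[OF wj m[OF fg(1)] m[OF fg(2)]])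
  qed simp_all
  show "((\<lambda>\<nu>. 1 / gam \<alpha> j * \<alpha> \<nu> 1)(0 := 1)) \<nu> \<le> 1 * ((\<lambda>\<nu>. \<alpha> \<nu> j)(0 := 1)) \<nu>" if j: "1 \<le> j" for j \<nu>
    using gam_ge[OF _ j, of \<nu>] gam_pos[OF j] \<alpha>_ge(4)[OF _ j, of \<nu>]
    by (cases "\<nu> = 0") (simp_all add: field_simps)
qed (use H_set_mono H_weights fcoef_e in \<open>auto simp: H_space_def G_space_def\<close>)

end

theorem theorem3p19:
  fixes K :: "complex set" and M :: "'d measure" and e :: "nat \<Rightarrow> 'd \<Rightarrow> complex"
    and \<alpha> :: "nat \<Rightarrow> nat \<Rightarrow> real" and a :: 'd
  assumes "K = \<real> \<or> K = UNIV"
    and "prob_space M"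
    and "onb K M e"
    and "\<forall>x\<in>space M. e 0 x = 1"
    and "\<forall>\<nu>\<ge>1. \<forall>j\<ge>1. \<alpha> \<nu> j \<ge> max (\<alpha> \<nu> 1) (\<alpha> 1 j)"
    and "\<alpha> 1 1 > 1"
    and "a \<in> space M"
    and "G_is_rkhs M e \<alpha>"
  shows "\<exists>c\<^sub>0. 0 < c\<^sub>0 \<and> c\<^sub>0 < 1 \<and>
    tensor_embeds K (e 0) (Fc_space K M e \<alpha> a c\<^sub>0) (F_space K M e \<alpha>) \<and>
    tensor_embeds K (e 0) (F_space K M e \<alpha>) (Fc_space K M e \<alpha> a (1 / c\<^sub>0)) \<and>
    tensor_embeds K (e 0) (Fc_space K M e \<alpha> a (1 / c\<^sub>0)) (\<lambda>_. L2_space K M) \<and>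
    tensor_embeds K (e 0) (Gc_space K M e \<alpha> a c\<^sub>0) (G_space K M e \<alpha>) \<and>
    tensor_embeds K (e 0) (G_space K M e \<alpha>) (Gc_space K M e \<alpha> a (1 / c\<^sub>0)) \<and>
    tensor_embeds K (e 0) (Gc_space K M e \<alpha> a (1 / c\<^sub>0)) (\<lambda>_. L2_space K M) \<and>
    tensor_embeds K (e 0) (F_space K M e \<alpha>) (H_space K M e \<alpha>) \<and>
    tensor_embeds K (e 0) (H_space K M e \<alpha>) (G_space K M e \<alpha>) \<and>
    tensor_rkhs K (e 0) (pt_val M e) (space M) (Fc_space K M e \<alpha> a (1 / c\<^sub>0)) \<and>
    tensor_rkhs K (e 0) (pt_val M e) (space M) (Gc_space K M e \<alpha> a (1 / c\<^sub>0))"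
proof -
  interpret weighted_L2 K M e \<alpha> a
    using assms by unfold_locales auto
  have "1 / (1 / 2) = (2 :: real)" by simp
  then show ?thesis
    using F_chain G_chain F_H H_G by (intro exI[of _ "1 / 2"]) (simp only:, simp)
qed

end
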